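(* Let $\delta\in(0,\pi)$ and let $k_\delta$ be a positive integer. Any shape in $\mathcal{K}(d,\delta,k_\delta)$ can be determined using the $\operatorname{ECT}$ or the $\operatorname{PHT}$ using no more than $$\Delta(d,\delta,k_\delta)=\big((d-1)k_\delta+1\big)\Big(1+\frac{3}{\delta}\Big)^d+O\!\left(\frac{d^{d+1}k_\delta^{2d}}{\delta^{2d(d-1)}}\right)$$ directions, where $\delta$ and $k_\delta$ are determined by the Euler or homological critical values, respectively. That is, for the $\operatorname{ECT}$ (resp. the $\operatorname{PHT}$) and the corresponding Euler (resp. homological) version of $\mathcal{K}(d,\delta,k_\delta)$, there is a procedure which, for an unknown $K\in\mathcal{K}(d,\delta,k_\delta)$, queries the value $\operatorname{ECT}(K)(v)$ (resp. $\operatorname{PHT}(K)(v)$) at no more than $\Delta(d,\delta,k_\delta)$ directions $v\in S^{d-1}$, the choice of directions being allowed to depend on the answers to previous queries, and such that the answers uniquely determine $K$ as a subset of $\mathbb{R}^d$ among all elements of $\mathcal{K}(d,\delta,k_\delta)$.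
   Context: A shape is a finite geometric simplicial complex $K$ in $\mathbb{R}^d$: a finite set of geometric simplices closed under faces, any two meeting in the empty set or a common face. It is identified with the union of its simplices (different triangulations of the same subset are equivalent); $X$ denotes its vertex set. $B(v,\delta)\subset S^{d-1}$ is the ball of radius $\delta$ about $v$ in the geodesic metric. For $v\in S^{d-1}$: $h_v(y)=v\cdot y$ on $K$, $K_{v,t}=\{y\in K: y\cdot v\le t\}$, and $\operatorname{ECT}(K)(v)$ is the Euler curve $t\mapsto\chi(K_{v,t})$. With homology over a fixed field, $PH_k(K,h_v)$ is the unique finite multiset of off-diagonal points $(b,e)$, $b\in\{-\infty\}\cup\mathbb{R}$, $e\in\mathbb{R}\cup\{\infty\}$, $b<e$, such that for all $s\le t$ the rank of $H_k(K_{v,s})\to H_k(K_{v,t})$ equals the number of points in $[-\infty,s]\times(t,\infty]$; $\operatorname{PHT}(K)(v)=(PH_0(K,h_v),\dots,PH_{d-1}(K,h_v))$. Euler version. $t\in\mathbb{R}$ is an Euler critical value of $h_v$ if there is no open interval containing $t$ on which $\operatorname{ECT}(K)(v)$ is constant. A vertex $x$ is at least $\delta$-(Euler) observable if there is a ball $B(v_x,\delta)\subset S^{d-1}$ such that the Euler characteristic of the sublevel sets of $h_v$ changes at $v\cdot x$ (i.e. $v\cdot x$ is an Euler critical value of $h_v$) for all $v\in B(v_x,\delta)$. $\mathcal{K}(d,\delta,k_\delta)$ is the set of all embedded finite simplicial complexes $K$ in $\mathbb{R}^d$ such that (1) every vertex of $K$ is at least $\delta$-observable; (2) for all $v\in S^{d-1}$,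 the number of $x\in X$ for which $h_w(x)$ is an Euler critical value of $h_w$ for some $w\in B(v,\delta)$ is at most $k_\delta$. Homological version. $t$ is a homological regular value of $h_v$ if some open interval $I\ni t$ is such that for all $a<b$ in $I$ the inclusion $K_{v,a}\to K_{v,b}$ induces isomorphisms on homology; otherwise it is a homological critical value. A vertex $x$ is homology observable in direction $v$ if $\operatorname{PHT}(K)(v)$ contains an off-diagonal point with birth or death value $v\cdot x$, and at least $\delta$-homology observable if this holds for every direction in some ball $B(v_x,\delta)$. The homological version of $\mathcal{K}(d,\delta,k_\delta)$ is defined by (1) and (2) with "$\delta$-homology observable" and "homological critical value" in place of the Euler notions. The $O(\cdot)$ term denotes a quantity bounded by a constant depending only on $d$ times the displayed expression. *)

theory Defs
  imports
    "HOL-Analysis.Analysis"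
    "HOL-Homology.Homology"
    "HOL-Library.Multiset"
    "Jordan_Normal_Form.Missing_VectorSpace"
begin

text \<open>
  HOL-Homology provides singular homology with integer coefficients only.  The first section
  extends it to coefficients in a field \<open>F\<close>, given as a ring record so that statements can
  quantify over \<open>F\<close>; vector spaces and their dimension are those of the AFP entry VectorSpace.
\<close>

section \<open>Singular homology with coefficients in a field\<close>

type_synonym ('f, 'a) field_chain = "((nat \<Rightarrow> real) \<Rightarrow> 'a) \<Rightarrow> 'f"

definition chain_space :: "'f ring \<Rightarrow> nat \<Rightarrow> 'a topology \<Rightarrow> ('f, ('f, 'a) field_chain) module" where
  "chain_space F p X = (ring.func_space F UNIV)
     \<lparr>carrier := {c \<in> UNIV \<rightarrow> carrier F.
        finite {s. c s \<noteq> \<zero>\<^bsub>F\<^esub>} \<and> (\<forall>s. c s \<noteq> \<zero>\<^bsub>F\<^esub> \<longrightarrow> singular_simplex p X s)}\<rparr>"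

text \<open>
  The \<open>F\<close>-linear extension of the integral boundary: the integer
  \<open>lookup (chain_boundary p (frag_of r)) s\<close> is the coefficient of \<open>s\<close> in the boundary of the
  singular simplex \<open>r\<close>, and it acts on \<open>F\<close> as an integer multiple.  As in HOL-Homology, the
  boundary is zero in degree 0 (homology is not reduced).
\<close>

definition boundary_map :: "'f ring \<Rightarrow> nat \<Rightarrow> ('f, 'a) field_chain \<Rightarrow> ('f, 'a) field_chain" where
  "boundary_map F p c =
     (\<lambda>s. \<Oplus>\<^bsub>F\<^esub> r \<in> {r. c r \<noteq> \<zero>\<^bsub>F\<^esub>}.
            [Poly_Mapping.lookup (chain_boundary p (frag_of r)) s] \<cdot>\<^bsub>F\<^esub> c r)"

definition cycles :: "'f ring \<Rightarrow> nat \<Rightarrow> 'a topology \<Rightarrow> ('f, 'a) field_chain set" where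
  "cycles F p X = {c \<in> carrier (chain_space F p X). boundary_map F p c = (\<lambda>s. \<zero>\<^bsub>F\<^esub>)}"

definition boundaries :: "'f ring \<Rightarrow> nat \<Rightarrow> 'a topology \<Rightarrow> ('f, 'a) field_chain set" where
  "boundaries F p X = boundary_map F (Suc p) ` carrier (chain_space F (Suc p) X)"

text \<open>
  The quotient of cycles by boundaries, its elements being cosets.  The ring components
  \<open>mult\<close> and \<open>one\<close> of the module record play no role.
\<close>

definition homology_space ::
  "'f ring \<Rightarrow> nat \<Rightarrow> 'a topology \<Rightarrow> ('f, ('f, 'a) field_chain set) module" where
  "homology_space F p X =
     \<lparr>carrier = (\<lambda>z. boundaries F p X +>\<^bsub>chain_space F p X\<^esub> z) ` cycles F p X,
      monoid.mult = undefined,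
      one = undefined,
      zero = boundaries F p X,
      add = (\<lambda>U V. U <+>\<^bsub>chain_space F p X\<^esub> V),
      smult = (\<lambda>a U. \<Union>c\<in>U. boundaries F p X +>\<^bsub>chain_space F p X\<^esub> (a \<odot>\<^bsub>chain_space F p X\<^esub> c))\<rparr>"

definition betti :: "'f ring \<Rightarrow> nat \<Rightarrow> 'a topology \<Rightarrow> nat" where
  "betti F p X = vectorspace.dim F (homology_space F p X)"

text \<open>
  The map induced by the inclusion of a subspace \<open>X\<close> of \<open>Y\<close>: it sends the class of \<open>z\<close> in \<open>X\<close> to
  the class of \<open>z\<close> in \<open>Y\<close>.
\<close>

definition inclusion_map ::
  "'f ring \<Rightarrow> nat \<Rightarrow> 'a topology \<Rightarrow> ('f, 'a) field_chain set \<Rightarrow> ('f, 'a) field_chain set" where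
  "inclusion_map F p Y U = (\<Union>z\<in>U. boundaries F p Y +>\<^bsub>chain_space F p Y\<^esub> z)"

definition inclusion_rank :: "'f ring \<Rightarrow> nat \<Rightarrow> 'a topology \<Rightarrow> 'a topology \<Rightarrow> nat" where
  "inclusion_rank F p X Y = vectorspace.dim F
     ((homology_space F p Y)\<lparr>carrier := inclusion_map F p Y ` carrier (homology_space F p X)\<rparr>)"

definition inclusion_iso :: "'f ring \<Rightarrow> nat \<Rightarrow> 'a topology \<Rightarrow> 'a topology \<Rightarrow> bool" where
  "inclusion_iso F p X Y \<longleftrightarrow>
     bij_betw (inclusion_map F p Y) (carrier (homology_space F p X)) (carrier (homology_space F p Y))"

definition euler_char :: "'f ring \<Rightarrow> 'a topology \<Rightarrow> int" where
  "euler_char F X = (\<Sum>p | betti F p X \<noteq> 0. (- 1) ^ p * int (betti F p X))"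

section \<open>The Euler characteristic transform and the persistent homology transform\<close>

text \<open>
  Both transforms take the underlying subset \<open>S\<close> of a complex, so they do not depend on
  the triangulation.
\<close>

definition sublevel :: "(real ^ 'n) set \<Rightarrow> real ^ 'n \<Rightarrow> real \<Rightarrow> (real ^ 'n) topology" where
  "sublevel S v t = top_of_set {y \<in> S. y \<bullet> v \<le> t}"

definition ECT :: "'f ring \<Rightarrow> (real ^ 'n) set \<Rightarrow> real ^ 'n \<Rightarrow> real \<Rightarrow> int" where
  "ECT F S v = (\<lambda>t. euler_char F (sublevel S v t))"

text \<open>
  Note that \<open>b < e\<close> in the extended reals excludes \<open>b = \<infinity>\<close> and \<open>e = -\<infinity>\<close>, and that only real
  levels \<open>s\<close> and \<open>t\<close> are tested.
\<close>

definition is_persistence_diagram ::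
  "'f ring \<Rightarrow> nat \<Rightarrow> (real ^ 'n) set \<Rightarrow> real ^ 'n \<Rightarrow> (ereal \<times> ereal) multiset \<Rightarrow> bool" where
  "is_persistence_diagram F p S v D \<longleftrightarrow>
     (\<forall>(b, e) \<in> set_mset D. b < e) \<and>
     (\<forall>s t :: real. s \<le> t \<longrightarrow>
        inclusion_rank F p (sublevel S v s) (sublevel S v t) =
        size {# (b, e) \<in># D. b \<le> ereal s \<and> ereal t < e #})"

definition PH :: "'f ring \<Rightarrow> nat \<Rightarrow> (real ^ 'n) set \<Rightarrow> real ^ 'n \<Rightarrow> (ereal \<times> ereal) multiset" where
  "PH F p S v = (THE D. is_persistence_diagram F p S v D)"

definition PHT :: "'f ring \<Rightarrow> (real ^ 'n) set \<Rightarrow> real ^ 'n \<Rightarrow> (ereal \<times> ereal) multiset list" where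
  "PHT F S v = map (\<lambda>p. PH F p S v) [0..<CARD('n)]"

section \<open>Critical values, observability and the classes of complexes\<close>

definition euler_critical :: "'f ring \<Rightarrow> (real ^ 'n) set \<Rightarrow> real ^ 'n \<Rightarrow> real \<Rightarrow> bool" where
  "euler_critical F S v t \<longleftrightarrow>
     \<not> (\<exists>a b. a < t \<and> t < b \<and> ECT F S v constant_on {a<..<b})"

definition homology_regular :: "'f ring \<Rightarrow> (real ^ 'n) set \<Rightarrow> real ^ 'n \<Rightarrow> real \<Rightarrow> bool" where
  "homology_regular F S v t \<longleftrightarrow>
     (\<exists>l u. l < t \<and> t < u \<and>
        (\<forall>a b. l < a \<and> a < b \<and> b < u \<longrightarrow>
           (\<forall>p. inclusion_iso F p (sublevel S v a) (sublevel S v b))))"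

definition homology_critical :: "'f ring \<Rightarrow> (real ^ 'n) set \<Rightarrow> real ^ 'n \<Rightarrow> real \<Rightarrow> bool" where
  "homology_critical F S v t \<longleftrightarrow> \<not> homology_regular F S v t"

text \<open>For unit vectors, \<open>arccos (v \<bullet> w)\<close> is the geodesic distance on the sphere.\<close>

definition geodesic_ball :: "real ^ 'n \<Rightarrow> real \<Rightarrow> (real ^ 'n) set" where
  "geodesic_ball v \<delta> = {w \<in> sphere 0 1. arccos (v \<bullet> w) < \<delta>}"

definition euler_observable :: "'f ring \<Rightarrow> real \<Rightarrow> (real ^ 'n) set \<Rightarrow> real ^ 'n \<Rightarrow> bool" where
  "euler_observable F \<delta> S x \<longleftrightarrow>
     (\<exists>v\<^sub>x \<in> sphere 0 1. \<forall>v \<in> geodesic_ball v\<^sub>x \<delta>. euler_critical F S v (v \<bullet> x))"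

definition homology_observable_in ::
  "'f ring \<Rightarrow> (real ^ 'n) set \<Rightarrow> real ^ 'n \<Rightarrow> real ^ 'n \<Rightarrow> bool" where
  "homology_observable_in F S v x \<longleftrightarrow>
     (\<exists>D \<in> set (PHT F S v). \<exists>(b, e) \<in> set_mset D. b = ereal (v \<bullet> x) \<or> e = ereal (v \<bullet> x))"

definition homology_observable :: "'f ring \<Rightarrow> real \<Rightarrow> (real ^ 'n) set \<Rightarrow> real ^ 'n \<Rightarrow> bool" where
  "homology_observable F \<delta> S x \<longleftrightarrow>
     (\<exists>v\<^sub>x \<in> sphere 0 1. \<forall>v \<in> geodesic_ball v\<^sub>x \<delta>. homology_observable_in F S v x)"

text \<open>
  The library's \<open>simplicial_complex\<close> counts the empty set as a face (the simplex of dimension -1);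
  this affects neither the vertices nor the underlying set.
\<close>

definition vertices :: "(real ^ 'n) set set \<Rightarrow> (real ^ 'n) set" where
  "vertices K = {x. {x} \<in> K}"

definition euler_complexes :: "'f ring \<Rightarrow> real \<Rightarrow> nat \<Rightarrow> (real ^ 'n) set set set" where
  "euler_complexes F \<delta> k =
     {K. simplicial_complex K \<and>
         (\<forall>x \<in> vertices K. euler_observable F \<delta> (\<Union>K) x) \<and>
         (\<forall>v \<in> sphere 0 1.
            card {x \<in> vertices K. \<exists>w \<in> geodesic_ball v \<delta>. euler_critical F (\<Union>K) w (w \<bullet> x)} \<le> k)}"

definition homology_complexes :: "'f ring \<Rightarrow> real \<Rightarrow> nat \<Rightarrow> (real ^ 'n) set set set" where
  "homology_complexes F \<delta> k =
     {K. simplicial_complex K \<and>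
         (\<forall>x \<in> vertices K. homology_observable F \<delta> (\<Union>K) x) \<and>
         (\<forall>v \<in> sphere 0 1.
            card {x \<in> vertices K. \<exists>w \<in> geodesic_ball v \<delta>. homology_critical F (\<Union>K) w (w \<bullet> x)} \<le> k)}"

section \<open>Adaptive query procedures\<close>

text \<open>
  A procedure either stops or queries a direction and continues depending on the answer, so every
  direction it queries depends only on the answers received so far.
\<close>

datatype ('v, 'a) query_procedure =
    Stop
  | Query 'v "'a \<Rightarrow> ('v, 'a) query_procedure"

text \<open>The list of queries and answers when the unknown object answers query \<open>v\<close> by \<open>f v\<close>.\<close>

primrec transcript :: "('v, 'a) query_procedure \<Rightarrow> ('v \<Rightarrow> 'a) \<Rightarrow> ('v \<times> 'a) list" where
  "transcript Stop f = []"
| "transcript (Query v next) f = (v, f v) # transcript (next (f v)) f"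

definition determinable ::
  "((real ^ 'n) set \<Rightarrow> real ^ 'n \<Rightarrow> 'a) \<Rightarrow> (real ^ 'n) set set set \<Rightarrow> real \<Rightarrow> bool" where
  "determinable T \<K> \<Delta> \<longleftrightarrow>
     (\<exists>P :: (real ^ 'n, 'a) query_procedure.
        (\<forall>K \<in> \<K>. fst ` set (transcript P (T (\<Union>K))) \<subseteq> sphere 0 1 \<and>
                  real (length (transcript P (T (\<Union>K)))) \<le> \<Delta>) \<and>
        (\<forall>K \<in> \<K>. \<forall>K' \<in> \<K>.
           transcript P (T (\<Union>K)) = transcript P (T (\<Union>K')) \<longrightarrow> \<Union>K = \<Union>K'))"

end

theory Submission
  imports Defs
begin

text \<open>
  Pushing away radially from a point of a maximal simplex outside the half-space shows that a
  sublevel set has the homology of the subcomplex of the simplices contained in it.  A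
  Mayer--Vietoris count, adding one simplex at a time, then shows that the Euler curve is the signed
  count of these simplices, so that critical values are heights of vertices.  The persistent
  homology transform determines the Betti numbers of the sublevel sets and hence the Euler curve.

  The first queries find the vertices.  Take a net of the sphere that is fine compared to \<open>\<delta>\<close> and
  near each of its points \<open>w\<close> choose \<open>(d - 1) k + 1\<close> directions in general position.  If the height
  of a point \<open>x\<close> is seen to be critical in all the directions near \<open>w\<close>, then it is each time the
  height of one of the at most \<open>k\<close> vertices counted in condition (2) at \<open>w\<close>, so one of these vertices
  has the height of \<open>x\<close> in \<open>d\<close> linearly independent directions, and it is \<open>x\<close>.  Conversely, every
  vertex is observable in all the directions near some point of the net.

  The second queries take one direction from each chamber of the arrangement of the hyperplanes
  orthogonal to the differences of vertices.  The order of the heights of the vertices is constant on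
  a chamber, so the Euler curves are now known for a dense set of directions, and then for all.

  They determine the shape: for fixed \<open>x\<close> the directions \<open>v\<close> for which a simplex \<open>\<sigma>\<close> lies strictly
  below \<open>v \<bullet> x\<close> form an open convex cone, which is empty if and only if \<open>x \<in> \<sigma>\<close>.  Counting every
  nonempty cone once therefore yields the sum of \<open>(-1)^(dim \<sigma>)\<close> over the simplices containing
  \<open>x\<close>, and the shape is the closure of the support of this function of \<open>x\<close>.
\<close>

section \<open>Quotients of spaces of functions\<close>

text \<open>A cycle over a field is in general not a combination of integral cycles, so statements
  about integral homology classes do not carry over to coefficients in \<open>F\<close>. An additive
  operator on integral chains does: it extends linearly to field chains. Homotopy invariance
  therefore enters as a chain homotopy defined on all chains, built from fillings in contractible
  prisms.

  Homology is handled through quotients of function spaces whose denominator need not lie in the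
  numerator. The image of the homology of \<open>S\<close> in that of \<open>T\<close> is then the
  space of cycles of \<open>S\<close> modulo the boundaries of \<open>T\<close>, and one exact
  sequence of quotients serves the ranks of inclusions, the diagrams and the Mayer--Vietoris count.

  The radii in the choice of directions are crude: \<delta>/8 for the net and \<delta>/8 for the
  directions around each net point keep chords below \<delta>/4, which is well inside a geodesic
  ball of radius \<delta>. Both query stages are charged to the error term. For \<open>d = 1\<close>
  this term has no factor \<open>1 / \<delta>\<close>, so the net must then have bounded
  size.\<close>

locale coeff_field = field F for F :: "'f ring"
begin

definition cadd :: "('s \<Rightarrow> 'f) \<Rightarrow> ('s \<Rightarrow> 'f) \<Rightarrow> 's \<Rightarrow> 'f" where
  "cadd c d = (\<lambda>s. c s \<oplus>\<^bsub>F\<^esub> d s)"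

definition cscale :: "'f \<Rightarrow> ('s \<Rightarrow> 'f) \<Rightarrow> 's \<Rightarrow> 'f" where
  "cscale a c = (\<lambda>s. a \<otimes>\<^bsub>F\<^esub> c s)"

definition czero :: "'s \<Rightarrow> 'f" where
  "czero = (\<lambda>s. \<zero>\<^bsub>F\<^esub>)"

definition csub :: "('s \<Rightarrow> 'f) \<Rightarrow> ('s \<Rightarrow> 'f) \<Rightarrow> 's \<Rightarrow> 'f" where
  "csub c d = (\<lambda>s. c s \<ominus>\<^bsub>F\<^esub> d s)"

definition cfun :: "('s \<Rightarrow> 'f) set" where
  "cfun = UNIV \<rightarrow> carrier F"

definition csubspace :: "('s \<Rightarrow> 'f) set \<Rightarrow> bool" where
  "csubspace Z \<longleftrightarrow> Z \<subseteq> cfun \<and> czero \<in> Z \<and> (\<forall>c\<in>Z. \<forall>d\<in>Z. cadd c d \<in> Z) \<and>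
     (\<forall>a\<in>carrier F. \<forall>c\<in>Z. cscale a c \<in> Z)"

lemma cfun_app [simp]: "c \<in> cfun \<Longrightarrow> c s \<in> carrier F"
  by (auto simp: cfun_def)

lemma cfun_closed [simp]:
  "czero \<in> cfun" "c \<in> cfun \<Longrightarrow> d \<in> cfun \<Longrightarrow> cadd c d \<in> cfun"
  "c \<in> cfun \<Longrightarrow> d \<in> cfun \<Longrightarrow> csub c d \<in> cfun"
  "a \<in> carrier F \<Longrightarrow> c \<in> cfun \<Longrightarrow> cscale a c \<in> cfun"
  by (auto simp: cfun_def czero_def cadd_def csub_def cscale_def)

lemma csub_conv: "c \<in> cfun \<Longrightarrow> d \<in> cfun \<Longrightarrow> csub c d = cadd c (cscale (\<ominus>\<^bsub>F\<^esub> \<one>\<^bsub>F\<^esub>) d)"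
  by (auto simp: csub_def cadd_def cscale_def a_minus_def l_minus)

lemma csubspaceD:
  assumes "csubspace Z"
  shows "c \<in> Z \<Longrightarrow> c \<in> cfun" "czero \<in> Z" "c \<in> Z \<Longrightarrow> d \<in> Z \<Longrightarrow> cadd c d \<in> Z"
    "a \<in> carrier F \<Longrightarrow> c \<in> Z \<Longrightarrow> cscale a c \<in> Z" "c \<in> Z \<Longrightarrow> d \<in> Z \<Longrightarrow> csub c d \<in> Z"
proof -
  show 1: "c \<in> Z \<Longrightarrow> c \<in> cfun" "czero \<in> Z" "c \<in> Z \<Longrightarrow> d \<in> Z \<Longrightarrow> cadd c d \<in> Z"
    "a \<in> carrier F \<Longrightarrow> c \<in> Z \<Longrightarrow> cscale a c \<in> Z" for a c d
    using assms by (auto simp: csubspace_def)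
  show "c \<in> Z \<Longrightarrow> d \<in> Z \<Longrightarrow> csub c d \<in> Z"
    using 1 by (simp add: csub_conv)
qed

lemma csubspaceI:
  assumes "Z \<subseteq> cfun" "czero \<in> Z" "\<And>c d. c \<in> Z \<Longrightarrow> d \<in> Z \<Longrightarrow> cadd c d \<in> Z"
    "\<And>a c. a \<in> carrier F \<Longrightarrow> c \<in> Z \<Longrightarrow> cscale a c \<in> Z"
  shows "csubspace Z"
  using assms by (auto simp: csubspace_def)

lemma csubspace_Int: "csubspace Z \<Longrightarrow> csubspace W \<Longrightarrow> csubspace (Z \<inter> W)"
  by (auto simp: csubspace_def)

definition csum :: "('s \<Rightarrow> 'f) set \<Rightarrow> ('s \<Rightarrow> 'f) set \<Rightarrow> ('s \<Rightarrow> 'f) set" where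
  "csum Z W = {cadd z w |z w. z \<in> Z \<and> w \<in> W}"

lemma cadd_ac:
  "c \<in> cfun \<Longrightarrow> d \<in> cfun \<Longrightarrow> cadd c d = cadd d c"
  "c \<in> cfun \<Longrightarrow> d \<in> cfun \<Longrightarrow> e \<in> cfun \<Longrightarrow> cadd (cadd c d) e = cadd c (cadd d e)"
  "c \<in> cfun \<Longrightarrow> d \<in> cfun \<Longrightarrow> e \<in> cfun \<Longrightarrow> cadd c (cadd d e) = cadd d (cadd c e)"
  by (auto simp: cadd_def a_ac)

lemma cadd_simps [simp]:
  "c \<in> cfun \<Longrightarrow> cadd c czero = c" "c \<in> cfun \<Longrightarrow> cadd czero c = c"
  "c \<in> cfun \<Longrightarrow> csub c c = czero" "c \<in> cfun \<Longrightarrow> csub c czero = c"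
  "c \<in> cfun \<Longrightarrow> d \<in> cfun \<Longrightarrow> cadd (csub c d) d = c"
  by (auto simp: cadd_def csub_def czero_def a_minus_def a_assoc l_neg r_neg)

lemma csub_cadd_cancel [simp]:
  assumes "c \<in> cfun" "d \<in> cfun"
  shows "cadd d (csub c d) = c" "csub (cadd c d) d = c" "csub (cadd c d) c = d"
proof -
  show "cadd d (csub c d) = c"
    using assms cadd_ac(1)[of d "csub c d"] by simp
  have *: "csub (cadd c d) d = c" if "c \<in> cfun" "d \<in> cfun" for c d
    using that by (auto simp: cadd_def csub_def a_minus_def a_assoc r_neg)
  show "csub (cadd c d) d = c" using * assms .
  show "csub (cadd c d) c = d"
    using *[of d c] assms cadd_ac(1) by metis
qed

lemma cscale_simps:
  "c \<in> cfun \<Longrightarrow> d \<in> cfun \<Longrightarrow> a \<in> carrier F \<Longrightarrow> cscale a (cadd c d) = cadd (cscale a c) (cscale a d)"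
  "c \<in> cfun \<Longrightarrow> d \<in> cfun \<Longrightarrow> a \<in> carrier F \<Longrightarrow> cscale a (csub c d) = csub (cscale a c) (cscale a d)"
  "c \<in> cfun \<Longrightarrow> b \<in> carrier F \<Longrightarrow> a \<in> carrier F \<Longrightarrow> cscale (a \<oplus>\<^bsub>F\<^esub> b) c = cadd (cscale a c) (cscale b c)"
  "c \<in> cfun \<Longrightarrow> b \<in> carrier F \<Longrightarrow> a \<in> carrier F \<Longrightarrow> cscale (a \<otimes>\<^bsub>F\<^esub> b) c = cscale a (cscale b c)"
  "c \<in> cfun \<Longrightarrow> cscale \<one>\<^bsub>F\<^esub> c = c"
  "c \<in> cfun \<Longrightarrow> cscale \<zero>\<^bsub>F\<^esub> c = czero"
  "a \<in> carrier F \<Longrightarrow> cscale a czero = czero"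
  by (auto simp: cadd_def csub_def czero_def cscale_def r_distr l_distr m_assoc a_minus_def r_minus)

lemma csub_cadd:
  "a \<in> cfun \<Longrightarrow> b \<in> cfun \<Longrightarrow> c \<in> cfun \<Longrightarrow> d \<in> cfun \<Longrightarrow>
     csub (cadd a b) (cadd c d) = cadd (csub a c) (csub b d)"
  by (auto simp: cadd_def csub_def a_minus_def minus_add a_ac)

lemma csubspace_csum:
  assumes "csubspace Z" "csubspace W"
  shows "csubspace (csum Z W)"
proof (rule csubspaceI)
  note z = csubspaceD[OF assms(1)] and w = csubspaceD[OF assms(2)]
  show "csum Z W \<subseteq> cfun" using z w by (auto simp: csum_def)
  show "czero \<in> csum Z W"
    unfolding csum_def by (rule CollectI, rule exI[of _ czero], rule exI[of _ czero]) (use z w in auto)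
  show "cadd c d \<in> csum Z W" if cd: "c \<in> csum Z W" "d \<in> csum Z W" for c d
  proof -
    obtain z1 w1 z2 w2 where "z1 \<in> Z" "z2 \<in> Z" "w1 \<in> W" "w2 \<in> W" "c = cadd z1 w1" "d = cadd z2 w2"
      using cd by (auto simp: csum_def)
    moreover from this have "cadd c d = cadd (cadd z1 z2) (cadd w1 w2)"
      using z(1) w(1) by (simp add: cadd_ac)
    ultimately show ?thesis unfolding csum_def using z(3) w(3) by blast
  qed
  show "cscale a c \<in> csum Z W" if a: "a \<in> carrier F" and c: "c \<in> csum Z W" for a c
  proof -
    obtain z1 w1 where "z1 \<in> Z" "w1 \<in> W" "c = cadd z1 w1"
      using c by (auto simp: csum_def)
    moreover from this have "cscale a c = cadd (cscale a z1) (cscale a w1)"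
      using z(1) w(1) a by (simp add: cscale_simps)
    ultimately show ?thesis unfolding csum_def using z(4) w(4) a by blast
  qed
qed

definition coset :: "('s \<Rightarrow> 'f) set \<Rightarrow> ('s \<Rightarrow> 'f) \<Rightarrow> ('s \<Rightarrow> 'f) set" where
  "coset B z = (\<lambda>b. cadd b z) ` B"

text \<open>\<open>B\<close> need not be contained in \<open>Z\<close>: this is the image of \<open>Z\<close> in the quotient by \<open>B\<close>.\<close>

definition quot :: "('s \<Rightarrow> 'f) set \<Rightarrow> ('s \<Rightarrow> 'f) set \<Rightarrow> ('f, ('s \<Rightarrow> 'f) set) module" where
  "quot Z B = \<lparr>carrier = coset B ` Z, monoid.mult = undefined, one = undefined, zero = B,
     add = (\<lambda>U V. {cadd u v |u v. u \<in> U \<and> v \<in> V}),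
     smult = (\<lambda>a U. \<Union>c\<in>U. coset B (cscale a c))\<rparr>"

lemma coset_eq_iff:
  assumes B: "csubspace B" and zw: "z \<in> cfun" "w \<in> cfun"
  shows "coset B z = coset B w \<longleftrightarrow> csub z w \<in> B"
proof
  note b = csubspaceD[OF B]
  assume "coset B z = coset B w"
  moreover have "z \<in> coset B z" unfolding coset_def using b(2) zw by force
  ultimately obtain u where u: "u \<in> B" "z = cadd u w" by (auto simp: coset_def)
  then have "csub z w = u" using b(1) zw by simp
  then show "csub z w \<in> B" using u by simp
next
  note b = csubspaceD[OF B]
  assume zw': "csub z w \<in> B"
  have "cadd u z \<in> coset B w" if "u \<in> B" for u
  proof -
    have "cadd u z = cadd (cadd u (csub z w)) w"
      using b(1)[OF that] zw by (simp add: cadd_ac(2))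
    then show ?thesis using b(3)[OF that zw'] by (auto simp: coset_def)
  qed
  moreover have "cadd u w \<in> coset B z" if "u \<in> B" for u
  proof -
    have "cadd u w = cadd (csub u (csub z w)) z"
      using b(1)[OF that] zw
      by (auto simp: cadd_def csub_def a_minus_def minus_add a_ac r_neg l_neg r_neg1 r_neg2)
    then show ?thesis using b(5)[OF that zw'] by (auto simp: coset_def)
  qed
  ultimately show "coset B z = coset B w" by (auto simp: coset_def)
qed

lemma coset_self: "csubspace B \<Longrightarrow> z \<in> cfun \<Longrightarrow> z \<in> coset B z"
  unfolding coset_def using csubspaceD(2)[of B] by force

lemma coset_czero: "csubspace B \<Longrightarrow> coset B czero = B"
  using csubspaceD(1)[of B] by (force simp: coset_def)

lemma coset_add:
  assumes B: "csubspace B" and zw: "z \<in> cfun" "w \<in> cfun"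
  shows "{cadd u v |u v. u \<in> coset B z \<and> v \<in> coset B w} = coset B (cadd z w)"
proof -
  note b = csubspaceD[OF B]
  have "cadd (cadd u z) (cadd v w) = cadd (cadd u v) (cadd z w)" if "u \<in> B" "v \<in> B" for u v
    using that b(1) zw by (simp add: cadd_ac)
  then have "{cadd u v |u v. u \<in> coset B z \<and> v \<in> coset B w} \<subseteq> coset B (cadd z w)"
    using b(3) by (auto simp: coset_def)
  moreover have "cadd u (cadd z w) \<in> {cadd u v |u v. u \<in> coset B z \<and> v \<in> coset B w}" if "u \<in> B" for u
  proof -
    have "cadd u (cadd z w) = cadd (cadd u z) (cadd czero w)"
      using that b(1) zw by (simp add: cadd_ac)
    then show ?thesis using b(2) that unfolding coset_def by blast
  qed
  ultimately show ?thesis by (auto simp: coset_def)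
qed

lemma coset_scale:
  assumes B: "csubspace B" and z: "z \<in> cfun" and a: "a \<in> carrier F"
  shows "(\<Union>c\<in>coset B z. coset B (cscale a c)) = coset B (cscale a z)"
proof -
  note b = csubspaceD[OF B]
  have "coset B (cscale a c) = coset B (cscale a z)" if c: "c \<in> coset B z" for c
  proof -
    obtain u where u: "u \<in> B" "c = cadd u z" using c by (auto simp: coset_def)
    have "csub (cscale a c) (cscale a z) = cscale a u"
      using u b(1) a z by (simp add: cscale_simps)
    then show ?thesis using coset_eq_iff[OF B] b(4)[OF a u(1)] a z u b(1) by simp
  qed
  then show ?thesis using coset_self[OF B z] by blast
qed

lemma quot_simps:
  assumes "csubspace B"
  shows "carrier (quot Z B) = coset B ` Z" "\<zero>\<^bsub>quot Z B\<^esub> = coset B czero"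
    "z \<in> cfun \<Longrightarrow> w \<in> cfun \<Longrightarrow> coset B z \<oplus>\<^bsub>quot Z B\<^esub> coset B w = coset B (cadd z w)"
    "a \<in> carrier F \<Longrightarrow> z \<in> cfun \<Longrightarrow> a \<odot>\<^bsub>quot Z B\<^esub> coset B z = coset B (cscale a z)"
  unfolding quot_def by (simp_all add: assms coset_add coset_scale coset_czero)

lemma vectorspace_quot:
  assumes Z: "csubspace Z" and B: "csubspace B"
  shows "vectorspace F (quot Z B)"
proof -
  note z = csubspaceD[OF Z] and q = quot_simps[OF B]
  have neg: "\<exists>v\<in>Z. coset B (cadd u v) = coset B czero" if "u \<in> Z" for u
    using z(1)[OF that] z(5)[OF z(2) that] 
    by (intro bexI[of _ "csub czero u"]) auto
  show ?thesis
    by (rule vs_criteria; (unfold q)?)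
      (use field_axioms z neg in \<open>auto simp: q cadd_ac cscale_simps\<close>)
qed

definition qdim :: "('s \<Rightarrow> 'f) set \<Rightarrow> ('s \<Rightarrow> 'f) set \<Rightarrow> nat" where
  "qdim Z B = vectorspace.dim F (quot Z B)"

definition qfin :: "('s \<Rightarrow> 'f) set \<Rightarrow> ('s \<Rightarrow> 'f) set \<Rightarrow> bool" where
  "qfin Z B = vectorspace.fin_dim F (quot Z B)"

end

text \<open>An independent subset of the subspace stays independent in the whole space, so its size
  is at most \<open>dim\<close>; a maximal one is a finite basis.\<close>

lemma (in vectorspace) subspace_fin_dim:
  assumes W: "subspace K W V" and fd: "fin_dim"
  shows "vectorspace.fin_dim K (vs W)"
proof -
  interpret W: vectorspace K "vs W" by (rule subspace_is_vs[OF W])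
  have sub: "submodule K W V" using W by (simp add: subspace_def)
  then have WC: "W \<subseteq> carrier V" by (simp add: submodule_def)
  have "finite A \<and> card A \<le> dim" if "A \<subseteq> carrier (vs W) \<and> W.lin_indpt A" for A
    using li_le_dim[OF fd, of A] that span_li_not_depend(2)[OF _ sub, of A] WC by auto
  moreover have "W.lin_indpt {}" by (auto simp: W.lin_dep_def)
  ultimately obtain A where A: "finite A" "maximal A (\<lambda>S. S \<subseteq> carrier (vs W) \<and> W.lin_indpt S)"
    using maximal_exists[of "\<lambda>S. S \<subseteq> carrier (vs W) \<and> W.lin_indpt S" dim "{}"] by auto
  then have "W.basis A" by (intro W.max_li_is_basis) auto
  then show ?thesis using A by (auto simp: W.fin_dim_def W.basis_def)
qed

text \<open>Generators of the kernel and preimages of generators of the target generate the source.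
  This supplies the finiteness that rank--nullity presupposes.\<close>

lemma (in linear_map) fin_dim_from_ker_image:
  assumes k: "vectorspace.fin_dim K (V.vs kerT)" and surj: "T ` carrier V = carrier W"
    and fw: "W.fin_dim"
  shows "V.fin_dim"
proof -
  interpret kr: vectorspace K "V.vs kerT" by (rule V.subspace_is_vs[OF kerT_is_subspace])
  have ksub: "submodule K kerT V" using kerT_is_subspace by (simp add: subspace_def)
  obtain A where A: "finite A" "A \<subseteq> kerT" "kerT = kr.span A"
    using k by (auto simp: kr.fin_dim_def)
  have A': "kerT = V.module.span A" using A V.module.span_li_not_depend(1)[OF A(2) ksub] by simp
  obtain C where C: "finite C" "C \<subseteq> carrier W" "carrier W = W.module.span C"
    using fw by (auto simp: W.fin_dim_def)
  obtain D where D: "D \<subseteq> carrier V" "finite D" "C = T ` D"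
    using C surj finite_subset_image[of C T "carrier V"] by auto
  have kC: "kerT \<subseteq> carrier V" by (auto simp: ker_def)
  have AD: "A \<union> D \<subseteq> carrier V" using A(2) kC D by auto
  define S where "S = V.module.span (A \<union> D)"
  have S: "submodule K S V" unfolding S_def by (rule V.module.span_is_submodule[OF AD])
  then have SC: "S \<subseteq> carrier V" by (simp add: submodule_def)
  have ADS: "A \<union> D \<subseteq> S" unfolding S_def by (rule V.module.in_own_span[OF AD])
  have "submodule K (T ` S) W"
  proof
    show "T ` S \<subseteq> carrier W" using SC by auto
    show "v \<oplus>\<^bsub>W\<^esub> w \<in> T ` S" if vw: "v \<in> T ` S" "w \<in> T ` S" for v w
    proof -
      obtain a b where ab: "a \<in> S" "b \<in> S" "v = T a" "w = T b" using vw by auto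
      then have "v \<oplus>\<^bsub>W\<^esub> w = T (a \<oplus>\<^bsub>V\<^esub> b)" using SC by (subst T_add) auto
      then show ?thesis using S ab by (auto simp: submodule_def)
    qed
    show "\<zero>\<^bsub>W\<^esub> \<in> T ` S" using S T0_is_0 unfolding submodule_def by (metis imageI)
    show "c \<odot>\<^bsub>W\<^esub> v \<in> T ` S" if c: "c \<in> carrier K" and v: "v \<in> T ` S" for c v
    proof -
      obtain a where ab: "a \<in> S" "v = T a" using v by auto
      then have "c \<odot>\<^bsub>W\<^esub> v = T (c \<odot>\<^bsub>V\<^esub> a)" using SC c by (subst T_smult) auto
      then show ?thesis using S ab c by (auto simp: submodule_def)
    qed
  qed
  then have *: "carrier W \<subseteq> T ` S"
    using C(3) D(3) ADS W.module.span_is_subset[of C "T ` S"] by blast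
  have "v \<in> S" if v: "v \<in> carrier V" for v
  proof -
    obtain s where s: "s \<in> S" "T s = T v" using * v by (metis T_im imageE subsetD)
    have sC: "s \<in> carrier V" using s SC by auto
    have "v \<ominus>\<^bsub>V\<^esub> s \<in> kerT" using s v sC by (simp add: ker_def)
    then have k: "v \<ominus>\<^bsub>V\<^esub> s \<in> S"
      unfolding A' S_def using V.module.span_is_monotone[of A "A \<union> D"] AD by auto
    have "v = (v \<ominus>\<^bsub>V\<^esub> s) \<oplus>\<^bsub>V\<^esub> s"
      using v sC by (simp add: a_minus_def V.module.M.a_assoc V.module.M.l_neg)
    then show ?thesis using S k s unfolding submodule_def by metis
  qed
  then have "V.module.span (A \<union> D) = carrier V" using SC by (auto simp: S_def)
  then show ?thesis using A(1) D(2) AD by (auto simp: V.fin_dim_def)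
qed

section \<open>Exact sequences of quotients, and linear relations that induce isomorphisms\<close>

context coeff_field
begin

text \<open>The map of quotients induced by enlarging the denominator to \<open>B\<close>. Taking
  the union over all representatives avoids a choice and gives a single coset whenever
  \<open>U\<close> is a coset of a subspace of \<open>B\<close>.\<close>

definition coset_map :: "('s \<Rightarrow> 'f) set \<Rightarrow> ('s \<Rightarrow> 'f) set \<Rightarrow> ('s \<Rightarrow> 'f) set" where
  "coset_map B U = (\<Union>z\<in>U. coset B z)"

lemma coset_map_coset:
  assumes B: "csubspace B" and B': "csubspace B'" and sub: "B \<subseteq> B'" and z: "z \<in> cfun"
  shows "coset_map B' (coset B z) = coset B' z"
proof -
  have "coset B' u = coset B' z" if u: "u \<in> coset B z" for u
  proof -
    obtain b where b: "b \<in> B" "u = cadd b z" using u by (auto simp: coset_def)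
    then have "csub u z \<in> B'" "u \<in> cfun" using z sub csubspaceD(1)[OF B b(1)] by auto
    then show ?thesis using coset_eq_iff[OF B', of u z] z by simp
  qed
  then show ?thesis using coset_self[OF B z] unfolding coset_map_def by blast
qed

lemma linear_mapI:
  assumes V: "vectorspace F V" and W: "vectorspace F W"
    and T: "\<And>v. v \<in> carrier V \<Longrightarrow> T v \<in> carrier W"
    "\<And>v w. v \<in> carrier V \<Longrightarrow> w \<in> carrier V \<Longrightarrow> T (v \<oplus>\<^bsub>V\<^esub> w) = T v \<oplus>\<^bsub>W\<^esub> T w"
    "\<And>a v. a \<in> carrier F \<Longrightarrow> v \<in> carrier V \<Longrightarrow> T (a \<odot>\<^bsub>V\<^esub> v) = a \<odot>\<^bsub>W\<^esub> T v"
  shows "linear_map F V W T"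
proof -
  interpret V: vectorspace F V by fact
  interpret W: vectorspace F W by fact
  show ?thesis
    by unfold_locales (use T in \<open>auto simp: module_hom_def\<close>)
qed

text \<open>The sequence 0 -> (Z Int B')/B -> Z/B -> Z/B' -> 0 is exact, even when the denominators
  are not contained in \<open>Z\<close>; rank--nullity does the rest. The counts for ranks of
  inclusions and for Mayer--Vietoris are instances.\<close>

lemma quot_exact:
  assumes Z: "csubspace Z" and B: "csubspace B" and B': "csubspace B'" and sub: "B \<subseteq> B'"
  shows "qfin Z B \<longleftrightarrow> qfin Z B' \<and> qfin (Z \<inter> B') B"
    and "qfin Z B \<Longrightarrow> qdim Z B = qdim Z B' + qdim (Z \<inter> B') B"
proof -
  note z = csubspaceD[OF Z] and q = quot_simps[OF B] and q' = quot_simps[OF B']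
  interpret T: linear_map F "quot Z B" "quot Z B'" "coset_map B'"
    by (rule linear_mapI)
      (use Z B B' z in \<open>auto simp: vectorspace_quot q q' coset_map_coset[OF B B' sub]\<close>)
  have "coset B z \<in> T.ker \<longleftrightarrow> z \<in> B'" if "z \<in> Z" for z
    using that coset_eq_iff[OF B', of z czero] z
    by (auto simp: T.ker_def q q' coset_map_coset[OF B B' sub])
  then have ker: "T.ker = coset B ` (Z \<inter> B')"
    by (auto simp: T.ker_def q)
  have kq: "(quot Z B)\<lparr>carrier := T.ker\<rparr> = quot (Z \<inter> B') B"
    by (simp only: ker) (simp add: quot_def)
  have surj: "coset_map B' ` carrier (quot Z B) = carrier (quot Z B')"
    using z by (auto simp: q q' image_iff coset_map_coset[OF B B' sub])
  have "T.im = coset B' ` Z"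
    using surj unfolding T.im_def by (simp add: q')
  then have im: "(quot Z B')\<lparr>carrier := T.im\<rparr> = quot Z B'"
    by (simp only:) (simp add: quot_def)
  show "qdim Z B = qdim Z B' + qdim (Z \<inter> B') B" if "qfin Z B"
    using T.rank_nullity_main(1) that unfolding kq im qdim_def qfin_def by simp
  show "qfin Z B \<longleftrightarrow> qfin Z B' \<and> qfin (Z \<inter> B') B"
    unfolding qfin_def
    using T.surj_fin_dim[OF _ surj] T.V.subspace_fin_dim[OF T.kerT_is_subspace]
      T.fin_dim_from_ker_image[OF _ surj] unfolding kq by blast
qed

text \<open>A linear relation between \<open>Z\<close> and \<open>Z'\<close> that descends to an
  isomorphism of the quotients: both projections are onto modulo the denominators, and related
  elements vanish together. It is a relation and not a map because the connecting homomorphism of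
  Mayer--Vietoris depends on a noncanonical splitting of a cycle.\<close>

definition quot_rel where
  "quot_rel R Z B Z' B' \<longleftrightarrow> csubspace Z \<and> csubspace B \<and> csubspace Z' \<and> csubspace B' \<and>
     (\<forall>x y. R x y \<longrightarrow> x \<in> Z \<and> y \<in> Z') \<and>
     (\<forall>x y x' y'. R x y \<longrightarrow> R x' y' \<longrightarrow> R (cadd x x') (cadd y y')) \<and>
     (\<forall>a x y. a \<in> carrier F \<longrightarrow> R x y \<longrightarrow> R (cscale a x) (cscale a y)) \<and>
     (\<forall>z\<in>Z. \<exists>x y. R x y \<and> csub z x \<in> B) \<and> (\<forall>z\<in>Z'. \<exists>x y. R x y \<and> csub z y \<in> B') \<and>
     (\<forall>x y. R x y \<longrightarrow> (x \<in> B \<longleftrightarrow> y \<in> B'))"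

lemma quot_relation_dim_aux:
  fixes Z B :: "('s \<Rightarrow> 'f) set" and Z' B' :: "('t \<Rightarrow> 'f) set"
  assumes rel: "quot_rel R Z B Z' B'"
    and fin: "qfin Z B"
  shows "qfin Z' B' \<and> qdim Z B = qdim Z' B'"
proof -
  note r0 = rel[unfolded quot_rel_def]
  note r1 = r0[THEN conjunct2] note r2 = r1[THEN conjunct2] note r3 = r2[THEN conjunct2]
  note r4 = r3[THEN conjunct2] note r5 = r4[THEN conjunct2] note r6 = r5[THEN conjunct2]
  note r7 = r6[THEN conjunct2] note r8 = r7[THEN conjunct2] note r9 = r8[THEN conjunct2]
  note Z = r0[THEN conjunct1] and B = r1[THEN conjunct1] and Z' = r2[THEN conjunct1]
    and B' = r3[THEN conjunct1]
  note R = r4[THEN conjunct1, rule_format] and Radd = r5[THEN conjunct1, rule_format]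
    and Rscale = r6[THEN conjunct1, rule_format] and dom = r7[THEN conjunct1, rule_format]
    and ran = r8[THEN conjunct1, rule_format] and ker = r9[rule_format]
  note z = csubspaceD[OF Z] and q = quot_simps[OF B] and q' = quot_simps[OF B']
    and z' = csubspaceD[OF Z']
  have Rsub: "R (csub x x') (csub y y')" if "R x y" "R x' y'" for x y x' y'
    using Radd[OF that(1) Rscale[OF _ that(2), of "\<ominus>\<^bsub>F\<^esub> \<one>\<^bsub>F\<^esub>"]] R[OF that(1)] R[OF that(2)] z(1) z'(1)
    by (simp add: csub_conv)
  \<comment> \<open>Subtracting two related pairs and applying the vanishing condition gives
    well-definedness and injectivity at once.\<close>
  have uniq: "coset B x = coset B x' \<longleftrightarrow> coset B' y = coset B' y'" if "R x y" "R x' y'" for x y x' y'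
    using ker[OF Rsub[OF that]] R[OF that(1)] R[OF that(2)] z(1) z'(1)
      coset_eq_iff[OF B] coset_eq_iff[OF B'] by simp
  define T where "T U = coset B' (SOME y. \<exists>x. R x y \<and> U = coset B x)" for U
  have T: "T (coset B x) = coset B' y" if "R x y" for x y
  proof -
    have "\<exists>x'. R x' (SOME y. \<exists>x'. R x' y \<and> coset B x = coset B x') \<and> coset B x = coset B x'"
      using someI_ex[of "\<lambda>y. \<exists>x'. R x' y \<and> coset B x = coset B x'"] that by blast
    then obtain x' where "R x' (SOME y. \<exists>x'. R x' y \<and> coset B x = coset B x')" "coset B x = coset B x'"
      by blast
    then show ?thesis unfolding T_def using uniq[OF _ that] by blast
  qed
  have domR: "\<exists>x y. R x y \<and> U = coset B x" if "U \<in> carrier (quot Z B)" for U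
  proof -
    obtain u where u: "u \<in> Z" "U = coset B u" using \<open>U \<in> _\<close> by (auto simp: q)
    then obtain x y where "R x y" "csub u x \<in> B" using dom by blast
    moreover from this have "coset B u = coset B x" using coset_eq_iff[OF B] u z R by auto
    ultimately show ?thesis using u by auto
  qed
  have ranR: "\<exists>x y. R x y \<and> U = coset B' y" if "U \<in> carrier (quot Z' B')" for U
  proof -
    obtain u where u: "u \<in> Z'" "U = coset B' u" using \<open>U \<in> _\<close> by (auto simp: q')
    then obtain x y where "R x y" "csub u y \<in> B'" using ran by blast
    moreover from this have "coset B' u = coset B' y" using coset_eq_iff[OF B'] u z' R by auto
    ultimately show ?thesis using u by auto
  qed
  interpret T: linear_map F "quot Z B" "quot Z' B'" T
  proof (rule linear_mapI)
    show "vectorspace F (quot Z B)" "vectorspace F (quot Z' B')"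
      using Z B Z' B' by (auto intro: vectorspace_quot)
    show "T v \<in> carrier (quot Z' B')" if "v \<in> carrier (quot Z B)" for v
      using domR[OF that] R T by (auto simp: q')
    show "T (v \<oplus>\<^bsub>quot Z B\<^esub> w) = T v \<oplus>\<^bsub>quot Z' B'\<^esub> T w"
      if vw: "v \<in> carrier (quot Z B)" "w \<in> carrier (quot Z B)" for v w
    proof -
      obtain x y x' y' where "R x y" "R x' y'" "v = coset B x" "w = coset B x'"
        using domR[OF vw(1)] domR[OF vw(2)] by blast
      moreover from this have "x \<in> cfun" "x' \<in> cfun" "y \<in> cfun" "y' \<in> cfun"
        using R z(1) z'(1) by auto
      ultimately show ?thesis using T Radd by (simp add: q q')
    qed
    show "T (a \<odot>\<^bsub>quot Z B\<^esub> v) = a \<odot>\<^bsub>quot Z' B'\<^esub> T v"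
      if v: "v \<in> carrier (quot Z B)" and a: "a \<in> carrier F" for a v
    proof -
      obtain x y where "R x y" "v = coset B x"
        using domR[OF v] by blast
      moreover from this have "x \<in> cfun" "y \<in> cfun"
        using R z(1) z'(1) by auto
      ultimately show ?thesis using T Rscale a by (simp add: q q')
    qed
  qed
  have inj: "inj_on T (carrier (quot Z B))"
  proof (rule inj_onI)
    fix U U' assume U: "U \<in> carrier (quot Z B)" "U' \<in> carrier (quot Z B)" "T U = T U'"
    obtain x y x' y' where "R x y" "U = coset B x" "R x' y'" "U' = coset B x'"
      using domR[OF U(1)] domR[OF U(2)] by blast
    then show "U = U'" using T[of x y] T[of x' y'] uniq[of x y x' y'] U(3) by simp
  qed
  have surj: "T ` carrier (quot Z B) = carrier (quot Z' B')"
  proof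
    show "T ` carrier (quot Z B) \<subseteq> carrier (quot Z' B')" by auto
    show "carrier (quot Z' B') \<subseteq> T ` carrier (quot Z B)"
    proof
      fix U assume "U \<in> carrier (quot Z' B')"
      then obtain x y where xy: "R x y" "U = coset B' y" using ranR by blast
      then have "coset B x \<in> carrier (quot Z B)" using R by (auto simp: q)
      then show "U \<in> T ` carrier (quot Z B)" using T xy by (metis imageI)
    qed
  qed
  show ?thesis
    using T.dim_eq[OF _ inj surj] T.surj_fin_dim[OF _ surj] fin unfolding qfin_def qdim_def by blast
qed

lemma quot_relation_dim:
  assumes "quot_rel R Z B Z' B'"
  shows "qfin Z B \<longleftrightarrow> qfin Z' B'" "qfin Z B \<Longrightarrow> qdim Z B = qdim Z' B'"
proof -
  \<comment> \<open>The converse relation satisfies the same conditions, so finiteness passes in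
    both directions.\<close>
  have "quot_rel (\<lambda>y x. R x y) Z' B' Z B"
    using assms unfolding quot_rel_def by (elim conjE) (intro conjI; (assumption | blast))
  from quot_relation_dim_aux[OF this] quot_relation_dim_aux[OF assms] show "qfin Z B \<longleftrightarrow> qfin Z' B'" "qfin Z B \<Longrightarrow> qdim Z B = qdim Z' B'"
    by blast+
qed

end

section \<open>Chains with field coefficients\<close>

context coeff_field
begin

definition csupp :: "('s \<Rightarrow> 'f) \<Rightarrow> 's set" where
  "csupp c = {s. c s \<noteq> \<zero>\<^bsub>F\<^esub>}"

definition fchain :: "('s \<Rightarrow> 'f) \<Rightarrow> bool" where
  "fchain c \<longleftrightarrow> c \<in> cfun \<and> finite (csupp c)"

text \<open>The integral chain \<open>x\<close> tensored with the scalar \<open>a\<close>; for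
  single simplices \<open>x\<close> these elements span the field chains.\<close>

definition chain_emb :: "'f \<Rightarrow> ('s \<Rightarrow>\<^sub>0 int) \<Rightarrow> 's \<Rightarrow> 'f" where
  "chain_emb a x = (\<lambda>s. [Poly_Mapping.lookup x s] \<cdot>\<^bsub>F\<^esub> a)"

text \<open>Only the values of \<open>T\<close> on single simplices enter. For additive
  \<open>T\<close> this is \<open>T\<close> tensored with the identity of \<open>F\<close>.\<close>

definition chain_ext :: "(('s \<Rightarrow>\<^sub>0 int) \<Rightarrow> ('t \<Rightarrow>\<^sub>0 int)) \<Rightarrow> ('s \<Rightarrow> 'f) \<Rightarrow> 't \<Rightarrow> 'f" where
  "chain_ext T c = (\<lambda>s. \<Oplus>\<^bsub>F\<^esub> r \<in> csupp c. [Poly_Mapping.lookup (T (frag_of r)) s] \<cdot>\<^bsub>F\<^esub> c r)"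

lemma fchain_cfun [simp]: "fchain c \<Longrightarrow> c \<in> cfun"
  by (simp add: fchain_def)

lemma csupp_cadd: "c \<in> cfun \<Longrightarrow> d \<in> cfun \<Longrightarrow> csupp (cadd c d) \<subseteq> csupp c \<union> csupp d"
  by (auto simp: csupp_def cadd_def)

lemma csupp_cscale: "a \<in> carrier F \<Longrightarrow> csupp (cscale a c) \<subseteq> csupp c"
  by (auto simp: csupp_def cscale_def)

lemma csupp_czero [simp]: "csupp czero = {}"
  by (auto simp: csupp_def czero_def)

lemma fchain_closed [simp]:
  "fchain czero" "fchain c \<Longrightarrow> fchain d \<Longrightarrow> fchain (cadd c d)"
  "a \<in> carrier F \<Longrightarrow> fchain c \<Longrightarrow> fchain (cscale a c)"
  using csupp_cadd[of c d] csupp_cscale[of a c] finite_subset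
  by (auto simp: fchain_def)

lemma fchain_csub [simp]: "fchain c \<Longrightarrow> fchain d \<Longrightarrow> fchain (csub c d)"
  by (simp add: csub_conv)

lemma int_pow_facts:
  fixes k l :: int
  assumes "a \<in> carrier F" "b \<in> carrier F"
  shows "add_pow F k a \<in> carrier F"
    "add_pow F (0::int) a = \<zero>\<^bsub>F\<^esub>" "add_pow F (1::int) a = a"
    "add_pow F (k + l) a = add_pow F k a \<oplus>\<^bsub>F\<^esub> add_pow F l a"
    "add_pow F (k - l) a = add_pow F k a \<ominus>\<^bsub>F\<^esub> add_pow F l a"
    "add_pow F k (a \<oplus>\<^bsub>F\<^esub> b) = add_pow F k a \<oplus>\<^bsub>F\<^esub> add_pow F k b"
    "add_pow F k (a \<otimes>\<^bsub>F\<^esub> b) = a \<otimes>\<^bsub>F\<^esub> add_pow F k b"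
    "add_pow F k \<zero>\<^bsub>F\<^esub> = \<zero>\<^bsub>F\<^esub>"
  subgoal using assms by (simp add: add.int_pow_closed)
  subgoal by (simp add: add_pow_def int_pow_def nat_pow_def)
  subgoal using assms add.int_pow_1[of a] by (simp add: add_pow_def)
  subgoal using assms add.int_pow_mult[of a k l] by (simp add: add_pow_def)
  subgoal using assms add.int_pow_diff[of a k l] by (simp add: add_pow_def a_minus_def)
  subgoal using assms add.int_pow_distrib[of a b k] by (simp add: add_pow_def)
  subgoal using assms add_pow_rdistr_int[of a b k] by simp
  subgoal using add.int_pow_one[of k] by (simp add: add_pow_def)
  done

lemma chain_emb_cfun [simp]: "a \<in> carrier F \<Longrightarrow> chain_emb a x \<in> cfun"
  by (auto simp: chain_emb_def cfun_def int_pow_facts)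

lemma csupp_chain_emb: "a \<in> carrier F \<Longrightarrow> csupp (chain_emb a x) \<subseteq> Poly_Mapping.keys x"
  by (auto simp: chain_emb_def csupp_def int_pow_facts in_keys_iff)

lemma fchain_chain_emb [simp]: "a \<in> carrier F \<Longrightarrow> fchain (chain_emb a x)"
  using csupp_chain_emb[of a x] finite_subset[OF _ finite_keys[of x]] by (auto simp: fchain_def)

lemma chain_emb_simps:
  "a \<in> carrier F \<Longrightarrow> chain_emb a (x + y) = cadd (chain_emb a x) (chain_emb a y)"
  "a \<in> carrier F \<Longrightarrow> chain_emb a (x - y) = csub (chain_emb a x) (chain_emb a y)"
  "a \<in> carrier F \<Longrightarrow> chain_emb a 0 = czero"
  "a \<in> carrier F \<Longrightarrow> b \<in> carrier F \<Longrightarrow> cscale b (chain_emb a x) = chain_emb (b \<otimes>\<^bsub>F\<^esub> a) x"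
  "a \<in> carrier F \<Longrightarrow> b \<in> carrier F \<Longrightarrow> chain_emb (a \<oplus>\<^bsub>F\<^esub> b) x = cadd (chain_emb a x) (chain_emb b x)"
  by (auto simp: chain_emb_def cadd_def csub_def czero_def cscale_def int_pow_facts lookup_add lookup_minus fun_eq_iff)

lemma chain_emb_of:
  "a \<in> carrier F \<Longrightarrow> chain_emb a (frag_of r) s = (if s = r then a else \<zero>\<^bsub>F\<^esub>)"
  by (auto simp: chain_emb_def int_pow_facts)

text \<open>Identities between extended operators need to be checked only on one simplex with an
  arbitrary coefficient. The set \<open>S\<close> records the support, so that lying in a given
  space survives the induction.\<close>

lemma fchain_induct [consumes 2, case_names zero single add]:
  assumes c: "fchain c" "csupp c \<subseteq> S"
    and zero: "P czero"
    and single: "\<And>a r. a \<in> carrier F \<Longrightarrow> r \<in> S \<Longrightarrow> P (chain_emb a (frag_of r))"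
    and add: "\<And>c d. fchain c \<Longrightarrow> fchain d \<Longrightarrow> csupp c \<subseteq> S \<Longrightarrow> csupp d \<subseteq> S \<Longrightarrow> P c \<Longrightarrow> P d \<Longrightarrow> P (cadd c d)"
  shows "P c"
proof -
  have "finite A \<Longrightarrow> fchain c \<Longrightarrow> csupp c = A \<Longrightarrow> A \<subseteq> S \<Longrightarrow> P c" for A c
  proof (induction A arbitrary: c rule: finite_induct)
    case empty
    then have "c = czero" by (auto simp: csupp_def czero_def)
    then show ?case using zero by simp
  next
    case (insert r A)
    define d where "d = c(r := \<zero>\<^bsub>F\<^esub>)"
    define e where "e = chain_emb (c r) (frag_of r)"
    have cr: "c r \<in> carrier F" using insert.prems by simp
    have d: "csupp d = A" using insert.prems(2) insert.hyps by (auto simp: csupp_def d_def)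
    have "fchain d" using insert d by (auto simp: fchain_def cfun_def d_def)
    moreover from this have "P d" using insert d by auto
    moreover have "csupp e \<subseteq> S" using csupp_chain_emb[OF cr, of "frag_of r"] insert.prems by (auto simp: e_def)
    moreover have "P e" "fchain e" using single[OF cr] insert.prems cr by (auto simp: e_def)
    ultimately have "P (cadd d e)" using add d insert.prems by auto
    moreover have "cadd d e = c"
      using cr insert.prems(1) by (auto simp: cadd_def d_def e_def chain_emb_of)
    ultimately show ?case by simp
  qed
  then show ?thesis using c unfolding fchain_def by blast
qed

lemma chain_ext_superset:
  assumes c: "c \<in> cfun" and A: "finite A" "csupp c \<subseteq> A"
  shows "chain_ext T c s = (\<Oplus>\<^bsub>F\<^esub> r \<in> A. [Poly_Mapping.lookup (T (frag_of r)) s] \<cdot>\<^bsub>F\<^esub> c r)"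
  unfolding chain_ext_def
  using c A by (intro add.finprod_mono_neutral_cong_left) (auto simp: csupp_def int_pow_facts)

lemma chain_ext_cfun [simp]: "c \<in> cfun \<Longrightarrow> chain_ext T c \<in> cfun"
  unfolding chain_ext_def cfun_def
  by (auto intro!: finsum_closed simp: int_pow_facts Pi_iff)

lemma chain_ext_cadd:
  assumes "fchain c" "fchain d"
  shows "chain_ext T (cadd c d) = cadd (chain_ext T c) (chain_ext T d)"
proof
  fix s
  let ?A = "csupp c \<union> csupp d"
  have A: "finite ?A" using assms by (auto simp: fchain_def)
  have "chain_ext T (cadd c d) s = (\<Oplus>\<^bsub>F\<^esub> r \<in> ?A. [Poly_Mapping.lookup (T (frag_of r)) s] \<cdot>\<^bsub>F\<^esub> cadd c d r)"
    using assms csupp_cadd[of c d] A by (intro chain_ext_superset) auto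
  also have "\<dots> = (\<Oplus>\<^bsub>F\<^esub> r \<in> ?A. [Poly_Mapping.lookup (T (frag_of r)) s] \<cdot>\<^bsub>F\<^esub> c r \<oplus>\<^bsub>F\<^esub>
      [Poly_Mapping.lookup (T (frag_of r)) s] \<cdot>\<^bsub>F\<^esub> d r)"
    using assms by (intro add.finprod_cong') (auto simp: cadd_def int_pow_facts)
  also have "\<dots> = chain_ext T c s \<oplus>\<^bsub>F\<^esub> chain_ext T d s"
    using assms A by (subst finsum_addf) (auto simp: int_pow_facts chain_ext_superset[of _ ?A])
  finally show "chain_ext T (cadd c d) s = cadd (chain_ext T c) (chain_ext T d) s"
    by (simp add: cadd_def)
qed

lemma chain_ext_single:
  assumes "a \<in> carrier F"
  shows "chain_ext T (chain_emb a (frag_of r)) = chain_emb a (T (frag_of r))"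
proof
  fix s
  have "chain_ext T (chain_emb a (frag_of r)) s =
      (\<Oplus>\<^bsub>F\<^esub> r' \<in> {r}. [Poly_Mapping.lookup (T (frag_of r')) s] \<cdot>\<^bsub>F\<^esub> chain_emb a (frag_of r) r')"
    using assms csupp_chain_emb[OF assms, of "frag_of r"] by (intro chain_ext_superset) auto
  then show "chain_ext T (chain_emb a (frag_of r)) s = chain_emb a (T (frag_of r)) s"
    using assms by (simp add: chain_emb_of int_pow_facts) (simp add: chain_emb_def)
qed

lemma chain_ext_czero [simp]: "chain_ext T czero = czero"
  by (simp add: chain_ext_def czero_def csupp_def)

lemma chain_ext_cscale:
  assumes c: "fchain c" and a: "a \<in> carrier F"
  shows "chain_ext T (cscale a c) = cscale a (chain_ext T c)"
  using c subset_UNIV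
proof (induction c rule: fchain_induct)
  case (single b r)
  then show ?case using a by (simp add: chain_emb_simps chain_ext_single)
qed (use a in \<open>auto simp: cscale_simps chain_ext_cadd\<close>)

lemma chain_ext_csub:
  assumes "fchain c" "fchain d"
  shows "chain_ext T (csub c d) = csub (chain_ext T c) (chain_ext T d)"
  using assms by (simp add: csub_conv chain_ext_cadd chain_ext_cscale)

lemma fchain_chain_ext [simp]:
  assumes "fchain c"
  shows "fchain (chain_ext T c)"
  using assms subset_UNIV
  by (induction c rule: fchain_induct) (auto simp: chain_ext_cadd chain_ext_single)

lemma chain_ext_emb:
  assumes a: "a \<in> carrier F" and T: "\<And>x y. T (x - y) = T x - T y"
  shows "chain_ext T (chain_emb a x) = chain_emb a (T x)"
proof -
  have T0: "T 0 = 0" using T[of 0 0] by simp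
  show ?thesis
    using subset_UNIV[of "Poly_Mapping.keys x"]
    by (induction x rule: frag_induction)
      (use a in \<open>auto simp: T0 chain_emb_simps chain_ext_single T chain_ext_csub\<close>)
qed

text \<open>Additivity is asked of the outer operator: it meets the integral chains
  \<open>U (frag_of r)\<close>, whereas the inner one is evaluated on single simplices.\<close>

lemma chain_ext_comp:
  assumes "fchain c" and T: "\<And>x y. T (x - y) = T x - T y"
  shows "chain_ext T (chain_ext U c) = chain_ext (\<lambda>x. T (U x)) c"
  using assms(1) subset_UNIV
  by (induction c rule: fchain_induct) (auto simp: chain_ext_cadd chain_ext_single chain_ext_emb T)

lemma chain_ext_add_op:
  assumes "fchain c"
  shows "chain_ext (\<lambda>x. T x + U x) c = cadd (chain_ext T c) (chain_ext U c)"
  using assms subset_UNIV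
  by (induction c rule: fchain_induct) (auto simp: chain_ext_cadd chain_ext_single chain_emb_simps cadd_ac)

lemma chain_ext_diff_op:
  assumes "fchain c"
  shows "chain_ext (\<lambda>x. T x - U x) c = csub (chain_ext T c) (chain_ext U c)"
  using assms subset_UNIV
  by (induction c rule: fchain_induct) (auto simp: chain_ext_cadd chain_ext_single chain_emb_simps csub_cadd)

lemma chain_ext_id_op:
  assumes "fchain c"
  shows "chain_ext (\<lambda>x. x) c = c"
  using assms subset_UNIV
  by (induction c rule: fchain_induct) (auto simp: chain_ext_cadd chain_ext_single)

lemma chain_ext_zero_op:
  assumes "fchain c"
  shows "chain_ext (\<lambda>x. 0) c = czero"
  using assms subset_UNIV
  by (induction c rule: fchain_induct) (auto simp: chain_ext_cadd chain_ext_single chain_emb_simps)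

lemma chain_ext_cong:
  assumes "csupp c \<subseteq> S" "\<And>r. r \<in> S \<Longrightarrow> T (frag_of r) = U (frag_of r)" "c \<in> cfun"
  shows "chain_ext T c = chain_ext U c"
  unfolding chain_ext_def
  using assms by (intro ext add.finprod_cong') (auto simp: int_pow_facts)

definition fchains :: "nat \<Rightarrow> 'a topology \<Rightarrow> ('f, 'a) field_chain set" where
  "fchains p X = {c. fchain c \<and> csupp c \<subseteq> singular_simplex_set p X}"

lemma fchainsD: "c \<in> fchains p X \<Longrightarrow> fchain c" "c \<in> fchains p X \<Longrightarrow> c \<in> cfun"
  "c \<in> fchains p X \<Longrightarrow> csupp c \<subseteq> singular_simplex_set p X"
  by (auto simp: fchains_def)

lemma csubspace_fchains: "csubspace (fchains p X)"
proof (rule csubspaceI)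
  show "cadd c d \<in> fchains p X" if "c \<in> fchains p X" "d \<in> fchains p X" for c d
    using that csupp_cadd[of c d] by (auto simp: fchains_def)
  show "cscale a c \<in> fchains p X" if "a \<in> carrier F" "c \<in> fchains p X" for c a
    using that csupp_cscale[of a c] by (auto simp: fchains_def)
qed (auto simp: fchains_def)

lemma chain_emb_fchains:
  "a \<in> carrier F \<Longrightarrow> singular_chain p X x \<Longrightarrow> chain_emb a x \<in> fchains p X"
  using csupp_chain_emb[of a x] by (auto simp: fchains_def singular_chain_def)

lemma chain_ext_fchains:
  assumes c: "c \<in> fchains p X"
    and T: "\<And>r. singular_simplex p X r \<Longrightarrow> singular_chain q Y (T (frag_of r))"
  shows "chain_ext T c \<in> fchains q Y"
  using fchainsD(1)[OF c] fchainsD(3)[OF c]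
  by (induction c rule: fchain_induct)
    (use T in \<open>auto simp: chain_ext_cadd chain_ext_single chain_emb_fchains csubspaceD[OF csubspace_fchains]\<close>)

lemma carrier_chain_space: "carrier (chain_space F p X) = fchains p X"
  by (auto simp: chain_space_def fchains_def fchain_def cfun_def csupp_def)

lemma boundary_map_eq: "boundary_map F p = chain_ext (chain_boundary p)"
  by (auto simp: boundary_map_def chain_ext_def csupp_def fun_eq_iff)

lemma cycles_eq: "cycles F p X = {c \<in> fchains p X. chain_ext (chain_boundary p) c = czero}"
  by (auto simp: cycles_def carrier_chain_space boundary_map_eq czero_def)

lemma boundaries_eq: "boundaries F p X = chain_ext (chain_boundary (Suc p)) ` fchains (Suc p) X"
  by (auto simp: boundaries_def carrier_chain_space boundary_map_eq)

lemma homology_space_eq: "homology_space F p X = quot (cycles F p X) (boundaries F p X)"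
proof -
  have 1: "B +>\<^bsub>chain_space F p X\<^esub> z = coset B z" for B z
    by (auto simp: a_r_coset_def r_coset_def coset_def chain_space_def func_space_def cadd_def restrict_def image_iff)
  have 2: "U <+>\<^bsub>chain_space F p X\<^esub> V = {cadd u v |u v. u \<in> U \<and> v \<in> V}" for U V
    by (simp add: set_add_def set_mult_def chain_space_def func_space_def cadd_def restrict_def) blast
  have 3: "a \<odot>\<^bsub>chain_space F p X\<^esub> c = cscale a c" for a c
    by (simp add: chain_space_def func_space_def cscale_def restrict_def)
  show ?thesis unfolding homology_space_def quot_def 1 2 3 by simp
qed

lemma betti_eq: "betti F p X = qdim (cycles F p X) (boundaries F p X)"
  by (simp add: betti_def homology_space_eq qdim_def)

lemma inclusion_map_eq: "inclusion_map F p Y = coset_map (boundaries F p Y)"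
proof -
  have 1: "B +>\<^bsub>chain_space F p X\<^esub> z = coset B z" for B z and X :: "'a topology"
    by (auto simp: a_r_coset_def r_coset_def coset_def chain_space_def func_space_def cadd_def restrict_def image_iff)
  show ?thesis by (auto simp: inclusion_map_def coset_map_def 1 fun_eq_iff)
qed

end

section \<open>Chain homotopies\<close>

text \<open>A contraction deforms the cycle into one carried by a point, and a point has no homology
  in positive degree. This provides the fillings from which the prism chains are built.\<close>

lemma contractible_cycle_imp_boundary:
  assumes X: "contractible_space X" and q: "1 \<le> q" and c: "singular_relcycle q X {} c"
  shows "singular_relboundary q X {} c"
proof (cases "topspace X = {}")
  case True
  then have "c = 0" using c singular_chain_empty[OF True, of q c] by (simp add: singular_cycle)
  then show ?thesis by simp
next
  case False
  obtain a where a: "homotopic_with (\<lambda>x. True) X X id (\<lambda>x. a)"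
    using X by (auto simp: contractible_space_def)
  then have ca: "continuous_map X X (\<lambda>x. a)" by (rule homotopic_with_imp_continuous_maps[THEN conjunct2])
  then have aX: "a \<in> topspace X" using False by (auto simp: continuous_map_def)
  have "homotopic_with (\<lambda>h. h \<in> {} \<rightarrow> {}) X X id (\<lambda>x. a)"
    using a by (simp add: homotopic_with_def)
  from homotopic_imp_homologous_rel_chain_maps[OF this c]
  have h: "homologous_rel q X {} (chain_map q id c) (chain_map q (\<lambda>x. a) c)" .
  have "continuous_map X (subtopology X {a}) (\<lambda>x. a)"
    using aX by (simp add: continuous_map_in_subtopology ca)
  from singular_relcycle_chain_map[OF c this, of "{}"]
  have "singular_relcycle q (subtopology X {a}) {} (chain_map q (\<lambda>x. a) c)" by simp
  moreover have ta: "topspace (subtopology X {a}) = {a}" using aX by auto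
  ultimately have "singular_relboundary q (subtopology X {a}) {} (chain_map q (\<lambda>x. a) c)"
    using singular_boundary_eq_cycle_singleton[OF ta q] by blast
  then have "singular_relboundary q (subtopology X (topspace X)) {} (chain_map q (\<lambda>x. a) c)"
    by (rule singular_boundary_mono[rotated]) (use aX in auto)
  then have 1: "singular_relboundary q X {} (chain_map q (\<lambda>x. a) c)" by simp
  have "chain_map q id c = c"
    using c by (auto simp: singular_cycle intro: chain_map_ident)
  then have 2: "singular_relboundary q X {} (c - chain_map q (\<lambda>x. a) c)"
    using h by (simp add: homologous_rel_def)
  from singular_relboundary_add[OF 2 1] show ?thesis by simp
qed

section \<open>Acyclic models: the prism operator\<close>

abbreviation simplex_top :: "nat \<Rightarrow> (nat \<Rightarrow> real) topology" where
  "simplex_top p \<equiv> subtopology (powertop_real UNIV) (standard_simplex p)"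

abbreviation prism_top :: "nat \<Rightarrow> (real \<times> (nat \<Rightarrow> real)) topology" where
  "prism_top p \<equiv> prod_topology (top_of_set {0..1}) (simplex_top p)"

lemma contractible_simplex_top: "contractible_space (simplex_top p)"
proof -
  define e :: "nat \<Rightarrow> real" where "e = (\<lambda>j. if j = 0 then 1 else 0)"
  have e: "e \<in> standard_simplex p" by (simp add: e_def)
  define h :: "real \<times> (nat \<Rightarrow> real) \<Rightarrow> nat \<Rightarrow> real" where "h = (\<lambda>(s, x) i. (1 - s) * x i + s * e i)"
  have "continuous_map (prism_top p) (powertop_real UNIV) h"
    unfolding continuous_map_componentwise_UNIV
  proof
    fix i
    have "continuous_map (prism_top p) euclideanreal (\<lambda>z. fst z)"
      using continuous_map_fst continuous_map_into_fulltopology by blast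
    moreover have "continuous_map (simplex_top p) euclideanreal (\<lambda>x. x i)"
      by (intro continuous_map_from_subtopology continuous_map_product_projection) auto
    then have "continuous_map (prism_top p) euclideanreal ((\<lambda>x. x i) \<circ> snd)"
      by (rule continuous_map_compose[OF continuous_map_snd])
    ultimately show "continuous_map (prism_top p) euclideanreal (\<lambda>z. h z i)"
      unfolding h_def case_prod_unfold o_def by (intro continuous_intros) auto
  qed
  moreover have "h \<in> topspace (prism_top p) \<rightarrow> standard_simplex p"
    using convex_standard_simplex[OF _ e] by (auto simp: h_def)
  ultimately have "continuous_map (prism_top p) (simplex_top p) h"
    by (simp add: continuous_map_in_subtopology)
  moreover have "h (0, x) = id x" "h (1, x) = e" for x by (auto simp: h_def)
  ultimately show ?thesis
    unfolding contractible_space_def homotopic_with_def by blast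
qed

lemma contractible_prism_top: "contractible_space (prism_top p)"
  by (simp add: contractible_space_prod_topology contractible_simplex_top convex_imp_contractible)

text \<open>A chain \<open>x\<close> on the model prism, the product of the unit interval and the
  standard simplex, is transported along every singular simplex \<open>r\<close>. Naturality is
  thereby built in; with a suitable \<open>x\<close> this is the prism operator.\<close>

definition prism_op :: "nat \<Rightarrow> (real \<times> (nat \<Rightarrow> real)) chain \<Rightarrow> 'a chain \<Rightarrow> (real \<times> 'a) chain" where
  "prism_op p x = frag_extend (\<lambda>r. chain_map (Suc p) (\<lambda>(s, z). (s, r z)) x)"

lemma prism_op_simps:
  "prism_op p x 0 = 0" "prism_op p x (c - d) = prism_op p x c - prism_op p x d"
  "prism_op p x (frag_of r) = chain_map (Suc p) (\<lambda>(s, z). (s, r z)) x"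
  by (auto simp: prism_op_def frag_extend_diff)

lemma continuous_map_prism:
  assumes "continuous_map X Y r"
  shows "continuous_map (prod_topology (top_of_set {0..1::real}) X) (prod_topology (top_of_set {0..1}) Y)
           (\<lambda>(s, z). (s, r z))"
  unfolding case_prod_unfold
  by (intro continuous_map_pairedI continuous_map_fst continuous_map_compose[OF continuous_map_snd assms, unfolded o_def])

lemma singular_chain_prism_op:
  assumes x: "singular_chain (Suc p) (prism_top p) x" and c: "singular_chain p Y c"
  shows "singular_chain (Suc p) (prod_topology (top_of_set {0..1}) Y) (prism_op p x c)"
  using c unfolding singular_chain_def[of p]
proof (induction c rule: frag_induction)
  case (one r)
  then have "continuous_map (simplex_top p) Y r" by (simp add: singular_simplex_def)
  then show ?case unfolding prism_op_simps
    by (intro singular_chain_chain_map[OF x] continuous_map_prism)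
qed (auto simp: prism_op_simps singular_chain_diff)

lemma prism_op_natural:
  assumes x: "singular_chain (Suc p) (prism_top p) x" and c: "singular_chain p Y c"
  shows "prism_op p x (chain_map p g c) = chain_map (Suc p) (\<lambda>(s, z). (s, g z)) (prism_op p x c)"
  using c unfolding singular_chain_def[of p]
proof (induction c rule: frag_induction)
  case (one r)
  have "chain_map (Suc p) (\<lambda>(s, z). (s, simplex_map p g r z)) x =
      chain_map (Suc p) ((\<lambda>(s, z). (s, g z)) \<circ> (\<lambda>(s, z). (s, r z))) x"
    by (rule chain_map_eq[OF x]) (auto simp: simplex_map_def)
  then show ?case by (simp add: prism_op_simps chain_map_compose)
qed (auto simp: prism_op_simps chain_map_diff)

abbreviation simplex_id :: "nat \<Rightarrow> (nat \<Rightarrow> real) chain" where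
  "simplex_id p \<equiv> frag_of (restrict id (standard_simplex p))"

lemma singular_chain_simplex_id: "singular_chain p (simplex_top p) (simplex_id p)"
  by (auto simp: singular_chain_of singular_simplex_def intro: continuous_map_eq[OF continuous_map_id])

lemma chain_map_simplex_slice:
  assumes "singular_simplex p Y r"
  shows "chain_map p (\<lambda>(s, z). (s, r z)) (chain_map p (Pair t) (simplex_id p)) = chain_map p (Pair t) (frag_of r)"
proof -
  have "(\<lambda>(s, z). (s, r z)) \<circ> Pair t = Pair t \<circ> r" by auto
  then have "chain_map p (\<lambda>(s, z). (s, r z)) (chain_map p (Pair t) c) = chain_map p (Pair t) (chain_map p r c)" for c
    using chain_map_compose[of p "\<lambda>(s, z). (s, r z)" "Pair t"] chain_map_compose[of p "Pair t" r]
    by (metis comp_apply)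
  then show ?thesis
    by (simp add: singular_simplex_chain_map_id[OF assms] del: chain_map_of)
qed

lemma boundary_prism_op_0:
  assumes x: "singular_chain (Suc 0) (prism_top 0) x"
    and bx: "chain_boundary (Suc 0) x = chain_map 0 (Pair 1) (simplex_id 0) - chain_map 0 (Pair 0) (simplex_id 0)"
    and c: "singular_chain 0 Y c"
  shows "chain_boundary (Suc 0) (prism_op 0 x c) = chain_map 0 (Pair 1) c - chain_map 0 (Pair 0) c"
  using c unfolding singular_chain_def[of 0]
proof (induction c rule: frag_induction)
  case (one r)
  then show ?case
    using chain_boundary_chain_map[OF x, of "\<lambda>(s, z). (s, r z)"]
    by (simp add: prism_op_simps bx chain_map_diff chain_map_simplex_slice del: chain_map_of)
qed (auto simp: prism_op_simps chain_boundary_diff chain_map_diff)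

text \<open>By naturality, the homotopy formula for all chains follows from its instance
  \<open>yb\<close> at the identity simplex.\<close>

lemma boundary_prism_op_Suc:
  assumes x: "singular_chain (Suc n) (prism_top n) x" and y: "singular_chain (Suc (Suc n)) (prism_top (Suc n)) y"
    and yb: "chain_boundary (Suc (Suc n)) y = chain_map (Suc n) (Pair 1) (simplex_id (Suc n))
       - chain_map (Suc n) (Pair 0) (simplex_id (Suc n)) - prism_op n x (chain_boundary (Suc n) (simplex_id (Suc n)))"
    and c: "singular_chain (Suc n) Y c"
  shows "chain_boundary (Suc (Suc n)) (prism_op (Suc n) y c) =
     chain_map (Suc n) (Pair 1) c - chain_map (Suc n) (Pair 0) c - prism_op n x (chain_boundary (Suc n) c)"
  using c unfolding singular_chain_def[of "Suc n"]
proof (induction c rule: frag_induction)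
  case (one r)
  let ?r = "\<lambda>(s, z). (s, r z)"
  have r: "singular_simplex (Suc n) Y r" using one by simp
  have i: "singular_chain (Suc n) (simplex_top (Suc n)) (simplex_id (Suc n))"
    by (rule singular_chain_simplex_id)
  then have b: "singular_chain n (simplex_top (Suc n)) (chain_boundary (Suc n) (simplex_id (Suc n)))"
    by (rule singular_chain_boundary_alt)
  have "chain_map (Suc n) ?r (prism_op n x (chain_boundary (Suc n) (simplex_id (Suc n)))) =
      prism_op n x (chain_boundary (Suc n) (frag_of r))"
    using prism_op_natural[OF x b, of r] chain_boundary_chain_map[OF i, of r]
      singular_simplex_chain_map_id[OF r] by (simp del: chain_map_of)
  then show ?case
    using chain_boundary_chain_map[OF y, of ?r] chain_map_simplex_slice[OF r, of "0::real"]
      chain_map_simplex_slice[OF r, of "1::real"]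
    by (simp add: prism_op_simps yb chain_map_diff del: chain_map_of)
qed (auto simp: prism_op_simps chain_boundary_diff chain_map_diff)

text \<open>The boundary prescribed for \<open>d (Suc n)\<close> involves \<open>d n\<close> and is
  a cycle by the formula in degree \<open>n\<close>; since the prism is contractible, it
  bounds.\<close>

lemma prism_chains_exist:
  obtains d where "\<And>p. singular_chain (Suc p) (prism_top p) (d p)"
    "chain_boundary (Suc 0) (d 0) = chain_map 0 (Pair 1) (simplex_id 0) - chain_map 0 (Pair 0) (simplex_id 0)"
    "\<And>n. chain_boundary (Suc (Suc n)) (d (Suc n)) = chain_map (Suc n) (Pair 1) (simplex_id (Suc n))
       - chain_map (Suc n) (Pair 0) (simplex_id (Suc n)) - prism_op n (d n) (chain_boundary (Suc n) (simplex_id (Suc n)))"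
proof -
  let ?i = "\<lambda>p t. chain_map p (Pair t) (simplex_id p) :: (real \<times> (nat \<Rightarrow> real)) chain"
  have Pc: "continuous_map (simplex_top p) (prism_top p) (Pair t)" if "t \<in> {0..1}" for p and t :: real
    using that by (intro continuous_map_pairedI) auto
  \<comment> \<open>The induction uses the homotopy formula in degree \<open>n\<close> for cycles
    only, as it is applied to the boundary of the identity simplex. \<open>Q\<close> links
    successive choices, so that dependent choice yields one sequence.\<close>
  define P where "P n x \<longleftrightarrow> singular_chain (Suc n) (prism_top n) x \<and>
     (\<forall>Y c. singular_chain n Y c \<and> chain_boundary n c = 0 \<longrightarrow>
        chain_boundary (Suc n) (prism_op n x c) = chain_map n (Pair 1) (c :: (nat \<Rightarrow> real) chain) - chain_map n (Pair 0) c) \<and>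
     (n = 0 \<longrightarrow> chain_boundary (Suc 0) x = ?i 0 1 - ?i 0 0)" for n x
  define Q where "Q n x y \<longleftrightarrow> chain_boundary (Suc (Suc n)) y = ?i (Suc n) 1 - ?i (Suc n) 0
       - prism_op n x (chain_boundary (Suc n) (simplex_id (Suc n)))" for n x y
  \<comment> \<open>Degree 0 is treated apart, because a 0-cycle in a contractible space need not
    bound: the two end slices are homotopic as maps into a contractible space, hence
    homologous.\<close>
  have "\<exists>x. P 0 x"
  proof -
    have "homotopic_with (\<lambda>h. h \<in> {} \<rightarrow> {}) (simplex_top 0) (prism_top 0) (Pair 1) (Pair 0)"
    proof -
      have "homotopic_with (\<lambda>x. True) (simplex_top 0) (prism_top 0) (Pair 1) (Pair 0)"
        by (rule homotopic_into_contractible_space) (simp add: Pc contractible_prism_top)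
      then show ?thesis by (simp add: homotopic_with_def)
    qed
    moreover have "singular_relcycle 0 (simplex_top 0) {} (simplex_id 0)"
      using singular_chain_simplex_id[of 0] by (simp add: singular_cycle chain_boundary_def)
    ultimately have "homologous_rel 0 (prism_top 0) {} (?i 0 1) (?i 0 0)"
      by (rule homotopic_imp_homologous_rel_chain_maps)
    then obtain x where x: "singular_chain (Suc 0) (prism_top 0) x" "chain_boundary (Suc 0) x = ?i 0 1 - ?i 0 0"
      unfolding homologous_rel_def singular_boundary by auto
    then have "P 0 x" unfolding P_def using boundary_prism_op_0[OF x] by auto
    then show ?thesis ..
  qed
  moreover have "\<exists>y. P (Suc n) y \<and> Q n x y" if Px: "P n x" for n x
  proof -
    let ?b = "chain_boundary (Suc n) (simplex_id (Suc n))"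
    let ?z = "?i (Suc n) 1 - ?i (Suc n) 0 - prism_op n x ?b"
    have x: "singular_chain (Suc n) (prism_top n) x" using Px by (simp add: P_def)
    have i: "singular_chain (Suc n) (simplex_top (Suc n)) (simplex_id (Suc n))"
      by (rule singular_chain_simplex_id)
    have b: "singular_chain n (simplex_top (Suc n)) ?b" by (rule singular_chain_boundary_alt[OF i])
    have bb: "chain_boundary n ?b = 0" by (rule chain_boundary_boundary_alt[OF i])
    have "chain_boundary (Suc n) (prism_op n x ?b) = chain_map n (Pair 1) ?b - chain_map n (Pair 0) ?b"
      using Px b bb unfolding P_def by blast
    then have "chain_boundary (Suc n) ?z = 0"
      using chain_boundary_chain_map[OF i, of "Pair (0::real)"] chain_boundary_chain_map[OF i, of "Pair (1::real)"]
      by (simp add: chain_boundary_diff del: chain_map_of)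
    moreover have "singular_chain (Suc n) (prism_top (Suc n)) ?z"
      by (intro singular_chain_diff singular_chain_chain_map[OF i] Pc singular_chain_prism_op[OF x b]) auto
    ultimately have "singular_relcycle (Suc n) (prism_top (Suc n)) {} ?z" by (simp add: singular_cycle)
    then have "singular_relboundary (Suc n) (prism_top (Suc n)) {} ?z"
      by (intro contractible_cycle_imp_boundary contractible_prism_top) auto
    then obtain y where y: "singular_chain (Suc (Suc n)) (prism_top (Suc n)) y" "chain_boundary (Suc (Suc n)) y = ?z"
      by (auto simp: singular_boundary)
    have "P (Suc n) y"
      unfolding P_def
    proof (intro conjI allI impI)
      show "chain_boundary (Suc (Suc n)) (prism_op (Suc n) y c) = chain_map (Suc n) (Pair 1) c - chain_map (Suc n) (Pair 0) c"
        if "singular_chain (Suc n) Y c \<and> chain_boundary (Suc n) c = 0" for Y and c :: "(nat \<Rightarrow> real) chain"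
        using boundary_prism_op_Suc[OF x y, of Y c] that by (simp add: prism_op_simps)
    qed (use y(1) in auto)
    then show ?thesis using y(2) by (auto simp: Q_def)
  qed
  ultimately obtain d where "\<And>n. P n (d n)" "\<And>n. Q n (d n) (d (Suc n))"
    using dependent_nat_choice[of P Q] by blast
  then show ?thesis using that[of d] unfolding P_def Q_def by blast
qed

text \<open>The prism operator followed by the homotopy \<open>h\<close>. The result is additive in
  all chains, as an extension to field coefficients demands. At \<open>p = 0\<close> the index
  \<open>p - Suc 0\<close> is harmless, since the boundary vanishes there.\<close>

proposition homotopic_imp_chain_homotopy:
  assumes "homotopic_with (\<lambda>x. True) X Y f g"
  obtains K where "\<And>p c d. K p (c - d) = K p c - K p d"
    "\<And>p c. singular_chain p X c \<Longrightarrow> singular_chain (Suc p) Y (K p c)"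
    "\<And>p c. singular_chain p X c \<Longrightarrow>
       chain_boundary (Suc p) (K p c) + K (p - Suc 0) (chain_boundary p c) = chain_map p g c - chain_map p f c"
proof -
  obtain h :: "real \<times> _ \<Rightarrow> _" where h: "continuous_map (prod_topology (top_of_set {0..1}) X) Y h" "\<And>x. h (0, x) = f x" "\<And>x. h (1, x) = g x"
    using assms unfolding homotopic_with_def by blast
  obtain d where d: "\<And>p. singular_chain (Suc p) (prism_top p) (d p)"
    "chain_boundary (Suc 0) (d 0) = chain_map 0 (Pair 1) (simplex_id 0) - chain_map 0 (Pair 0) (simplex_id 0)"
    "\<And>n. chain_boundary (Suc (Suc n)) (d (Suc n)) = chain_map (Suc n) (Pair 1) (simplex_id (Suc n))
       - chain_map (Suc n) (Pair 0) (simplex_id (Suc n)) - prism_op n (d n) (chain_boundary (Suc n) (simplex_id (Suc n)))"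
    using prism_chains_exist by blast
  have fg: "f = h \<circ> Pair 0" "g = h \<circ> Pair 1" using h by auto
  have fgc: "chain_map p f c = chain_map p h (chain_map p (Pair 0) c)"
    "chain_map p g c = chain_map p h (chain_map p (Pair 1) c)" for p c
    unfolding fg chain_map_compose by simp_all
  define K where "K p c = chain_map (Suc p) h (prism_op p (d p) c)" for p c
  show thesis
  proof
    show "K p (c - d) = K p c - K p d" for p c d by (simp add: K_def prism_op_simps chain_map_diff)
    show "singular_chain (Suc p) Y (K p c)" if "singular_chain p X c" for p c
      unfolding K_def by (rule singular_chain_chain_map[OF singular_chain_prism_op[OF d(1) that] h(1)])
    show "chain_boundary (Suc p) (K p c) + K (p - Suc 0) (chain_boundary p c) = chain_map p g c - chain_map p f c"
      if c: "singular_chain p X c" for p c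
    proof (cases p)
      case 0
      then show ?thesis
        using c boundary_prism_op_0[OF d(1,2), of X c]
          chain_boundary_chain_map[OF singular_chain_prism_op[OF d(1) c], of h]
        by (simp add: K_def fgc chain_map_diff prism_op_simps chain_boundary_def[of 0])
    next
      case (Suc n)
      then show ?thesis
        using c boundary_prism_op_Suc[OF d(1) d(1) d(3), of n X c]
          chain_boundary_chain_map[OF singular_chain_prism_op[OF d(1) c], of h]
        by (simp add: K_def fgc chain_map_diff)
    qed
  qed
qed

section \<open>Homology of subspaces\<close>

context coeff_field
begin

abbreviation bd :: "nat \<Rightarrow> ('f, 'a) field_chain \<Rightarrow> ('f, 'a) field_chain" where
  "bd p \<equiv> chain_ext (chain_boundary p)"

abbreviation Ch :: "nat \<Rightarrow> 'a::topological_space set \<Rightarrow> ('f, 'a) field_chain set" where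
  "Ch p S \<equiv> fchains p (top_of_set S)"

abbreviation cyc :: "nat \<Rightarrow> 'a::topological_space set \<Rightarrow> ('f, 'a) field_chain set" where
  "cyc p S \<equiv> cycles F p (top_of_set S)"

abbreviation bnd :: "nat \<Rightarrow> 'a::topological_space set \<Rightarrow> ('f, 'a) field_chain set" where
  "bnd p S \<equiv> boundaries F p (top_of_set S)"

lemma fchains_bd: "c \<in> fchains p X \<Longrightarrow> bd p c \<in> fchains (p - Suc 0) X"
  by (rule chain_ext_fchains) (auto intro: singular_chain_boundary simp: singular_chain_of)

lemma fchains_bd_Suc: "c \<in> fchains (Suc p) X \<Longrightarrow> bd (Suc p) c \<in> fchains p X"
  using fchains_bd[of c "Suc p" X] by simp

lemma bd_bd:
  assumes "c \<in> fchains (Suc p) X"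
  shows "bd p (bd (Suc p) c) = czero"
proof -
  have "bd p (bd (Suc p) c) = chain_ext (\<lambda>x. chain_boundary p (chain_boundary (Suc p) x)) c"
    using fchainsD(1)[OF assms] by (intro chain_ext_comp) (auto simp: chain_boundary_diff)
  also have "\<dots> = chain_ext (\<lambda>x. 0) c"
    by (rule chain_ext_cong[OF fchainsD(3)[OF assms] _ fchainsD(2)[OF assms]])
      (auto intro!: chain_boundary_boundary_alt simp: singular_chain_of)
  finally show ?thesis using fchainsD(1)[OF assms] by (simp add: chain_ext_zero_op)
qed

lemma bd_0: "fchain c \<Longrightarrow> bd 0 c = czero"
  using chain_ext_zero_op[of c] by (simp add: chain_boundary_def[abs_def])

lemma csubspace_cycles: "csubspace (cycles F p X)"
  unfolding cycles_eq
  by (rule csubspaceI)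
    (use csubspaceD[OF csubspace_fchains[of p X]] in
      \<open>auto simp: chain_ext_cadd chain_ext_cscale fchainsD(1) cscale_simps\<close>)

lemma csubspace_boundaries: "csubspace (boundaries F p X)"
proof (rule csubspaceI)
  note f = csubspaceD[OF csubspace_fchains[of "Suc p" X]]
  show "boundaries F p X \<subseteq> cfun"
    by (auto simp: boundaries_eq dest: fchainsD(2))
  show "czero \<in> boundaries F p X"
    unfolding boundaries_eq using f(2) by (intro image_eqI[of _ _ czero]) auto
  show "cadd c d \<in> boundaries F p X" if "c \<in> boundaries F p X" "d \<in> boundaries F p X" for c d
  proof -
    obtain x y where "x \<in> fchains (Suc p) X" "y \<in> fchains (Suc p) X" "c = bd (Suc p) x" "d = bd (Suc p) y"
      using \<open>c \<in> _\<close> \<open>d \<in> _\<close> by (auto simp: boundaries_eq)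
    then show ?thesis
      unfolding boundaries_eq using f(3) by (intro image_eqI[of _ _ "cadd x y"]) (auto simp: chain_ext_cadd fchainsD(1))
  qed
  show "cscale a c \<in> boundaries F p X" if a: "a \<in> carrier F" and "c \<in> boundaries F p X" for a c
  proof -
    obtain x where "x \<in> fchains (Suc p) X" "c = bd (Suc p) x"
      using \<open>c \<in> _\<close> by (auto simp: boundaries_eq)
    then show ?thesis
      unfolding boundaries_eq using f(4) a by (intro image_eqI[of _ _ "cscale a x"]) (auto simp: chain_ext_cscale fchainsD(1))
  qed
qed

lemmas cycD = csubspaceD[OF csubspace_cycles]
lemmas bndD = csubspaceD[OF csubspace_boundaries]
lemmas ChD = csubspaceD[OF csubspace_fchains]

lemma cycI: "c \<in> fchains p X \<Longrightarrow> bd p c = czero \<Longrightarrow> c \<in> cycles F p X"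
  by (simp add: cycles_eq)

lemma cyc_fchains: "c \<in> cycles F p X \<Longrightarrow> c \<in> fchains p X"
  and cyc_bd: "c \<in> cycles F p X \<Longrightarrow> bd p c = czero"
  by (simp_all add: cycles_eq)

lemma bndI: "c \<in> fchains (Suc p) X \<Longrightarrow> bd (Suc p) c \<in> boundaries F p X"
  by (auto simp: boundaries_eq)

lemma bndE: "b \<in> boundaries F p X \<Longrightarrow> (\<And>c. c \<in> fchains (Suc p) X \<Longrightarrow> b = bd (Suc p) c \<Longrightarrow> P) \<Longrightarrow> P"
  by (auto simp: boundaries_eq)

lemma csub_sym: "csubspace B \<Longrightarrow> x \<in> cfun \<Longrightarrow> y \<in> cfun \<Longrightarrow> csub x y \<in> B \<Longrightarrow> csub y x \<in> B"
proof -
  assume B: "csubspace B" and xy: "x \<in> cfun" "y \<in> cfun" "csub x y \<in> B"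
  have "csub y x = csub czero (csub x y)"
    using xy by (auto simp: csub_def czero_def a_minus_def minus_add a_ac)
  then show ?thesis using csubspaceD(5)[OF B csubspaceD(2)[OF B] xy(3)] by simp
qed

lemma Ch_mono: "S \<subseteq> T \<Longrightarrow> Ch p S \<subseteq> Ch p T"
  unfolding fchains_def singular_simplex_subtopology by blast

lemma cyc_mono: "S \<subseteq> T \<Longrightarrow> cyc p S \<subseteq> cyc p T"
  using Ch_mono[of S T p] by (auto simp: cycles_eq)

lemma bnd_mono: "S \<subseteq> T \<Longrightarrow> bnd p S \<subseteq> bnd p T"
  using Ch_mono[of S T "Suc p"] by (auto simp: boundaries_eq)

lemma Ch_Int: "Ch p (U \<inter> V) = Ch p U \<inter> Ch p V"
  unfolding fchains_def singular_simplex_subtopology by blast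

lemma Ch_empty: "Ch p ({} :: 'a::topological_space set) = {czero}"
proof -
  have "c = czero" if "csupp c \<subseteq> singular_simplex_set p (top_of_set {})" for c :: "('f, 'a) field_chain"
    using that by (auto simp: csupp_def czero_def singular_simplex_empty fun_eq_iff)
  then show ?thesis using csubspaceD(2)[OF csubspace_fchains[of p "top_of_set {}"]] by (auto simp: fchains_def)
qed

abbreviation push :: "nat \<Rightarrow> ('a \<Rightarrow> 'b) \<Rightarrow> ('f, 'a) field_chain \<Rightarrow> ('f, 'b) field_chain" where
  "push p f \<equiv> chain_ext (chain_map p f)"

lemma push_fchains:
  "c \<in> fchains p X \<Longrightarrow> continuous_map X Y f \<Longrightarrow> push p f c \<in> fchains p Y"
  by (rule chain_ext_fchains) (auto simp: singular_chain_of intro: singular_simplex_simplex_map)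

lemma chain_ext_comp_cong:
  assumes c: "c \<in> fchains p X" and T: "\<And>x y. T (x - y) = T x - T y" and T': "\<And>x y. T' (x - y) = T' x - T' y"
    and eq: "\<And>r. singular_simplex p X r \<Longrightarrow> T (U (frag_of r)) = T' (U' (frag_of r))"
  shows "chain_ext T (chain_ext U c) = chain_ext T' (chain_ext U' c)"
  using chain_ext_comp[OF fchainsD(1)[OF c], of T U] chain_ext_comp[OF fchainsD(1)[OF c], of T' U'] T T'
    chain_ext_cong[OF fchainsD(3)[OF c], of "\<lambda>x. T (U x)" "\<lambda>x. T' (U' x)"] eq fchainsD(2)[OF c]
  by simp

lemma bd_push:
  assumes c: "c \<in> fchains p X"
  shows "bd p (push p f c) = push (p - Suc 0) f (bd p c)"
  by (rule chain_ext_comp_cong[OF c])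
    (auto simp: chain_boundary_diff chain_map_diff chain_boundary_chain_map[of p X] singular_chain_of simp del: chain_map_of)

lemma push_cyc: "c \<in> cycles F p X \<Longrightarrow> continuous_map X Y f \<Longrightarrow> push p f c \<in> cycles F p Y"
  by (auto intro!: cycI push_fchains simp: cyc_fchains bd_push[OF cyc_fchains] cyc_bd)

lemma push_bnd:
  assumes "c \<in> boundaries F p X" "continuous_map X Y f" 
  shows "push p f c \<in> boundaries F p Y"
  using assms(1)
proof (rule bndE)
  fix d assume d: "d \<in> fchains (Suc p) X" "c = bd (Suc p) d"
  then have "push p f c = bd (Suc p) (push (Suc p) f d)" using bd_push[OF d(1), of f] by simp
  then show ?thesis using push_fchains[OF d(1) assms(2)] bndI by simp
qed

lemma push_id:
  assumes "c \<in> fchains p X" "\<And>x. x \<in> topspace X \<Longrightarrow> f x = x"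
  shows "push p f c = c"
proof -
  have "push p f c = chain_ext (\<lambda>x. x) c"
    by (rule chain_ext_cong[OF fchainsD(3)[OF assms(1)] _ fchainsD(2)[OF assms(1)]])
      (auto simp: simplex_map_id_gen assms)
  then show ?thesis using chain_ext_id_op[OF fchainsD(1)[OF assms(1)]] by simp
qed

text \<open>On a cycle the second term of the homotopy formula disappears, so the two images differ
  by the boundary of the extension of \<open>K p\<close>.\<close>

lemma chain_homotopy_cycle:
  assumes z: "z \<in> cycles F p X"
    and K: "\<And>p c d. K p (c - d) = K p c - K p d"
    and KY: "\<And>p c. singular_chain p X c \<Longrightarrow> singular_chain (Suc p) Y (K p c)"
    and KT: "\<And>p c. singular_chain p X c \<Longrightarrow>
       chain_boundary (Suc p) (K p c) + K (p - Suc 0) (chain_boundary p c) = T p c - U p c"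
  shows "csub (chain_ext (T p) z) (chain_ext (U p) z) \<in> boundaries F p Y"
proof -
  note zc = cyc_fchains[OF z]
  note f = fchainsD(1)[OF zc]
  have "csub (chain_ext (T p) z) (chain_ext (U p) z) = chain_ext (\<lambda>x. T p x - U p x) z"
    using f by (simp add: chain_ext_diff_op)
  also have "\<dots> = chain_ext (\<lambda>x. chain_boundary (Suc p) (K p x) + K (p - Suc 0) (chain_boundary p x)) z"
    by (rule chain_ext_cong[OF fchainsD(3)[OF zc] _ fchainsD(2)[OF zc]]) (simp add: KT singular_chain_of)
  also have "\<dots> = cadd (bd (Suc p) (chain_ext (K p) z)) (chain_ext (K (p - Suc 0)) (bd p z))"
    using f by (simp add: chain_ext_add_op chain_ext_comp chain_boundary_diff K)
  also have "\<dots> = bd (Suc p) (chain_ext (K p) z)"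
    using f by (simp add: cyc_bd[OF z])
  also have "\<dots> \<in> boundaries F p Y"
    by (intro bndI chain_ext_fchains[OF zc] KY) (simp add: singular_chain_of)
  finally show ?thesis .
qed

lemma homotopic_push_cyc:
  assumes "homotopic_with (\<lambda>x. True) X Y f g" and z: "z \<in> cycles F p X"
  shows "csub (push p g z) (push p f z) \<in> boundaries F p Y"
proof -
  obtain K where K: "\<And>p c d. K p (c - d) = K p c - K p d"
    "\<And>p c. singular_chain p X c \<Longrightarrow> singular_chain (Suc p) Y (K p c)"
    "\<And>p c. singular_chain p X c \<Longrightarrow>
       chain_boundary (Suc p) (K p c) + K (p - Suc 0) (chain_boundary p c) = chain_map p g c - chain_map p f c"
    using homotopic_imp_chain_homotopy[OF assms(1)] by blast
  show ?thesis
    using chain_homotopy_cycle[OF z, where K = K and T = "\<lambda>p. chain_map p g" and U = "\<lambda>p. chain_map p f"] K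
    by blast
qed

section \<open>Barycentric subdivision and small chains\<close>

abbreviation sd :: "nat \<Rightarrow> nat \<Rightarrow> ('f, 'a) field_chain \<Rightarrow> ('f, 'a) field_chain" where
  "sd n p \<equiv> chain_ext (singular_subdivision p ^^ n)"

lemma singular_chain_subdivision_pow:
  "singular_chain p X c \<Longrightarrow> singular_chain p X ((singular_subdivision p ^^ n) c)"
  by (induction n) (auto intro: singular_chain_singular_subdivision)

lemma sd_fchains: "c \<in> fchains p X \<Longrightarrow> sd n p c \<in> fchains p X"
  by (rule chain_ext_fchains) (auto simp: singular_chain_of intro: singular_chain_subdivision_pow)

lemma bd_sd:
  assumes c: "c \<in> fchains p X"
  shows "bd p (sd n p c) = sd n (p - Suc 0) (bd p c)"
proof (rule chain_ext_comp_cong[OF c])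
  show "chain_boundary p ((singular_subdivision p ^^ n) (frag_of r)) =
      (singular_subdivision (p - Suc 0) ^^ n) (chain_boundary p (frag_of r))" if r: "singular_simplex p X r" for r
  proof (induction n)
    case (Suc n)
    have "singular_chain p X ((singular_subdivision p ^^ n) (frag_of r))"
      using r by (auto simp: singular_chain_of intro: singular_chain_subdivision_pow)
    then show ?case using Suc by (simp add: chain_boundary_singular_subdivision)
  qed simp
qed (auto simp: chain_boundary_diff singular_subdivision_power_diff)

lemma sd_cyc:
  fixes X :: "'a topology"
  assumes z: "z \<in> cycles F p X"
  shows "csub (sd n p z) z \<in> boundaries F p X"
proof -
  obtain h where h: "\<And>p c d. h p (c - d) = h p c - h p (d :: 'a chain)"
    "\<And>p X c. singular_chain p X c \<Longrightarrow> singular_chain (Suc p) X (h p c)"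
    "\<And>p X c. singular_chain p X c
                 \<Longrightarrow> chain_boundary (Suc p) (h p c) + h (p - Suc 0) (chain_boundary p c)
                   = (singular_subdivision p ^^ n) c - c"
    using chain_homotopic_iterated_singular_subdivision[where n = n] by metis
  have "csub (chain_ext (singular_subdivision p ^^ n) z) (chain_ext (\<lambda>x. x) z) \<in> boundaries F p X"
    using chain_homotopy_cycle[OF z, where K = h and T = "\<lambda>p. singular_subdivision p ^^ n" and U = "\<lambda>p x. x"] h
    by blast
  then show ?thesis using chain_ext_id_op[OF fchainsD(1)[OF cyc_fchains[OF z]]] by simp
qed

lemma sd_cyc_cyc: "z \<in> cycles F p X \<Longrightarrow> sd n p z \<in> cycles F p X"
  by (auto intro!: cycI sd_fchains simp: cyc_fchains bd_sd[OF cyc_fchains] cyc_bd)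

lemma csupp_chain_ext:
  assumes "fchain c" "csupp c \<subseteq> S"
  shows "csupp (chain_ext T c) \<subseteq> (\<Union>r\<in>S. Poly_Mapping.keys (T (frag_of r)))"
  using assms
proof (induction c rule: fchain_induct)
  case (single a r)
  then show ?case using csupp_chain_emb[of a "T (frag_of r)"] by (auto simp: chain_ext_single)
next
  case (add c d)
  then show ?case using csupp_cadd[of "chain_ext T c" "chain_ext T d"] by (auto simp: chain_ext_cadd)
qed auto

lemma fchain_split:
  assumes c: "fchain c" and AB: "csupp c \<subseteq> A \<union> B"
  obtains u v where "fchain u" "fchain v" "csupp u \<subseteq> A" "csupp v \<subseteq> B" "c = cadd u v"
proof
  let ?u = "\<lambda>s. if s \<in> A then c s else \<zero>\<^bsub>F\<^esub>" and ?v = "\<lambda>s. if s \<in> A then \<zero>\<^bsub>F\<^esub> else c s"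
  have "csupp ?u \<subseteq> csupp c" "csupp ?v \<subseteq> csupp c" by (auto simp: csupp_def)
  then show "fchain ?u" "fchain ?v" using c finite_subset by (auto simp: fchain_def cfun_def)
  show "csupp ?u \<subseteq> A" "csupp ?v \<subseteq> B" using AB by (auto simp: csupp_def)
  show "c = cadd ?u ?v" using c by (auto simp: cadd_def)
qed

text \<open>A Lebesgue number argument for each simplex of the support, with one number of
  subdivisions for all of these finitely many simplices. Only the smaller sets \<open>U'\<close> and
  \<open>V'\<close> are open in \<open>S\<close>; this matters because the convex piece of the cover
  will be a closed cell.\<close>

lemma sd_small:
  assumes U': "openin (top_of_set S) U'" "U' \<subseteq> U" and V': "openin (top_of_set S) V'" "V' \<subseteq> V"
    and S: "S \<subseteq> U' \<union> V'" and c: "c \<in> Ch p S"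
  obtains n u v where "u \<in> Ch p U" "v \<in> Ch p V" "sd n p c = cadd u v"
proof -
  have "\<exists>n. \<forall>m\<ge>n. Poly_Mapping.keys ((singular_subdivision p ^^ m) (frag_of r)) \<subseteq>
      singular_simplex_set p (top_of_set U) \<union> singular_simplex_set p (top_of_set V)" if r: "r \<in> csupp c" for r
  proof -
    have rS: "singular_chain p (top_of_set S) (frag_of r)"
      using fchainsD(3)[OF c] r by (auto simp: singular_chain_of)
    obtain n where n: "\<And>m f. n \<le> m \<Longrightarrow> f \<in> Poly_Mapping.keys ((singular_subdivision p ^^ m) (frag_of r))
         \<Longrightarrow> \<exists>W \<in> {U', V'}. f \<in> standard_simplex p \<rightarrow> W"
      by (rule sufficient_iterated_singular_subdivision_exists[OF _ _ rS, of "{U', V'}"])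
        (use U' V' S in auto)
    have "Poly_Mapping.keys ((singular_subdivision p ^^ m) (frag_of r)) \<subseteq>
      singular_simplex_set p (top_of_set U) \<union> singular_simplex_set p (top_of_set V)" if "m \<ge> n" for m
    proof
      fix f assume f: "f \<in> Poly_Mapping.keys ((singular_subdivision p ^^ m) (frag_of r))"
      then have "singular_simplex p (top_of_set S) f"
        using singular_chain_subdivision_pow[OF rS, of m] by (auto simp: singular_chain_def)
      moreover have "f ` standard_simplex p \<subseteq> U \<or> f ` standard_simplex p \<subseteq> V"
        using n[OF that f] U'(2) V'(2) by (auto simp: Pi_iff)
      ultimately show "f \<in> singular_simplex_set p (top_of_set U) \<union> singular_simplex_set p (top_of_set V)"
        unfolding singular_simplex_subtopology by blast
    qed
    then show ?thesis by blast
  qed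
  then obtain N where N: "\<And>r m. r \<in> csupp c \<Longrightarrow> m \<ge> N r \<Longrightarrow>
      Poly_Mapping.keys ((singular_subdivision p ^^ m) (frag_of r)) \<subseteq>
      singular_simplex_set p (top_of_set U) \<union> singular_simplex_set p (top_of_set V)"
    by metis
  define n where "n = Max (insert 0 (N ` csupp c))"
  have fin: "finite (csupp c)" using fchainsD(1)[OF c] by (simp add: fchain_def)
  have "N r \<le> n" if "r \<in> csupp c" for r using that fin by (simp add: n_def)
  then have "csupp (sd n p c) \<subseteq> singular_simplex_set p (top_of_set U) \<union> singular_simplex_set p (top_of_set V)"
    using csupp_chain_ext[OF fchainsD(1)[OF c] order.refl, of "singular_subdivision p ^^ n"] N[of _ n] by blast
  from fchain_split[OF fchain_chain_ext[OF fchainsD(1)[OF c]] this]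
  obtain u v where "fchain u" "fchain v" "csupp u \<subseteq> singular_simplex_set p (top_of_set U)"
    "csupp v \<subseteq> singular_simplex_set p (top_of_set V)" "sd n p c = cadd u v"
    by metis
  then show ?thesis using that[of u v n] by (simp add: fchains_def)
qed

section \<open>Comparison of quotients and of inclusions\<close>

lemma csumE: "x \<in> csum Z W \<Longrightarrow> (\<And>z w. z \<in> Z \<Longrightarrow> w \<in> W \<Longrightarrow> x = cadd z w \<Longrightarrow> P) \<Longrightarrow> P"
  by (auto simp: csum_def)

lemma csumI: "z \<in> Z \<Longrightarrow> w \<in> W \<Longrightarrow> cadd z w \<in> csum Z W"
  by (auto simp: csum_def)

lemma csum_iff_csub:
  assumes "csubspace Z" "csubspace W" "x \<in> cfun"
  shows "x \<in> csum Z W \<longleftrightarrow> (\<exists>z\<in>Z. csub x z \<in> W)"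
proof
  assume "x \<in> csum Z W"
  then obtain z w where "z \<in> Z" "w \<in> W" "x = cadd z w" by (auto simp: csum_def)
  then show "\<exists>z\<in>Z. csub x z \<in> W"
    using csubspaceD(1)[OF assms(1)] csubspaceD(1)[OF assms(2)] by (intro bexI[of _ z]) auto
next
  assume "\<exists>z\<in>Z. csub x z \<in> W"
  then obtain z where "z \<in> Z" "csub x z \<in> W" by blast
  then show "x \<in> csum Z W"
    using csumI[of z Z "csub x z" W] csubspaceD(1)[OF assms(1)] assms(3) by simp
qed

lemma csum_upper:
  assumes "csubspace Z" "csubspace W"
  shows "Z \<subseteq> csum Z W" "W \<subseteq> csum Z W"
proof -
  show "Z \<subseteq> csum Z W"
    using csubspaceD(1)[OF assms(1)] csubspaceD(2)[OF assms(2)] csumI[of _ Z czero W] by force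
  show "W \<subseteq> csum Z W"
    using csubspaceD(1)[OF assms(2)] csubspaceD(2)[OF assms(1)] csumI[of czero Z _ W] by force
qed

lemma quot_csum_cong:
  assumes Z: "csubspace Z" and B: "csubspace B" and "Z \<subseteq> Z'" "Z' \<subseteq> csum Z B"
  shows "quot Z' B = quot Z B"
proof -
  have "coset B z' \<in> coset B ` Z" if z': "z' \<in> Z'" for z'
  proof -
    obtain z b where "z \<in> Z" "b \<in> B" "z' = cadd z b" using z' assms(4) unfolding csum_def by blast
    then have "coset B z' = coset B z"
      using csubspaceD(1)[OF Z] csubspaceD(1)[OF B] coset_eq_iff[OF B, of z' z] by simp
    then show ?thesis using \<open>z \<in> Z\<close> by blast
  qed
  then have "coset B ` Z' = coset B ` Z" using assms(3) by blast
  then show ?thesis by (simp add: quot_def)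
qed

lemma qdim_csum_cong:
  assumes "csubspace Z" "csubspace B" "Z \<subseteq> Z'" "Z' \<subseteq> csum Z B"
  shows "qdim Z' B = qdim Z B" "qfin Z' B = qfin Z B"
  using quot_csum_cong[OF assms] by (simp_all add: qdim_def qfin_def)

lemma qdim_trivial:
  assumes Z: "csubspace Z" and B: "csubspace B" and "Z \<subseteq> B"
  shows "qfin Z B" "qdim Z B = 0"
proof -
  interpret vectorspace F "quot Z B" by (rule vectorspace_quot[OF Z B])
  have "coset B z = \<zero>\<^bsub>quot Z B\<^esub>" if "z \<in> Z" for z
    using that assms(3) csubspaceD[OF B] coset_eq_iff[OF B, of z czero] by (auto simp: quot_simps[OF B])
  then have c: "carrier (quot Z B) = {\<zero>\<^bsub>quot Z B\<^esub>}"
    using csubspaceD(2)[OF Z] by (auto simp: quot_simps(1)[OF B])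
  then have "gen_set {\<zero>\<^bsub>quot Z B\<^esub>}"
    using in_own_span[of "{\<zero>\<^bsub>quot Z B\<^esub>}"] span_is_subset2[of "{\<zero>\<^bsub>quot Z B\<^esub>}"] by auto
  then show "qfin Z B" "qdim Z B = 0"
    using dim0I c unfolding qfin_def qdim_def fin_dim_def by blast+
qed

text \<open>The image of \<open>Z\<close> in the quotient of \<open>Z'\<close> by \<open>B\<close>
  is the kernel of the projection to the quotient by \<open>csum Z B\<close>, so exactness gives the
  inequality.\<close>

lemma qdim_mono:
  assumes Z: "csubspace Z" and Z': "csubspace Z'" and B: "csubspace B" and sub: "Z \<subseteq> Z'" and fin: "qfin Z' B"
  shows "qfin Z B" "qdim Z B \<le> qdim Z' B"
proof -
  note c = csubspace_csum[OF Z B]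
  have i: "csubspace (Z' \<inter> csum Z B)" by (rule csubspace_Int[OF Z' c])
  have "quot (Z' \<inter> csum Z B) B = quot Z B"
    using csum_upper[OF Z B] sub by (intro quot_csum_cong[OF Z B]) auto
  then show "qfin Z B" "qdim Z B \<le> qdim Z' B"
    using quot_exact[OF Z' B c csum_upper(2)[OF Z B]] fin by (auto simp: qfin_def qdim_def)
qed

text \<open>The image of \<open>Z\<close> only sees the part of the denominator that meets
  \<open>Z\<close>; the identity relation on \<open>Z\<close> realises the isomorphism.\<close>

lemma qdim_Int_zero_cong:
  assumes Z: "csubspace Z" and B: "csubspace B" and B': "csubspace B'" and eq: "Z \<inter> B = Z \<inter> B'"
  shows "qfin Z B \<longleftrightarrow> qfin Z B'" "qfin Z B \<Longrightarrow> qdim Z B = qdim Z B'"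
proof -
  note z = csubspaceD[OF Z]
  have "quot_rel (\<lambda>x y. x = y \<and> x \<in> Z) Z B Z B'"
    unfolding quot_rel_def
  proof (intro conjI allI impI ballI)
    show "\<exists>x y. (x = y \<and> x \<in> Z) \<and> csub w x \<in> B" if "w \<in> Z" for w
      using that z(1) csubspaceD(2)[OF B] by auto
    show "\<exists>x y. (x = y \<and> x \<in> Z) \<and> csub w y \<in> B'" if "w \<in> Z" for w
      using that z(1) csubspaceD(2)[OF B'] by auto
  qed (use Z B B' z eq in auto)
  then show "qfin Z B \<longleftrightarrow> qfin Z B'" "qfin Z B \<Longrightarrow> qdim Z B = qdim Z B'"
    using quot_relation_dim by blast+
qed

text \<open>The image on homology consists of the cosets of cycles of \<open>S\<close> modulo
  boundaries of \<open>T\<close>. This is the case for which \<open>quot\<close> admits denominators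
  outside the numerator.\<close>

lemma inclusion_rank_eq:
  assumes "S \<subseteq> T"
  shows "inclusion_rank F p (top_of_set S) (top_of_set T) = qdim (cyc p S) (bnd p T)"
proof -
  have "inclusion_map F p (top_of_set T) ` carrier (homology_space F p (top_of_set S)) = coset (bnd p T) ` cyc p S"
    using coset_map_coset[OF csubspace_boundaries csubspace_boundaries bnd_mono[OF assms] cycD(1)]
    by (simp add: inclusion_map_eq homology_space_eq quot_simps[OF csubspace_boundaries] image_image)
  then show ?thesis
    by (simp add: inclusion_rank_def qdim_def homology_space_eq quot_def)
qed

text \<open>The inclusion induces an isomorphism in degree \<open>p\<close>: the middle conjunct is
  surjectivity, the last one injectivity, both stated on cycles to keep quotients out of the
  arguments.\<close>

definition heq :: "nat \<Rightarrow> 'a::topological_space set \<Rightarrow> 'a set \<Rightarrow> bool" where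
  "heq p S T \<longleftrightarrow> S \<subseteq> T \<and> cyc p T \<subseteq> csum (cyc p S) (bnd p T) \<and> cyc p S \<inter> bnd p T \<subseteq> bnd p S"

lemma heq_refl: "heq p S S"
  using csum_upper(1)[OF csubspace_cycles csubspace_boundaries] unfolding heq_def by blast

lemma heq_trans:
  assumes "heq p S T" "heq p T W"
  shows "heq p S W"
proof -
  have st: "S \<subseteq> T" "T \<subseteq> W" using assms by (auto simp: heq_def)
  have "z \<in> csum (cyc p S) (bnd p W)" if z: "z \<in> cyc p W" for z
  proof -
    obtain t b where t: "t \<in> cyc p T" "b \<in> bnd p W" "z = cadd t b"
      using z assms(2) unfolding heq_def csum_def by blast
    obtain s b' where s: "s \<in> cyc p S" "b' \<in> bnd p T" "t = cadd s b'"
      using t(1) assms(1) unfolding heq_def csum_def by blast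
    have b': "b' \<in> bnd p W" using s(2) bnd_mono[OF st(2)] by blast
    have "z = cadd s (cadd b' b)"
      using cycD(1)[OF s(1)] bndD(1)[OF s(2)] bndD(1)[OF t(2)] t(3) s(3) by (simp add: cadd_ac(2))
    then show ?thesis using csumI[OF s(1) bndD(3)[OF b' t(2)]] by simp
  qed
  moreover have "cyc p S \<inter> bnd p W \<subseteq> bnd p S"
    using assms cyc_mono[OF st(1), of p] unfolding heq_def by blast
  ultimately show ?thesis using st by (auto simp: heq_def)
qed

text \<open>Two-out-of-three for isomorphisms. It allows two sublevel sets to be compared through a
  common subcomplex of lower cells.\<close>

lemma heq_cancel_left:
  assumes st: "heq p S T" and sw: "heq p S W" and sub: "T \<subseteq> W"
  shows "heq p T W"
proof -
  have "cyc p W \<subseteq> csum (cyc p T) (bnd p W)"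
    using sw st cyc_mono[of S T p] unfolding heq_def csum_def by blast
  moreover have "z \<in> bnd p T" if z: "z \<in> cyc p T" "z \<in> bnd p W" for z
  proof -
    obtain s b where s: "s \<in> cyc p S" "b \<in> bnd p T" "z = cadd s b"
      using z(1) st unfolding heq_def csum_def by blast
    have bW: "b \<in> bnd p W" using s(2) bnd_mono[OF sub] by auto
    have "csub z b \<in> bnd p W" by (rule bndD(5)[OF z(2) bW])
    then have "s \<in> bnd p W" using s(3) cycD(1)[OF s(1)] bndD(1)[OF s(2)] by simp
    then have "s \<in> bnd p T" using sw s(1) bnd_mono[of S T p] st by (auto simp: heq_def)
    then show ?thesis using s(3) bndD(3)[OF _ s(2)] by simp
  qed
  ultimately show ?thesis using sub by (auto simp: heq_def)
qed

lemma inclusion_iso_iff_heq: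
  assumes ST: "S \<subseteq> T"
  shows "inclusion_iso F p (top_of_set S) (top_of_set T) \<longleftrightarrow> heq p S T"
proof -
  let ?BS = "bnd p S" and ?BT = "bnd p T"
  note cm = coset_map_coset[OF csubspace_boundaries csubspace_boundaries bnd_mono[OF ST]]
  note ceq = coset_eq_iff[OF csubspace_boundaries]
  have cm': "coset_map ?BT (coset ?BS z) = coset ?BT z" if "z \<in> cyc p S" for z
    using cm[of z p] cycD(1)[OF that] by simp
  have im: "coset_map ?BT ` coset ?BS ` cyc p S = coset ?BT ` cyc p S"
    by (simp add: image_image cm')
  have "inclusion_iso F p (top_of_set S) (top_of_set T) \<longleftrightarrow>
     inj_on (coset_map ?BT) (coset ?BS ` cyc p S) \<and> coset ?BT ` cyc p S = coset ?BT ` cyc p T"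
    unfolding inclusion_iso_def bij_betw_def inclusion_map_eq homology_space_eq
      quot_simps(1)[OF csubspace_boundaries] im ..
  also have "inj_on (coset_map ?BT) (coset ?BS ` cyc p S) \<longleftrightarrow> cyc p S \<inter> ?BT \<subseteq> ?BS"
  proof
    assume inj: "inj_on (coset_map ?BT) (coset ?BS ` cyc p S)"
    show "cyc p S \<inter> ?BT \<subseteq> ?BS"
    proof
      fix z assume z: "z \<in> cyc p S \<inter> ?BT"
      have 0: "czero \<in> cyc p S" by (rule cycD(2))
      have zS: "z \<in> cyc p S" using z by blast
      note zf = cycD(1)[OF zS]
      have "coset ?BT z = coset ?BT czero" using z ceq[of z czero p "top_of_set T"] zf by simp
      then have "coset_map ?BT (coset ?BS z) = coset_map ?BT (coset ?BS czero)"
        using cm'[OF zS] cm'[OF 0] by simp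
      then have "coset ?BS z = coset ?BS czero"
        by (rule inj_onD[OF inj]) (use zS 0 in auto)
      then show "z \<in> ?BS" using ceq[of z czero p "top_of_set S"] zf by simp
    qed
  next
    assume s: "cyc p S \<inter> ?BT \<subseteq> ?BS"
    show "inj_on (coset_map ?BT) (coset ?BS ` cyc p S)"
    proof (rule inj_onI)
      fix U V assume "U \<in> coset ?BS ` cyc p S" "V \<in> coset ?BS ` cyc p S" and eq: "coset_map ?BT U = coset_map ?BT V"
      then obtain u v where uv: "u \<in> cyc p S" "v \<in> cyc p S" "U = coset ?BS u" "V = coset ?BS v" by blast
      note uvf = cycD(1)[OF uv(1)] cycD(1)[OF uv(2)]
      have "coset ?BT u = coset ?BT v" using eq cm'[OF uv(1)] cm'[OF uv(2)] uv(3,4) by simp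
      then have "csub u v \<in> ?BT" using ceq[OF uvf] by simp
      then have "csub u v \<in> ?BS" using s cycD(5)[OF uv(1,2)] by blast
      then show "U = V" using ceq[OF uvf] uv(3,4) by simp
    qed
  qed
  also have "coset ?BT ` cyc p S = coset ?BT ` cyc p T \<longleftrightarrow> cyc p T \<subseteq> csum (cyc p S) ?BT"
  proof
    assume eq: "coset ?BT ` cyc p S = coset ?BT ` cyc p T"
    show "cyc p T \<subseteq> csum (cyc p S) ?BT"
    proof
      fix z assume z: "z \<in> cyc p T"
      then have "coset ?BT z \<in> coset ?BT ` cyc p S" using eq by simp
      then obtain s where s: "s \<in> cyc p S" "coset ?BT z = coset ?BT s" by blast
      then have "csub z s \<in> ?BT" using ceq[OF cycD(1)[OF z] cycD(1)[OF s(1)]] by simp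
      then show "z \<in> csum (cyc p S) ?BT"
        using csum_iff_csub[OF csubspace_cycles csubspace_boundaries cycD(1)[OF z]] s(1) by blast
    qed
  next
    assume "cyc p T \<subseteq> csum (cyc p S) ?BT"
    from quot_csum_cong[OF csubspace_cycles csubspace_boundaries cyc_mono[OF ST] this]
    show "coset ?BT ` cyc p S = coset ?BT ` cyc p T" by (simp add: quot_def)
  qed
  finally show ?thesis using ST unfolding heq_def by blast
qed

text \<open>The rank of an inclusion is unchanged when the smaller space is replaced by a
  homologically equal one; \<open>heq_qdim_right\<close> does the same for the larger space.
  Together they make persistence ranks locally constant away from vertex heights.\<close>

lemma heq_qdim_left:
  assumes "heq p S T" "T \<subseteq> W"
  shows "qdim (cyc p T) (bnd p W) = qdim (cyc p S) (bnd p W)" "qfin (cyc p T) (bnd p W) = qfin (cyc p S) (bnd p W)"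
proof -
  have "cyc p T \<subseteq> csum (cyc p S) (bnd p W)"
    using assms bnd_mono[OF assms(2), of p] unfolding heq_def csum_def by blast
  moreover have "cyc p S \<subseteq> cyc p T" using assms cyc_mono[of S T p] unfolding heq_def by blast
  ultimately show "qdim (cyc p T) (bnd p W) = qdim (cyc p S) (bnd p W)"
    "qfin (cyc p T) (bnd p W) = qfin (cyc p S) (bnd p W)"
    by (simp_all add: qdim_csum_cong[OF csubspace_cycles csubspace_boundaries])
qed

lemma heq_qdim_right:
  assumes "heq p S T" "R \<subseteq> S"
  shows "qfin (cyc p R) (bnd p S) = qfin (cyc p R) (bnd p T)"
    "qfin (cyc p R) (bnd p S) \<Longrightarrow> qdim (cyc p R) (bnd p S) = qdim (cyc p R) (bnd p T)"
proof -
  have eq: "cyc p R \<inter> bnd p S = cyc p R \<inter> bnd p T"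
    using assms cyc_mono[OF assms(2), of p] bnd_mono[of S T p] unfolding heq_def by blast
  note q = qdim_Int_zero_cong[OF csubspace_cycles csubspace_boundaries csubspace_boundaries eq]
  show "qfin (cyc p R) (bnd p S) = qfin (cyc p R) (bnd p T)" by (rule q(1))
  show "qfin (cyc p R) (bnd p S) \<Longrightarrow> qdim (cyc p R) (bnd p S) = qdim (cyc p R) (bnd p T)" by (rule q(2))
qed

lemma heq_qdim:
  assumes "heq p S T"
  shows "qfin (cyc p S) (bnd p S) = qfin (cyc p T) (bnd p T)"
    "qfin (cyc p S) (bnd p S) \<Longrightarrow> qdim (cyc p S) (bnd p S) = qdim (cyc p T) (bnd p T)"
proof -
  note r = heq_qdim_right[OF assms order.refl] and l = heq_qdim_left[OF assms order.refl]
  show "qfin (cyc p S) (bnd p S) = qfin (cyc p T) (bnd p T)" using r(1) l(2) by simp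
  show "qfin (cyc p S) (bnd p S) \<Longrightarrow> qdim (cyc p S) (bnd p S) = qdim (cyc p T) (bnd p T)"
    using r(2) l(1) by simp
qed

lemma homotopic_id_push:
  assumes "homotopic_with_canon (\<lambda>x. True) T T id r" and z: "z \<in> cyc p T"
  shows "csub z (push p r z) \<in> bnd p T"
proof -
  have "csub (push p r z) (push p id z) \<in> bnd p T" by (rule homotopic_push_cyc[OF assms])
  moreover have "push p id z = z" using push_id[OF cyc_fchains[OF z], of id] by simp
  ultimately show ?thesis
    using csub_sym[OF csubspace_boundaries, of "push p r z" z] cycD(1)[OF z] by simp
qed

text \<open>Pushing a cycle along \<open>r\<close> changes it by a boundary in \<open>T\<close>,
  which gives surjectivity; pushing a filling along \<open>r\<close> brings it into
  \<open>S\<close>, which gives injectivity.\<close>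

lemma heq_retract:
  assumes ST: "S \<subseteq> T" and r: "continuous_on T r" "r ` T \<subseteq> S" "\<And>x. x \<in> S \<Longrightarrow> r x = x"
    and hom: "homotopic_with_canon (\<lambda>x. True) T T id r"
  shows "heq p S T"
proof -
  have cm: "continuous_map (top_of_set T) (top_of_set S) r"
    using r by (auto simp: continuous_map_in_subtopology)
  have "z \<in> csum (cyc p S) (bnd p T)" if z: "z \<in> cyc p T" for z
    using csum_iff_csub[OF csubspace_cycles csubspace_boundaries cycD(1)[OF z]]
      push_cyc[OF z cm] homotopic_id_push[OF hom z] by blast
  moreover have "z \<in> bnd p S" if z: "z \<in> cyc p S" "z \<in> bnd p T" for z
    using push_bnd[OF z(2) cm] push_id[OF cyc_fchains[OF z(1)], of r] r(3) by simp
  ultimately show ?thesis using ST by (auto simp: heq_def)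
qed

end

section \<open>Convex sets\<close>

context coeff_field
begin

lemma homotopic_const_convex:
  fixes V :: "'a::euclidean_space set"
  assumes "convex V" "a \<in> V"
  shows "homotopic_with_canon (\<lambda>x. True) V V id (\<lambda>x. a)"
  by (rule homotopic_with_linear)
    (use assms in \<open>auto simp: convex_contains_segment closed_segment_commute continuous_on_id'\<close>)

lemma fchains_singleton:
  assumes "c \<in> fchains p X" "topspace X = {a}"
  obtains b where "b \<in> carrier F" "c = chain_emb b (frag_of (restrict (\<lambda>x. a) (standard_simplex p)))"
proof
  let ?r = "restrict (\<lambda>x. a) (standard_simplex p)"
  note c = fchainsD[OF assms(1)]
  show "c ?r \<in> carrier F" using c(2) by simp
  have "c s = \<zero>\<^bsub>F\<^esub>" if "s \<noteq> ?r" for s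
    using that c(3) singular_simplex_singleton[OF assms(2), of p s] by (auto simp: csupp_def)
  then have "c s = chain_emb (c ?r) (frag_of ?r) s" for s
    using c(2) by (cases "s = ?r") (simp_all only: chain_emb_of cfun_app if_True if_False refl)
  then show "c = chain_emb (c ?r) (frag_of ?r)" by blast
qed

text \<open>Each degree has one simplex, the constant one, and the boundary maps alternate between
  zero and the identity. A cycle of odd degree is the boundary of a multiple of the next constant
  simplex; one of positive even degree is zero.\<close>

lemma cyc_singleton:
  assumes X: "topspace X = {a}" and z: "z \<in> cycles F (Suc p) X"
  shows "z \<in> boundaries F (Suc p) X"
proof -
  let ?r = "\<lambda>p. restrict (\<lambda>x. a) (standard_simplex p)"
  have sr: "singular_chain p X (frag_of (?r p))" for p
    using singular_simplex_singleton[OF X] by (simp add: singular_chain_of)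
  have br: "chain_boundary p (frag_of (?r p)) = (if p = 0 \<or> odd p then 0 else frag_of (?r (p - 1)))" for p
    using chain_boundary_of_singleton[OF X sr[of p]] by auto
  obtain b where b: "b \<in> carrier F" "z = chain_emb b (frag_of (?r (Suc p)))"
    by (rule fchains_singleton[OF cyc_fchains[OF z] X])
  show ?thesis
  proof (cases "odd (Suc p)")
    case True
    then have "z = bd (Suc (Suc p)) (chain_emb b (frag_of (?r (Suc (Suc p)))))"
      using b br[of "Suc (Suc p)"] by (simp add: chain_ext_single)
    then show ?thesis using bndI[OF chain_emb_fchains[OF b(1) sr]] by metis
  next
    case False
    then have "chain_emb b (frag_of (?r p)) = czero"
      using b br[of "Suc p"] cyc_bd[OF z] by (simp add: chain_ext_single)
    from fun_cong[OF this, of "?r p"] have "b = \<zero>\<^bsub>F\<^esub>"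
      using b(1) by (simp add: chain_emb_of czero_def)
    then have "z = czero" using b by (auto simp: czero_def chain_emb_def int_pow_facts fun_eq_iff)
    then show ?thesis using bndD(2) by simp
  qed
qed

lemma cyc_Suc_convex:
  fixes V :: "'a::euclidean_space set"
  assumes V: "convex V" and z: "z \<in> cyc (Suc p) V"
  shows "z \<in> bnd (Suc p) V"
proof (cases "V = {}")
  case True
  then have "z = czero" using cyc_fchains[OF z] Ch_empty by blast
  then show ?thesis using bndD(2) by simp
next
  case False
  then obtain a where a: "a \<in> V" by blast
  let ?z = "push (Suc p) (\<lambda>x. a) z"
  have 1: "csub z ?z \<in> bnd (Suc p) V"
    by (rule homotopic_id_push[OF homotopic_const_convex[OF V a] z])
  have "?z \<in> cyc (Suc p) {a}" by (rule push_cyc[OF z]) simp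
  then have "?z \<in> bnd (Suc p) {a}" by (intro cyc_singleton) auto
  then have 2: "?z \<in> bnd (Suc p) V" using bnd_mono[of "{a}" V] a by blast
  have "z = cadd (csub z ?z) ?z" using cycD(1)[OF z] by simp
  then show ?thesis using bndD(3)[OF 1 2] by simp
qed

text \<open>The augmentation, that is, the sum of the coefficients. Values in functions on a
  one-point type make it an instance of \<open>chain_ext\<close> and put its target among the spaces
  covered by \<open>quot\<close>.\<close>

definition aug :: "('s \<Rightarrow> 'f) \<Rightarrow> unit \<Rightarrow> 'f" where
  "aug = chain_ext (frag_extend (\<lambda>r. frag_of ()))"

lemma aug_simps:
  "fchain c \<Longrightarrow> aug c \<in> cfun" "fchain c \<Longrightarrow> fchain d \<Longrightarrow> aug (cadd c d) = cadd (aug c) (aug d)"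
  "fchain c \<Longrightarrow> a \<in> carrier F \<Longrightarrow> aug (cscale a c) = cscale a (aug c)"
  "a \<in> carrier F \<Longrightarrow> aug (chain_emb a (frag_of r)) () = a"
  by (auto simp: aug_def chain_ext_cadd chain_ext_cscale chain_ext_single chain_emb_of)

lemma chain_emb_zero: "chain_emb \<zero>\<^bsub>F\<^esub> x = czero"
  by (simp add: chain_emb_def czero_def int_pow_facts)

lemma aug_czero: "aug czero u = \<zero>\<^bsub>F\<^esub>"
  by (simp add: aug_def) (simp add: czero_def)

lemma aug_bnd:
  assumes "b \<in> boundaries F 0 X"
  shows "aug b = czero"
proof -
  obtain c where c: "c \<in> fchains (Suc 0) X" "b = bd (Suc 0) c" using assms by (rule bndE)
  have "aug b = chain_ext (\<lambda>x. frag_extend (\<lambda>r. frag_of ()) (chain_boundary (Suc 0) x)) c"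
    unfolding aug_def c(2) by (rule chain_ext_comp[OF fchainsD(1)[OF c(1)]]) (simp add: frag_extend_diff)
  also have "\<dots> = chain_ext (\<lambda>x. 0) c"
    by (rule chain_ext_cong[OF fchainsD(3)[OF c(1)] _ fchainsD(2)[OF c(1)]])
      (simp add: chain_boundary_of frag_extend_add frag_extend_minus frag_extend_cmul frag_extend_diff)
  finally show ?thesis using fchainsD(1)[OF c(1)] by (simp add: chain_ext_zero_op)
qed

lemma push_const:
  assumes "fchain c"
  shows "push 0 (\<lambda>x. a) c = chain_emb (aug c ()) (frag_of (restrict (\<lambda>x. a) (standard_simplex 0)))"
  using assms subset_UNIV
proof (induction c rule: fchain_induct)
  case zero
  then show ?case by (simp only: aug_czero chain_emb_zero chain_ext_czero)
next
  case (single b r)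
  have "simplex_map 0 (\<lambda>x. a) r = restrict (\<lambda>x. a) (standard_simplex 0)"
    by (auto simp: simplex_map_def)
  then show ?case using single by (simp add: chain_ext_single aug_simps del: restrict_apply)
next
  case (add c d)
  have "aug (cadd c d) () = aug c () \<oplus>\<^bsub>F\<^esub> aug d ()"
    using add(1,2) by (simp add: aug_simps(2)) (simp add: cadd_def)
  moreover have "aug c () \<in> carrier F" "aug d () \<in> carrier F"
    using aug_simps(1)[OF add(1)] aug_simps(1)[OF add(2)] by simp_all
  ultimately show ?case
    using add by (simp only: chain_ext_cadd chain_emb_simps)
qed

lemma cyc_0: "cycles F 0 X = fchains 0 X"
  by (auto simp: cycles_eq bd_0 fchainsD(1))

text \<open>Contracting \<open>V\<close> to a point \<open>a\<close> turns a 0-cycle into its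
  augmentation times \<open>a\<close>, so the augmentation decides whether the cycle bounds.\<close>

lemma aug_convex:
  fixes V :: "'a::euclidean_space set"
  assumes V: "convex V" and z: "z \<in> cyc 0 V"
  shows "z \<in> bnd 0 V \<longleftrightarrow> aug z = czero"
proof
  assume az: "aug z = czero"
  show "z \<in> bnd 0 V"
  proof (cases "V = {}")
    case True
    then have "z = czero" using cyc_fchains[OF z] Ch_empty by blast
    then show ?thesis using bndD(2) by simp
  next
    case False
    then obtain a where a: "a \<in> V" by blast
    have "csub z (push 0 (\<lambda>x. a) z) \<in> bnd 0 V"
      by (rule homotopic_id_push[OF homotopic_const_convex[OF V a] z])
    moreover have "push 0 (\<lambda>x. a) z = czero"
      using push_const[OF fchainsD(1)[OF cyc_fchains[OF z]], of a]
      by (simp add: az chain_emb_zero[unfolded czero_def] del: restrict_apply) (simp add: czero_def chain_emb_zero[unfolded czero_def])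
    ultimately show ?thesis using cycD(1)[OF z] by simp
  qed
qed (rule aug_bnd)

lemma qdim_unit: "qfin (cfun :: (unit \<Rightarrow> 'f) set) {czero}" "qdim (cfun :: (unit \<Rightarrow> 'f) set) {czero} = 1"
proof -
  let ?C = "cfun :: (unit \<Rightarrow> 'f) set" and ?B = "{czero :: unit \<Rightarrow> 'f}"
  have C: "csubspace ?C" by (auto simp: csubspace_def)
  have B: "csubspace ?B" by (auto simp: csubspace_def cscale_simps)
  interpret vectorspace F "quot ?C ?B" by (rule vectorspace_quot[OF C B])
  define e :: "unit \<Rightarrow> 'f" where "e = (\<lambda>x. \<one>\<^bsub>F\<^esub>)"
  have e: "e \<in> cfun" by (auto simp: e_def cfun_def)
  define v where "v = coset ?B e"
  have v: "v \<in> carrier (quot ?C ?B)" using e by (auto simp: v_def quot_simps[OF B])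
  have "e \<noteq> czero" using one_not_zero by (auto simp: e_def czero_def fun_eq_iff)
  then have "csub e czero \<notin> ?B" using e by simp
  then have v0: "v \<noteq> \<zero>\<^bsub>quot ?C ?B\<^esub>"
    using coset_eq_iff[OF B e cfun_closed(1)] by (simp add: v_def quot_simps(2)[OF B])
  have "coset ?B c \<in> span {v}" if c: "c \<in> ?C" for c
  proof -
    have "c = cscale (c ()) e" using c by (auto simp: cscale_def e_def fun_eq_iff)
    then have "coset ?B c = c () \<odot>\<^bsub>quot ?C ?B\<^esub> v"
      using c e quot_simps(4)[OF B, of "c ()" e] by (simp add: v_def)
    also have "\<dots> = lincomb (\<lambda>_. c ()) {v}"
      using v c by (simp add: lincomb_def)
    finally show ?thesis
      unfolding span_def using c by (intro CollectI exI[of _ "\<lambda>_. c ()"] exI[of _ "{v}"]) auto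
  qed
  then have "carrier (quot ?C ?B) \<subseteq> span {v}" by (auto simp: quot_simps(1)[OF B])
  then have "gen_set {v}" using span_is_subset2[of "{v}"] v by auto
  then show "qfin ?C ?B" "qdim ?C ?B = 1"
    using dim1I[OF _ v0 v] v unfolding qfin_def qdim_def fin_dim_def by blast+
qed

text \<open>The augmentation identifies the image of the degree-0 homology of \<open>W\<close> in
  that of the convex set \<open>V\<close> with the field. \<open>W\<close> is arbitrary here: it
  will be the intersection of the pieces of a cover.\<close>

lemma qdim_point:
  fixes V :: "'a::euclidean_space set"
  assumes V: "convex V" and W: "W \<subseteq> V" "W \<noteq> {}"
  shows "qfin (cyc 0 W) (bnd 0 V)" "qdim (cyc 0 W) (bnd 0 V) = 1"
proof -
  obtain a where a: "a \<in> W" using W by blast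
  have WV: "cyc 0 W \<subseteq> cyc 0 V" by (rule cyc_mono[OF W(1)])
  let ?r = "restrict (\<lambda>x. a) (standard_simplex 0)"
  have r: "singular_chain 0 (top_of_set W) (frag_of ?r)"
    using a by (auto simp: singular_chain_of singular_simplex_def continuous_map_in_subtopology)
  have "quot_rel (\<lambda>x y. x \<in> cyc 0 W \<and> y = aug x) (cyc 0 W) (bnd 0 V) cfun {czero}"
    unfolding quot_rel_def
  proof (intro conjI allI impI ballI)
    show "csubspace (cyc 0 W)" "csubspace (bnd 0 V)" by (rule csubspace_cycles csubspace_boundaries)+
    show "csubspace (cfun :: (unit \<Rightarrow> 'f) set)" "csubspace {czero :: unit \<Rightarrow> 'f}"
      by (auto simp: csubspace_def cscale_simps)
    note fc = fchainsD(1)[OF cyc_fchains]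
    show "y \<in> cfun" if "x \<in> cyc 0 W \<and> y = aug x" for x y using that fc aug_simps(1) by blast
    show "cadd y y' = aug (cadd x x')" if "x \<in> cyc 0 W \<and> y = aug x" "x' \<in> cyc 0 W \<and> y' = aug x'" for x y x' y'
      using that fc[of x] fc[of x'] aug_simps(2)[of x x'] by auto
    show "cscale b y = aug (cscale b x)" if "b \<in> carrier F" "x \<in> cyc 0 W \<and> y = aug x" for b x y
      using that fc[of x] aug_simps(3)[of x b] by auto
    show "\<exists>x y. (x \<in> cyc 0 W \<and> y = aug x) \<and> csub z x \<in> bnd 0 V" if "z \<in> cyc 0 W" for z
      using that cycD(1)[OF that] bndD(2) by (intro exI[of _ z] exI[of _ "aug z"]) auto
    show "\<exists>x y. (x \<in> cyc 0 W \<and> y = aug x) \<and> csub z y \<in> {czero}" if z: "z \<in> cfun" for z :: "unit \<Rightarrow> 'f"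
    proof -
      have "chain_emb (z ()) (frag_of ?r) \<in> cyc 0 W"
        using chain_emb_fchains[OF _ r] z by (simp add: cyc_0)
      moreover have "aug (chain_emb (z ()) (frag_of ?r)) = z"
        using z by (auto simp: fun_eq_iff aug_simps(4))
      ultimately show ?thesis using z by (intro exI[of _ "chain_emb (z ()) (frag_of ?r)"]) auto
    qed
    show "(x \<in> bnd 0 V) = (y \<in> {czero})" if "x \<in> cyc 0 W \<and> y = aug x" for x y
      using that aug_convex[OF V, of x] WV by auto
  qed (auto intro: cycD(3,4))
  from quot_relation_dim[OF this] qdim_unit
  show "qfin (cyc 0 W) (bnd 0 V)" "qdim (cyc 0 W) (bnd 0 V) = 1" by auto
qed

lemma cyc_0_convex_point:
  fixes V :: "'a::euclidean_space set"
  assumes V: "convex V" and W: "W \<subseteq> V" "W \<noteq> {}" and z: "z \<in> cyc 0 V"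
  obtains w where "w \<in> cyc 0 W" "csub z w \<in> bnd 0 V"
proof -
  obtain a where a: "a \<in> W" using W by blast
  show thesis
  proof
    show "csub z (push 0 (\<lambda>x. a) z) \<in> bnd 0 V"
      by (rule homotopic_id_push[OF homotopic_const_convex[OF V] z]) (use a W in auto)
    show "push 0 (\<lambda>x. a) z \<in> cyc 0 W"
      by (rule push_cyc[OF z]) (use a in auto)
  qed
qed

end

section \<open>The Mayer--Vietoris sequence for a convex piece\<close>

text \<open>An excisive cover: the pieces may be closed, only open subsets of them have to cover. In
  the application \<open>U\<close> is the space minus a point of a cell and \<open>V\<close> is that
  closed cell.\<close>

definition mv_cover :: "'a::topological_space set \<Rightarrow> 'a set \<Rightarrow> 'a set \<Rightarrow> bool" where
  "mv_cover S U V \<longleftrightarrow> U \<subseteq> S \<and> V \<subseteq> S \<and>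
     (\<exists>U' V'. openin (top_of_set S) U' \<and> U' \<subseteq> U \<and> openin (top_of_set S) V' \<and> V' \<subseteq> V \<and> S \<subseteq> U' \<union> V')"

context coeff_field
begin

lemma csub_csub_cancel:
  assumes "a \<in> cfun" "b \<in> cfun"
  shows "csub a (csub a b) = b"
proof
  fix s
  have "a s \<ominus>\<^bsub>F\<^esub> (a s \<ominus>\<^bsub>F\<^esub> b s) = b s"
    using cfun_app[OF assms(1), of s] cfun_app[OF assms(2), of s] by algebra
  then show "csub a (csub a b) s = b s" by (simp add: csub_def)
qed

lemma cadd_exchange:
  assumes "u \<in> cfun" "v \<in> cfun" "a \<in> cfun"
  shows "cadd u v = cadd (csub u a) (cadd v a)"
proof
  fix s
  have "u s \<oplus>\<^bsub>F\<^esub> v s = (u s \<ominus>\<^bsub>F\<^esub> a s) \<oplus>\<^bsub>F\<^esub> (v s \<oplus>\<^bsub>F\<^esub> a s)"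
    using cfun_app[OF assms(1), of s] cfun_app[OF assms(2), of s] cfun_app[OF assms(3), of s] by algebra
  then show "cadd u v s = cadd (csub u a) (cadd v a) s" by (simp add: csub_def cadd_def)
qed

lemma cadd_eq_czero:
  assumes "a \<in> cfun" "b \<in> cfun" "cadd a b = czero"
  shows "a = csub czero b"
  using csub_cadd_cancel(2)[OF assms(1,2)] assms(3) by simp

text \<open>Subdivision splits the bounding chain \<open>c\<close> into a part in \<open>U\<close>
  and a part in \<open>V\<close>. Moving all terms in \<open>U\<close> to one side leaves a chain
  that lies in \<open>U\<close> and in \<open>V\<close>, hence in the intersection; the exactness
  statements below all obtain their chains there in this way.\<close>

lemma mv_exchange:
  assumes mv: "mv_cover S U V" and u: "u \<in> Ch p U" and v: "v \<in> Ch p V" and u0: "u0 \<in> Ch p U"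
    and c: "c \<in> Ch (Suc p) S" and eq: "cadd u v = cadd u0 (bd (Suc p) c)"
  obtains n cU cV where "cU \<in> Ch (Suc p) U" "cV \<in> Ch (Suc p) V"
    "csub (csub (sd n p u) (sd n p u0)) (bd (Suc p) cU) = csub (bd (Suc p) cV) (sd n p v)"
    "csub (bd (Suc p) cV) (sd n p v) \<in> Ch p (U \<inter> V)"
proof -
  obtain U' V' where UV: "openin (top_of_set S) U'" "U' \<subseteq> U" "openin (top_of_set S) V'" "V' \<subseteq> V" "S \<subseteq> U' \<union> V'"
    using mv unfolding mv_cover_def by blast
  obtain n cU cV where n: "cU \<in> Ch (Suc p) U" "cV \<in> Ch (Suc p) V" "sd n (Suc p) c = cadd cU cV"
    by (rule sd_small[OF UV c])
  note fc = fchainsD(1)[OF u] fchainsD(1)[OF v] fchainsD(1)[OF u0] fchainsD(1)[OF c] fchainsD(1)[OF n(1)] fchainsD(1)[OF n(2)]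
  have "cadd (sd n p u) (sd n p v) = cadd (sd n p u0) (sd n p (bd (Suc p) c))"
    using arg_cong[OF eq, of "sd n p"] fc by (simp add: chain_ext_cadd)
  also have "sd n p (bd (Suc p) c) = cadd (bd (Suc p) cU) (bd (Suc p) cV)"
    using bd_sd[OF c, of n] n(3) fc by (simp add: chain_ext_cadd)
  finally have eq': "cadd (sd n p u) (sd n p v) = cadd (sd n p u0) (cadd (bd (Suc p) cU) (bd (Suc p) cV))" .
  have ac: "a \<ominus>\<^bsub>F\<^esub> a' \<ominus>\<^bsub>F\<^esub> x = y \<ominus>\<^bsub>F\<^esub> b"
    if "a \<oplus>\<^bsub>F\<^esub> b = a' \<oplus>\<^bsub>F\<^esub> (x \<oplus>\<^bsub>F\<^esub> y)" "a \<in> carrier F" "b \<in> carrier F" "a' \<in> carrier F" "x \<in> carrier F" "y \<in> carrier F"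
    for a b a' x y
  proof -
    have "a = (a' \<oplus>\<^bsub>F\<^esub> (x \<oplus>\<^bsub>F\<^esub> y)) \<ominus>\<^bsub>F\<^esub> b"
      using that by (metis a_minus_def add.inv_solve_right' add.m_closed)
    then show ?thesis using that(2-) by algebra
  qed
  have w: "csub (csub (sd n p u) (sd n p u0)) (bd (Suc p) cU) = csub (bd (Suc p) cV) (sd n p v)"
  proof
    fix s
    show "csub (csub (sd n p u) (sd n p u0)) (bd (Suc p) cU) s = csub (bd (Suc p) cV) (sd n p v) s"
      unfolding csub_def
      by (rule ac) (use fun_cong[OF eq', of s] fc in \<open>auto simp: cadd_def\<close>)
  qed
  have "csub (bd (Suc p) cV) (sd n p v) \<in> Ch p V"
    by (intro ChD(5) fchains_bd_Suc sd_fchains n v)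
  moreover have "csub (bd (Suc p) cV) (sd n p v) \<in> Ch p U"
    unfolding w[symmetric] by (intro ChD(5) fchains_bd_Suc sd_fchains n u u0)
  ultimately have "csub (bd (Suc p) cV) (sd n p v) \<in> Ch p (U \<inter> V)" by (simp add: Ch_Int)
  then show ?thesis using that n(1,2) w by blast
qed

lemma cancel_sd:
  assumes y: "y \<in> cycles F p X" and "sd n p y \<in> boundaries F p X"
  shows "y \<in> boundaries F p X"
proof -
  have "y = csub (sd n p y) (csub (sd n p y) y)"
    using csub_csub_cancel[OF chain_ext_cfun[OF cycD(1)[OF y]] cycD(1)[OF y]] by simp
  then show ?thesis using bndD(5)[OF assms(2) sd_cyc[OF y, of n]] by simp
qed

text \<open>Exactness at \<open>U\<close>. The witness \<open>a\<close> is the boundary of the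
  \<open>V\<close>-part of a subdivided filling of \<open>z\<close>.\<close>

lemma mv_kernel:
  assumes mv: "mv_cover S U V" and z: "z \<in> cyc p U" "z \<in> bnd p S"
  obtains a where "a \<in> cyc p (U \<inter> V)" "a \<in> bnd p V" "csub z a \<in> bnd p U"
proof -
  obtain c where c: "c \<in> Ch (Suc p) S" "z = bd (Suc p) c" using z(2) by (rule bndE)
  have 0: "czero \<in> Ch p U" "czero \<in> Ch p V" by (rule ChD(2))+
  have eq: "cadd z czero = cadd czero (bd (Suc p) c)" using c cycD(1)[OF z(1)] by simp
  obtain n cU cV where n: "cU \<in> Ch (Suc p) U" "cV \<in> Ch (Suc p) V"
    "csub (csub (sd n p z) (sd n p czero)) (bd (Suc p) cU) = csub (bd (Suc p) cV) (sd n p czero)"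
    "csub (bd (Suc p) cV) (sd n p czero) \<in> Ch p (U \<inter> V)"
    by (rule mv_exchange[OF mv cyc_fchains[OF z(1)] 0(2,1) c(1) eq])
  let ?a = "bd (Suc p) cV" and ?z = "sd n p z"
  note zf = cycD(1)[OF z(1)]
  note f = zf chain_ext_cfun[OF zf, of "singular_subdivision p ^^ n"] fchainsD(2)[OF fchains_bd_Suc[OF n(1)]] fchainsD(2)[OF fchains_bd_Suc[OF n(2)]]
  have e: "csub ?z (bd (Suc p) cU) = ?a" using n(3) f by simp
  show thesis
  proof
    show "?a \<in> bnd p V" by (rule bndI[OF n(2)])
    show "?a \<in> cyc p (U \<inter> V)" using n(4) f by (intro cycI bd_bd[OF n(2)]) simp
    have "csub z ?a = cadd (csub z ?z) (bd (Suc p) cU)"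
      unfolding e[symmetric] using f by (auto simp: csub_def cadd_def fun_eq_iff a_minus_def minus_add a_ac)
    then show "csub z ?a \<in> bnd p U"
      using bndD(3)[OF csub_sym[OF csubspace_boundaries f(2) f(1) sd_cyc[OF z(1)]] bndI[OF n(1)]] by simp
  qed
qed

lemma mv_split:
  assumes mv: "mv_cover S U V" and z: "z \<in> cyc p S"
  obtains u v where "u \<in> Ch p U" "v \<in> Ch p V" "cadd u v \<in> cyc p S" "csub z (cadd u v) \<in> bnd p S"
proof -
  obtain U' V' where UV: "openin (top_of_set S) U'" "U' \<subseteq> U" "openin (top_of_set S) V'" "V' \<subseteq> V" "S \<subseteq> U' \<union> V'"
    using mv unfolding mv_cover_def by blast
  obtain n u v where n: "u \<in> Ch p U" "v \<in> Ch p V" "sd n p z = cadd u v"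
    by (rule sd_small[OF UV cyc_fchains[OF z]])
  have "csub z (sd n p z) \<in> bnd p S"
    by (rule csub_sym[OF csubspace_boundaries _ _ sd_cyc[OF z]]) (use cycD(1)[OF z] in auto)
  then show ?thesis using that n sd_cyc_cyc[OF z, of n] by simp
qed

text \<open>The connecting homomorphism sends the class of \<open>u + v\<close> to that of the
  boundary of \<open>u\<close>. Since \<open>V\<close> has no homology in degree
  \<open>Suc q\<close>, it identifies the cokernel of \<open>U\<close> into \<open>S\<close> with
  the classes of the intersection that die in both pieces.\<close>

lemma mv_connecting:
  assumes mv: "mv_cover S U V" and V: "\<And>z. z \<in> cyc (Suc q) V \<Longrightarrow> z \<in> bnd (Suc q) V"
  shows "quot_rel (\<lambda>x y. x \<in> cyc (Suc q) S \<and> y \<in> Ch q (U \<inter> V) \<and>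
       (\<exists>u v. u \<in> Ch (Suc q) U \<and> v \<in> Ch (Suc q) V \<and> x = cadd u v \<and> y = bd (Suc q) u))
     (cyc (Suc q) S) (csum (cyc (Suc q) U) (bnd (Suc q) S))
     (cyc q (U \<inter> V) \<inter> bnd q V \<inter> bnd q U) (bnd q (U \<inter> V))"
    (is "quot_rel ?R _ ?B ?Z' _")
proof -
  have US: "U \<subseteq> S" "V \<subseteq> S" using mv by (auto simp: mv_cover_def)
  have B: "csubspace ?B" by (intro csubspace_csum csubspace_cycles csubspace_boundaries)
  have neg: "bd (Suc q) u = csub czero (bd (Suc q) v)"
    if "bd (Suc q) (cadd u v) = czero" "u \<in> Ch (Suc q) U" "v \<in> Ch (Suc q) V" for u v
  proof -
    note uf = fchainsD(1)[OF that(2)] and vf = fchainsD(1)[OF that(3)]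
    have "cadd (bd (Suc q) u) (bd (Suc q) v) = czero" using that(1) uf vf by (simp add: chain_ext_cadd)
    then show ?thesis using cadd_eq_czero[of "bd (Suc q) u" "bd (Suc q) v"] uf vf by simp
  qed
  show ?thesis
    unfolding quot_rel_def
  proof (intro conjI)
    show "csubspace (cyc (Suc q) S)" "csubspace ?B" "csubspace ?Z'" "csubspace (bnd q (U \<inter> V))"
      by (intro csubspace_Int csubspace_csum csubspace_cycles csubspace_boundaries)+
    show "\<forall>x y. ?R x y \<longrightarrow> x \<in> cyc (Suc q) S \<and> y \<in> ?Z'"
    proof (intro allI impI)
      fix x y assume R: "?R x y"
      then obtain u v where uv: "u \<in> Ch (Suc q) U" "v \<in> Ch (Suc q) V" "x = cadd u v" "y = bd (Suc q) u" by blast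
      have x: "x \<in> cyc (Suc q) S" and y: "y \<in> Ch q (U \<inter> V)" using R by blast+
      have "y = csub czero (bd (Suc q) v)"
        using neg[OF _ uv(1,2)] cyc_bd[OF x] uv(3,4) by simp
      then have "y \<in> bnd q V" using bndD(5)[OF bndD(2) bndI[OF uv(2)]] by simp
      moreover have "y \<in> cyc q (U \<inter> V)" using y bd_bd[OF uv(1)] uv(4) by (intro cycI) auto
      ultimately show "x \<in> cyc (Suc q) S \<and> y \<in> ?Z'" using x uv(4) bndI[OF uv(1)] by blast
    qed
    show "\<forall>x y x' y'. ?R x y \<longrightarrow> ?R x' y' \<longrightarrow> ?R (cadd x x') (cadd y y')"
    proof (intro allI impI)
      fix x y x' y' assume R: "?R x y" and R': "?R x' y'"
      obtain u v where uv: "u \<in> Ch (Suc q) U" "v \<in> Ch (Suc q) V" "x = cadd u v" "y = bd (Suc q) u" using R by blast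
      obtain u' v' where uv': "u' \<in> Ch (Suc q) U" "v' \<in> Ch (Suc q) V" "x' = cadd u' v'" "y' = bd (Suc q) u'" using R' by blast
      note f = fchainsD(2)[OF uv(1)] fchainsD(2)[OF uv(2)] fchainsD(2)[OF uv'(1)] fchainsD(2)[OF uv'(2)]
      have "cadd x x' = cadd (cadd u u') (cadd v v')" unfolding uv uv' using f by (simp add: cadd_ac)
      moreover have "cadd y y' = bd (Suc q) (cadd u u')"
        unfolding uv uv' using fchainsD(1)[OF uv(1)] fchainsD(1)[OF uv'(1)] by (simp add: chain_ext_cadd)
      moreover have "cadd x x' \<in> cyc (Suc q) S" "cadd y y' \<in> Ch q (U \<inter> V)"
        using R R' cycD(3)[of x "Suc q" "top_of_set S" x'] ChD(3)[of y q "top_of_set (U \<inter> V)" y'] by blast+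
      ultimately show "?R (cadd x x') (cadd y y')"
        using ChD(3)[OF uv(1) uv'(1)] ChD(3)[OF uv(2) uv'(2)] by blast
    qed
    show "\<forall>a x y. a \<in> carrier F \<longrightarrow> ?R x y \<longrightarrow> ?R (cscale a x) (cscale a y)"
    proof (intro allI impI)
      fix a x y assume a: "a \<in> carrier F" and R: "?R x y"
      obtain u v where uv: "u \<in> Ch (Suc q) U" "v \<in> Ch (Suc q) V" "x = cadd u v" "y = bd (Suc q) u" using R by blast
      have "cscale a x = cadd (cscale a u) (cscale a v)"
        unfolding uv using a fchainsD(2)[OF uv(1)] fchainsD(2)[OF uv(2)] by (simp add: cscale_simps)
      moreover have "cscale a y = bd (Suc q) (cscale a u)"
        unfolding uv using fchainsD(1)[OF uv(1)] a by (simp add: chain_ext_cscale)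
      moreover have "cscale a x \<in> cyc (Suc q) S" "cscale a y \<in> Ch q (U \<inter> V)"
        using R cycD(4)[OF a, of x "Suc q" "top_of_set S"] ChD(4)[OF a, of y q "top_of_set (U \<inter> V)"] by blast+
      ultimately show "?R (cscale a x) (cscale a y)"
        using ChD(4)[OF a uv(1)] ChD(4)[OF a uv(2)] by blast
    qed
    show "\<forall>z\<in>cyc (Suc q) S. \<exists>x y. ?R x y \<and> csub z x \<in> ?B"
    proof
      fix z assume z: "z \<in> cyc (Suc q) S"
      obtain u v where uv: "u \<in> Ch (Suc q) U" "v \<in> Ch (Suc q) V" "cadd u v \<in> cyc (Suc q) S" "csub z (cadd u v) \<in> bnd (Suc q) S"
        by (rule mv_split[OF mv z])
      have "bd (Suc q) u = csub czero (bd (Suc q) v)" using neg[OF _ uv(1,2)] cyc_bd[OF uv(3)] by simp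
      then have "bd (Suc q) u \<in> Ch q V" using ChD(5)[OF ChD(2) fchains_bd_Suc[OF uv(2)]] by simp
      then have "bd (Suc q) u \<in> Ch q (U \<inter> V)" using fchains_bd_Suc[OF uv(1)] by (simp add: Ch_Int)
      moreover have "csub z (cadd u v) \<in> ?B"
        using uv(4) csum_upper(2)[OF csubspace_cycles csubspace_boundaries] by blast
      ultimately show "\<exists>x y. ?R x y \<and> csub z x \<in> ?B" using uv by blast
    qed
    show "\<forall>z\<in>?Z'. \<exists>x y. ?R x y \<and> csub z y \<in> bnd q (U \<inter> V)"
    proof
      fix z assume z: "z \<in> ?Z'"
      obtain u where u: "u \<in> Ch (Suc q) U" "z = bd (Suc q) u" using z bndE[of z q "top_of_set U"] by blast
      obtain v where v: "v \<in> Ch (Suc q) V" "z = bd (Suc q) v" using z bndE[of z q "top_of_set V"] by blast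
      let ?v = "csub czero v"
      have vV: "?v \<in> Ch (Suc q) V" by (rule ChD(5)[OF ChD(2) v(1)])
      have zA: "z \<in> cyc q (U \<inter> V)" using z by blast
      note f = fchainsD(1)[OF u(1)] fchainsD(1)[OF v(1)]
      have "bd (Suc q) (cadd u ?v) = cadd z (csub czero z)"
        using f u(2) v(2) by (simp add: chain_ext_cadd chain_ext_csub)
      also have "\<dots> = czero" using cycD(1)[OF zA] by simp
      finally have "cadd u ?v \<in> cyc (Suc q) S"
        using u(1) vV Ch_mono[OF US(1), of "Suc q"] Ch_mono[OF US(2), of "Suc q"] by (intro cycI ChD(3)) auto
      then have "?R (cadd u ?v) z" using u vV cyc_fchains[OF zA] by blast
      moreover have "csub z z \<in> bnd q (U \<inter> V)" using cycD(1)[OF zA] bndD(2) by simp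
      ultimately show "\<exists>x y. ?R x y \<and> csub z y \<in> bnd q (U \<inter> V)" by blast
    qed
    show "\<forall>x y. ?R x y \<longrightarrow> (x \<in> ?B) = (y \<in> bnd q (U \<inter> V))"
    proof (intro allI impI)
      fix x y assume R: "?R x y"
      obtain u v where uv: "u \<in> Ch (Suc q) U" "v \<in> Ch (Suc q) V" "x = cadd u v" "y = bd (Suc q) u" using R by blast
      have x: "x \<in> cyc (Suc q) S" and y: "y \<in> Ch q (U \<inter> V)" using R by blast+
      have yc: "y \<in> cyc q (U \<inter> V)" using y bd_bd[OF uv(1)] uv(4) by (intro cycI) auto
      show "(x \<in> ?B) = (y \<in> bnd q (U \<inter> V))"
      proof
        \<comment> \<open>Correcting \<open>u\<close> and \<open>v\<close> by a filling
          \<open>a\<close> of \<open>y\<close> turns both into cycles, and the one in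
          \<open>V\<close> bounds.\<close>
        assume "y \<in> bnd q (U \<inter> V)"
        then obtain a where a: "a \<in> Ch (Suc q) (U \<inter> V)" "y = bd (Suc q) a" by (rule bndE)
        then have a': "a \<in> Ch (Suc q) U" "a \<in> Ch (Suc q) V" by (simp_all add: Ch_Int)
        note f = fchainsD(1)[OF uv(1)] fchainsD(1)[OF uv(2)] fchainsD(1)[OF a(1)]
        have "bd (Suc q) (csub u a) = czero"
          using f a(2) uv(4) fchainsD(2)[OF y] by (simp add: chain_ext_csub)
        then have 1: "csub u a \<in> cyc (Suc q) U" by (intro cycI ChD(5) uv a')
        have "bd (Suc q) (cadd v a) = cadd (bd (Suc q) v) (bd (Suc q) u)"
          using f a(2) uv(4) by (simp add: chain_ext_cadd)
        also have "\<dots> = bd (Suc q) x" using f uv(3) by (simp add: chain_ext_cadd cadd_ac(1))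
        finally have "bd (Suc q) (cadd v a) = czero" using cyc_bd[OF x] by simp
        then have "cadd v a \<in> cyc (Suc q) V" by (intro cycI ChD(3) uv a')
        then have "cadd v a \<in> bnd (Suc q) S" using V bnd_mono[OF US(2)] by blast
        moreover have "x = cadd (csub u a) (cadd v a)"
          unfolding uv(3)
          by (rule cadd_exchange[OF fchain_cfun[OF f(1)] fchain_cfun[OF f(2)] fchain_cfun[OF f(3)]])
        ultimately show "x \<in> ?B" using csumI[OF 1] by simp
      next
        \<comment> \<open>Conversely, the exchange yields a chain in the intersection whose boundary
          is a subdivision of \<open>y\<close>.\<close>
        assume "x \<in> ?B"
        then obtain u0 b where u0: "u0 \<in> cyc (Suc q) U" "b \<in> bnd (Suc q) S" "x = cadd u0 b" by (rule csumE)
        obtain c where c: "c \<in> Ch (Suc (Suc q)) S" "b = bd (Suc (Suc q)) c" using u0(2) by (rule bndE)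
        have eq: "cadd u v = cadd u0 (bd (Suc (Suc q)) c)" using uv(3) u0(3) c(2) by simp
        obtain n cU cV where n: "cU \<in> Ch (Suc (Suc q)) U" "cV \<in> Ch (Suc (Suc q)) V"
          "csub (csub (sd n (Suc q) u) (sd n (Suc q) u0)) (bd (Suc (Suc q)) cU) = csub (bd (Suc (Suc q)) cV) (sd n (Suc q) v)"
          "csub (bd (Suc (Suc q)) cV) (sd n (Suc q) v) \<in> Ch (Suc q) (U \<inter> V)"
          by (rule mv_exchange[OF mv uv(1,2) cyc_fchains[OF u0(1)] c(1) eq])
        let ?w = "csub (csub (sd n (Suc q) u) (sd n (Suc q) u0)) (bd (Suc (Suc q)) cU)"
        note f = fchainsD(1)[OF uv(1)] fchainsD(1)[OF cyc_fchains[OF u0(1)]] fchainsD(1)[OF n(1)]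
        have "bd (Suc q) (sd n (Suc q) u0) = czero" using cyc_bd[OF sd_cyc_cyc[OF u0(1)]] .
        then have "bd (Suc q) ?w = sd n q y"
          using f bd_bd[OF n(1)] bd_sd[OF uv(1), of n] uv(4) by (simp add: chain_ext_csub)
        moreover have "?w \<in> Ch (Suc q) (U \<inter> V)" using n(3,4) by simp
        ultimately have "sd n q y \<in> bnd q (U \<inter> V)" using bndI by metis
        then show "y \<in> bnd q (U \<inter> V)" by (rule cancel_sd[OF yc])
      qed
    qed
  qed
qed

text \<open>The dimension of the kernel of the map from the homology of the intersection to the
  direct sum of those of \<open>U\<close> and \<open>V\<close>.\<close>

definition kdim :: "nat \<Rightarrow> 'a::topological_space set \<Rightarrow> 'a set \<Rightarrow> nat" where
  "kdim p U V = qdim (cyc p (U \<inter> V) \<inter> bnd p V \<inter> bnd p U) (bnd p (U \<inter> V))"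

abbreviation bt :: "nat \<Rightarrow> 'a::topological_space set \<Rightarrow> nat" where
  "bt p S \<equiv> betti F p (top_of_set S)"

definition hfin :: "nat \<Rightarrow> 'a::topological_space set \<Rightarrow> bool" where
  "hfin p S \<longleftrightarrow> qfin (cyc p S) (bnd p S)"

text \<open>For disjoint pieces the cokernel of \<open>U\<close> into \<open>S\<close> in degree 0
  is the whole degree-0 homology of \<open>V\<close>; sending a sum to its part in \<open>V\<close>
  realises this.\<close>

lemma mv_connecting_0:
  fixes U V :: "'a::topological_space set"
  assumes mv: "mv_cover S U V" and S: "S = U \<union> V" and A: "U \<inter> V = {}"
  shows "quot_rel (\<lambda>x y. y \<in> cyc 0 V \<and> (\<exists>u. u \<in> cyc 0 U \<and> x = cadd u y))
     (cyc 0 S) (csum (cyc 0 U) (bnd 0 S)) (cyc 0 V) (bnd 0 V)"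
    (is "quot_rel ?R _ ?B _ _")
proof -
  have US: "U \<subseteq> S" "V \<subseteq> S" using mv by (auto simp: mv_cover_def)
  have B: "csubspace ?B" by (intro csubspace_csum csubspace_cycles csubspace_boundaries)
  show ?thesis
    unfolding quot_rel_def
  proof (intro conjI)
    show "csubspace (cyc 0 S)" "csubspace ?B" "csubspace (cyc 0 V)" "csubspace (bnd 0 V)"
      by (intro csubspace_csum csubspace_cycles csubspace_boundaries)+
    show "\<forall>x y. ?R x y \<longrightarrow> x \<in> cyc 0 S \<and> y \<in> cyc 0 V"
      using cycD(3)[of _ 0 "top_of_set S"] cyc_mono[OF US(1), of 0] cyc_mono[OF US(2), of 0] by blast
    show "\<forall>x y x' y'. ?R x y \<longrightarrow> ?R x' y' \<longrightarrow> ?R (cadd x x') (cadd y y')"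
    proof (intro allI impI)
      fix x y x' y' assume R: "?R x y" and R': "?R x' y'"
      obtain u where u: "u \<in> cyc 0 U" "x = cadd u y" and y: "y \<in> cyc 0 V" using R by blast
      obtain u' where u': "u' \<in> cyc 0 U" "x' = cadd u' y'" and y': "y' \<in> cyc 0 V" using R' by blast
      have "cadd x x' = cadd (cadd u u') (cadd y y')"
        unfolding u u' using cycD(1)[OF u(1)] cycD(1)[OF u'(1)] cycD(1)[OF y] cycD(1)[OF y'] by (simp add: cadd_ac)
      then show "?R (cadd x x') (cadd y y')"
        using cycD(3)[OF u(1) u'(1)] cycD(3)[OF y y'] by blast
    qed
    show "\<forall>a x y. a \<in> carrier F \<longrightarrow> ?R x y \<longrightarrow> ?R (cscale a x) (cscale a y)"
    proof (intro allI impI)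
      fix a x y assume a: "a \<in> carrier F" and R: "?R x y"
      obtain u where u: "u \<in> cyc 0 U" "x = cadd u y" and y: "y \<in> cyc 0 V" using R by blast
      have "cscale a x = cadd (cscale a u) (cscale a y)"
        unfolding u using a cycD(1)[OF u(1)] cycD(1)[OF y] by (simp add: cscale_simps)
      then show "?R (cscale a x) (cscale a y)"
        using cycD(4)[OF a u(1)] cycD(4)[OF a y] by blast
    qed
    show "\<forall>z\<in>cyc 0 S. \<exists>x y. ?R x y \<and> csub z x \<in> ?B"
    proof
      fix z assume z: "z \<in> cyc 0 S"
      obtain u v where uv: "u \<in> Ch 0 U" "v \<in> Ch 0 V" "cadd u v \<in> cyc 0 S" "csub z (cadd u v) \<in> bnd 0 S"
        by (rule mv_split[OF mv z])
      moreover have "csub z (cadd u v) \<in> ?B"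
        using uv(4) csum_upper(2)[OF csubspace_cycles csubspace_boundaries] by blast
      ultimately show "\<exists>x y. ?R x y \<and> csub z x \<in> ?B" unfolding cyc_0 by blast
    qed
    show "\<forall>z\<in>cyc 0 V. \<exists>x y. ?R x y \<and> csub z y \<in> bnd 0 V"
    proof
      fix z assume z: "z \<in> cyc 0 V"
      have "?R (cadd czero z) z" using z cycD(2)[of 0 "top_of_set U"] by blast
      moreover have "csub z z \<in> bnd 0 V" using cycD(1)[OF z] bndD(2) by simp
      ultimately show "\<exists>x y. ?R x y \<and> csub z y \<in> bnd 0 V" by blast
    qed
    show "\<forall>x y. ?R x y \<longrightarrow> (x \<in> ?B) = (y \<in> bnd 0 V)"
    proof (intro allI impI)
      fix x y assume R: "?R x y"
      obtain u where u: "u \<in> cyc 0 U" "x = cadd u y" and y: "y \<in> cyc 0 V" using R by blast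
      show "(x \<in> ?B) = (y \<in> bnd 0 V)"
      proof
        assume "y \<in> bnd 0 V"
        then show "x \<in> ?B" using csumI[OF u(1)] bnd_mono[OF US(2), of 0] u(2) by blast
      next
        assume "x \<in> ?B"
        then obtain u0 b where u0: "u0 \<in> cyc 0 U" "b \<in> bnd 0 S" "x = cadd u0 b" by (rule csumE)
        obtain c where c: "c \<in> Ch (Suc 0) S" "b = bd (Suc 0) c" using u0(2) by (rule bndE)
        have eq: "cadd u y = cadd u0 (bd (Suc 0) c)" using u(2) u0(3) c(2) by simp
        obtain n cU cV where n: "cU \<in> Ch (Suc 0) U" "cV \<in> Ch (Suc 0) V"
          "csub (csub (sd n 0 u) (sd n 0 u0)) (bd (Suc 0) cU) = csub (bd (Suc 0) cV) (sd n 0 y)"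
          "csub (bd (Suc 0) cV) (sd n 0 y) \<in> Ch 0 (U \<inter> V)"
          by (rule mv_exchange[OF mv cyc_fchains[OF u(1)] cyc_fchains[OF y] cyc_fchains[OF u0(1)] c(1) eq])
        have z: "csub (bd (Suc 0) cV) (sd n 0 y) = czero" using n(4) A Ch_empty by auto
        have "sd n 0 y = bd (Suc 0) cV"
          using csub_csub_cancel[of "bd (Suc 0) cV" "sd n 0 y"] fchainsD(2)[OF n(2)] cycD(1)[OF y] z by simp
        then have "sd n 0 y \<in> bnd 0 V" using bndI[OF n(2)] by simp
        then show "y \<in> bnd 0 V" by (rule cancel_sd[OF y])
      qed
    qed
  qed
qed

text \<open>The long exact sequence cut into short ones, where \<open>V\<close> contributes a single
  dimension in degree 0. Each \<open>kdim q\<close> enters two consecutive degrees and will cancel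
  in alternating sums.\<close>

theorem mv_dim:
  fixes U V :: "'a::euclidean_space set"
  assumes mv: "mv_cover S U V" and S: "S = U \<union> V" and V: "convex V" "V \<noteq> {}"
    and fU: "\<And>p. hfin p U" and fA: "\<And>p. hfin p (U \<inter> V)"
  shows "hfin p S"
    and "bt 0 S + bt 0 (U \<inter> V) = bt 0 U + 1 + kdim 0 U V"
    and "bt (Suc q) S + bt (Suc q) (U \<inter> V) = bt (Suc q) U + kdim (Suc q) U V + kdim q U V"
proof -
  let ?A = "U \<inter> V"
  have US: "U \<subseteq> S" "V \<subseteq> S" and AU: "?A \<subseteq> U" "?A \<subseteq> V" using S by auto
  note sc = csubspace_cycles and sb = csubspace_boundaries
  have Z: "csubspace (cyc p ?A \<inter> bnd p V)" for p by (intro csubspace_Int sc sb)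
  have 1: "qfin (cyc p U) (bnd p S)" "qfin (cyc p U \<inter> bnd p S) (bnd p U)"
    "bt p U = qdim (cyc p U) (bnd p S) + qdim (cyc p U \<inter> bnd p S) (bnd p U)" for p
    using quot_exact[OF sc sb sb bnd_mono[OF US(1)], of p] fU[of p] by (auto simp: hfin_def betti_eq)
  have 4: "qfin (cyc p ?A) (bnd p V)" "qfin (cyc p ?A \<inter> bnd p V) (bnd p ?A)"
    "bt p ?A = qdim (cyc p ?A) (bnd p V) + qdim (cyc p ?A \<inter> bnd p V) (bnd p ?A)" for p
    using quot_exact[OF sc sb sb bnd_mono[OF AU(2)], of p] fA[of p] by (auto simp: hfin_def betti_eq)
  have 3: "qfin (cyc p ?A \<inter> bnd p V \<inter> bnd p U) (bnd p ?A)"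
    "qdim (cyc p ?A \<inter> bnd p V) (bnd p ?A) = qdim (cyc p ?A \<inter> bnd p V) (bnd p U) + kdim p U V" for p
    using quot_exact[OF Z sb sb bnd_mono[OF AU(1)], of p] 4(2)[of p] by (auto simp: kdim_def)
  have 2: "qdim (cyc p U \<inter> bnd p S) (bnd p U) = qdim (cyc p ?A \<inter> bnd p V) (bnd p U)" for p
  proof (rule qdim_csum_cong(1)[OF Z sb])
    show "cyc p ?A \<inter> bnd p V \<subseteq> cyc p U \<inter> bnd p S"
      using cyc_mono[OF AU(1), of p] bnd_mono[OF US(2), of p] by blast
    show "cyc p U \<inter> bnd p S \<subseteq> csum (cyc p ?A \<inter> bnd p V) (bnd p U)"
    proof
      fix z assume z: "z \<in> cyc p U \<inter> bnd p S"
      then have zU: "z \<in> cyc p U" and zS: "z \<in> bnd p S" by blast+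
      obtain a where "a \<in> cyc p ?A" "a \<in> bnd p V" "csub z a \<in> bnd p U"
        by (rule mv_kernel[OF mv zU zS])
      then show "z \<in> csum (cyc p ?A \<inter> bnd p V) (bnd p U)"
        using csum_iff_csub[OF Z sb cycD(1)[OF zU]] by blast
    qed
  qed
  let ?B = "\<lambda>p. csum (cyc p U) (bnd p S)"
  have B: "csubspace (?B p)" for p by (intro csubspace_csum sc sb)
  have Bsub: "bnd p S \<subseteq> ?B p" and Usub: "cyc p U \<subseteq> ?B p" for p
    using csum_upper[OF sc sb] by blast+
  have im: "quot (cyc p S \<inter> ?B p) (bnd p S) = quot (cyc p U) (bnd p S)" for p
    by (rule quot_csum_cong[OF sc sb]) (use cyc_mono[OF US(1), of p] Usub in blast)+
  have 5: "hfin p S \<longleftrightarrow> qfin (cyc p S) (?B p)"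
    "hfin p S \<Longrightarrow> bt p S = qdim (cyc p S) (?B p) + qdim (cyc p U) (bnd p S)" for p
  proof -
    have q: "qfin (cyc p S \<inter> ?B p) (bnd p S)" "qdim (cyc p S \<inter> ?B p) (bnd p S) = qdim (cyc p U) (bnd p S)"
      using 1(1)[of p] im[of p] by (simp_all add: qfin_def qdim_def)
    show "hfin p S \<longleftrightarrow> qfin (cyc p S) (?B p)"
      using quot_exact(1)[OF sc sb B Bsub, of p "top_of_set S"] q(1) by (simp add: hfin_def)
    show "hfin p S \<Longrightarrow> bt p S = qdim (cyc p S) (?B p) + qdim (cyc p U) (bnd p S)"
      using quot_exact(2)[OF sc sb B Bsub, of p "top_of_set S"] q(2) by (simp add: hfin_def betti_eq)
  qed
  note rel = mv_connecting[OF mv cyc_Suc_convex[OF V(1)]]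
  have 6: "qfin (cyc (Suc q) S) (?B (Suc q))" "qdim (cyc (Suc q) S) (?B (Suc q)) = kdim q U V" for q
    using quot_relation_dim[OF rel[of q]] 3(1)[of q] by (simp_all add: kdim_def)
  \<comment> \<open>The one dimension of the homology of \<open>V\<close> shows up here as a new
    component of \<open>S\<close> if the pieces are disjoint, and otherwise in \<open>70\<close> as
    the image of the intersection. Either way it is the summand 1 in degree 0.\<close>
  have 60: "qfin (cyc 0 S) (?B 0) \<and> qdim (cyc 0 S) (?B 0) = (if ?A = {} then 1 else 0)"
  proof (cases "?A = {}")
    case True
    show ?thesis
      using quot_relation_dim[OF mv_connecting_0[OF mv S True]] qdim_point[OF V(1) order.refl V(2)] True by simp
  next
    case False
    have "z \<in> ?B 0" if z: "z \<in> cyc 0 S" for z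
    proof -
      obtain u v where uv: "u \<in> Ch 0 U" "v \<in> Ch 0 V" "csub z (cadd u v) \<in> bnd 0 S"
        using mv_split[OF mv z] by metis
      have vc: "v \<in> cyc 0 V" and uc: "u \<in> cyc 0 U" using uv by (simp_all add: cyc_0)
      obtain a where a: "a \<in> cyc 0 ?A" "csub v a \<in> bnd 0 V"
        by (rule cyc_0_convex_point[OF V(1) AU(2) False vc])
      have aU: "a \<in> cyc 0 U" using a(1) cyc_mono[OF AU(1)] by blast
      have vS: "csub v a \<in> bnd 0 S" using a(2) bnd_mono[OF US(2)] by blast
      note f = cycD(1)[OF z] cycD(1)[OF uc] cycD(1)[OF vc] cycD(1)[OF aU]
      have "csub z (cadd u a) = cadd (csub z (cadd u v)) (csub v a)"
      proof
        fix s
        have "z s \<ominus>\<^bsub>F\<^esub> (u s \<oplus>\<^bsub>F\<^esub> a s) = (z s \<ominus>\<^bsub>F\<^esub> (u s \<oplus>\<^bsub>F\<^esub> v s)) \<oplus>\<^bsub>F\<^esub> (v s \<ominus>\<^bsub>F\<^esub> a s)"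
          using f[THEN cfun_app, of s] by algebra
        then show "csub z (cadd u a) s = cadd (csub z (cadd u v)) (csub v a) s" by (simp add: csub_def cadd_def)
      qed
      then have "csub z (cadd u a) \<in> bnd 0 S" using bndD(3)[OF uv(3) vS] by simp
      then show ?thesis
        using csum_iff_csub[OF sc sb f(1)] cycD(3)[OF uc aU] by blast
    qed
    then show ?thesis using qdim_trivial[OF sc B, of 0 "top_of_set S" 0] False by (simp add: subset_iff)
  qed
  show fin: "hfin p S" for p
    by (cases p) (use 5(1) 6(1) 60 in auto)
  have 7: "qdim (cyc (Suc q) ?A) (bnd (Suc q) V) = 0"
    by (rule qdim_trivial(2)[OF sc sb]) (use cyc_Suc_convex[OF V(1)] cyc_mono[OF AU(2)] in blast)
  have 70: "qdim (cyc 0 ?A) (bnd 0 V) = (if ?A = {} then 0 else 1)"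
  proof (cases "?A = {}")
    case True
    have "cyc 0 ?A = {czero}" unfolding True cyc_0 by (rule Ch_empty)
    then have "cyc 0 ?A \<subseteq> bnd 0 V" using bndD(2)[of 0 "top_of_set V"] by simp
    from qdim_trivial(2)[OF sc sb this] show ?thesis using True by simp
  next
    case False
    then show ?thesis using qdim_point(2)[OF V(1) AU(2)] by simp
  qed
  show "bt (Suc q) S + bt (Suc q) ?A = bt (Suc q) U + kdim (Suc q) U V + kdim q U V"
    using 5(2)[OF fin, of "Suc q"] 6(2)[of q] 1(3)[of "Suc q"] 2[of "Suc q"] 3(2)[of "Suc q"] 4(3)[of "Suc q"] 7 by simp
  show "bt 0 S + bt 0 ?A = bt 0 U + 1 + kdim 0 U V"
    using 5(2)[OF fin, of 0] 60 1(3)[of 0] 2[of 0] 3(2)[of 0] 4(3)[of 0] 70 by (auto split: if_splits)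
qed

end

section \<open>Homology of simplicial complexes and their sublevel sets\<close>

text \<open>Each ray from \<open>q\<close> within the affine hull meets the relative frontier
  exactly once. The map is defined on the whole punctured affine hull and not just on the cell: for
  a full-dimensional cell this brings fillings in the punctured space into the punctured
  cell.\<close>

lemma radial_projection_exists:
  fixes C :: "'a::euclidean_space set"
  assumes C: "convex C" "compact C" and q: "q \<in> rel_interior C"
  obtains \<rho> where "continuous_on (affine hull C - {q}) \<rho>" "\<rho> ` (affine hull C - {q}) \<subseteq> rel_frontier C"
    "\<And>y. y \<in> rel_frontier C \<Longrightarrow> \<rho> y = y"
    "\<And>y. y \<in> C - {q} \<Longrightarrow> \<exists>s\<ge>1. \<rho> y = q + s *\<^sub>R (y - q)"
proof -
  have bC: "bounded C" and clC: "closed C" using C by (auto intro: compact_imp_bounded compact_imp_closed)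
  have qC: "q \<in> C" using q rel_interior_subset by blast
  have qa: "q \<in> affine hull C" using qC by (simp add: hull_inc)
  let ?V = "(\<lambda>z. z - q) ` (affine hull C)"
  have dV: "q + x \<in> affine hull C \<longleftrightarrow> x \<in> ?V" for x by force
  \<comment> \<open>By convexity, a frontier point strictly before another one on the same ray would
    be in the relative interior.\<close>
  have uniq: "e = d" if "0 < d" "q + d *\<^sub>R x \<in> rel_frontier C" "\<And>e. 0 \<le> e \<Longrightarrow> e < d \<Longrightarrow> q + e *\<^sub>R x \<in> rel_interior C"
    "0 < e" "q + e *\<^sub>R x \<in> rel_frontier C" for d e x
  proof (rule ccontr)
    assume "e \<noteq> d"
    have fr: "rel_frontier C \<inter> rel_interior C = {}" by (auto simp: rel_frontier_def)
    then have "\<not> e < d" using that(3)[of e] that(4,5) by auto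
    then have "d < e" using \<open>e \<noteq> d\<close> by simp
    have x0: "x \<noteq> 0" using that(2) q fr by auto
    have "q + d *\<^sub>R x \<in> open_segment q (q + e *\<^sub>R x)"
      unfolding in_segment using \<open>d < e\<close> that(1) x0
      by (intro conjI exI[of _ "d / e"]) (auto simp: algebra_simps)
    moreover have "q + e *\<^sub>R x \<in> closure C" using that(5) by (auto simp: rel_frontier_def)
    ultimately have "q + d *\<^sub>R x \<in> rel_interior C"
      using rel_interior_closure_convex_segment[OF C(1) q] by blast
    then show False using fr that(2) by blast
  qed
  have "\<exists>d. \<forall>k. (0 < k \<and> q + k *\<^sub>R x \<in> rel_frontier C) \<longleftrightarrow> d = k" if x: "x \<in> ?V - {0}" for x
  proof -
    obtain d where d: "0 < d" "q + d *\<^sub>R x \<in> rel_frontier C" "\<And>e. 0 \<le> e \<Longrightarrow> e < d \<Longrightarrow> q + e *\<^sub>R x \<in> rel_interior C"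
      using ray_to_rel_frontier[OF bC q, of x] x dV by blast
    then show ?thesis using uniq[OF d] by blast
  qed
  then obtain d where d: "\<And>x k. x \<in> ?V - {0} \<Longrightarrow> (0 < k \<and> q + k *\<^sub>R x \<in> rel_frontier C) \<longleftrightarrow> d x = k"
    by metis
  let ?R = "(\<lambda>z. z - q) ` rel_frontier C"
  have RI: "x \<in> ?R \<longleftrightarrow> q + x \<in> rel_frontier C" for x by force
  have "continuous_on (?V - {0}) (\<lambda>x. d x *\<^sub>R x)"
  proof (rule continuous_on_compact_surface_projection)
    show "compact ?R"
      by (intro compact_translation_subtract compact_rel_frontier_bounded bC)
    have "rel_frontier C \<subseteq> affine hull C"
      using clC hull_subset[of C affine] by (auto simp: rel_frontier_def)
    moreover have "q \<notin> rel_frontier C" using q by (simp add: rel_frontier_def)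
    ultimately show "?R \<subseteq> ?V - {0}" by auto
    show "Convex.cone ?V"
      using affine_affine_hull[of C] qa affine_diffs_subspace_subtract[of "affine hull C" q]
      by (intro subspace_imp_cone) auto
    show "(0 < k \<and> k *\<^sub>R x \<in> ?R) = (d x = k)" if "x \<in> ?V - {0}" for x k
      unfolding RI using d[OF that] .
  qed
  then have "continuous_on (affine hull C - {q}) (\<lambda>y. d (y - q) *\<^sub>R (y - q))"
    by (rule continuous_on_compose2[where f = "\<lambda>y. y - q"]) (auto intro: continuous_intros)
  then have cont: "continuous_on (affine hull C - {q}) (\<lambda>y. q + d (y - q) *\<^sub>R (y - q))"
    by (intro continuous_on_add continuous_on_const)
  have mem: "0 < d (y - q)" "q + d (y - q) *\<^sub>R (y - q) \<in> rel_frontier C" if "y \<in> affine hull C - {q}" for y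
    using d[of "y - q" "d (y - q)"] that by auto
  show thesis
  proof
    show "continuous_on (affine hull C - {q}) (\<lambda>y. q + d (y - q) *\<^sub>R (y - q))" by (rule cont)
    show "(\<lambda>y. q + d (y - q) *\<^sub>R (y - q)) ` (affine hull C - {q}) \<subseteq> rel_frontier C" using mem by auto
    show "q + d (y - q) *\<^sub>R (y - q) = y" if "y \<in> rel_frontier C" for y
    proof -
      have "y \<in> affine hull C" using that clC hull_subset[of C affine] by (auto simp: rel_frontier_def)
      moreover have "y \<noteq> q" using that q by (auto simp: rel_frontier_def)
      ultimately have "d (y - q) = 1" using d[of "y - q" 1] that by auto
      then show ?thesis by simp
    qed
    show "\<exists>s\<ge>1. q + d (y - q) *\<^sub>R (y - q) = q + s *\<^sub>R (y - q)" if y: "y \<in> C - {q}" for y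
    proof (rule exI[of _ "d (y - q)"], rule conjI[OF _ refl], rule ccontr)
      assume "\<not> d (y - q) \<ge> 1"
      moreover have ya: "y \<in> affine hull C - {q}" using y by (simp add: hull_inc)
      ultimately have "q + d (y - q) *\<^sub>R (y - q) \<in> open_segment q y"
        unfolding in_segment using mem(1)[OF ya] y by (intro conjI exI[of _ "d (y - q)"]) (auto simp: algebra_simps)
      then have "q + d (y - q) *\<^sub>R (y - q) \<in> rel_interior C"
        using rel_interior_closure_convex_segment[OF C(1) q] y closure_subset[of C] by blast
      then show False using mem(2)[OF ya] by (simp add: rel_frontier_def)
    qed
  qed
qed

context coeff_field
begin

text \<open>\<open>D\<close> is pushed away from \<open>q\<close> onto the relative frontier while
  \<open>Y\<close> stays fixed; by \<open>ray\<close>, \<open>D\<close> contains the points of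
  \<open>C\<close> behind its own points as seen from \<open>q\<close>. It serves for a cell cut by
  a half-space, with \<open>q\<close> outside \<open>D\<close>, and for a whole cell punctured at
  \<open>q\<close>.\<close>

lemma heq_radial:
  fixes C :: "'a::euclidean_space set"
  assumes C: "convex C" "compact C" and q: "q \<in> rel_interior C"
    and Y: "closed Y" and D: "closed D" "D \<subseteq> C" and YD: "Y \<inter> D = D \<inter> rel_frontier C" and qY: "q \<notin> Y"
    and ray: "\<And>y s. y \<in> D \<Longrightarrow> s \<ge> 1 \<Longrightarrow> q + s *\<^sub>R (y - q) \<in> C \<Longrightarrow> q + s *\<^sub>R (y - q) \<in> D"
  shows "heq p Y (Y \<union> D - {q})"
proof -
  obtain \<rho> where \<rho>: "continuous_on (affine hull C - {q}) \<rho>" "\<rho> ` (affine hull C - {q}) \<subseteq> rel_frontier C"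
    "\<And>y. y \<in> rel_frontier C \<Longrightarrow> \<rho> y = y" "\<And>y. y \<in> C - {q} \<Longrightarrow> \<exists>s\<ge>1. \<rho> y = q + s *\<^sub>R (y - q)"
    using radial_projection_exists[OF C q] by blast
  have Ca: "C \<subseteq> affine hull C" by (rule hull_subset)
  have clC: "closed C" using C by (simp add: compact_imp_closed)
  have frC: "rel_frontier C \<subseteq> C" using clC by (auto simp: rel_frontier_def)
  let ?T = "Y \<union> D - {q}"
  have T: "?T = (D - {q}) \<union> Y" using qY by auto
  define r where "r x = (if x \<in> D then \<rho> x else x)" for x
  have rY: "r x = x" if "x \<in> Y" for x using that YD \<rho>(3) by (auto simp: r_def)
  have rD: "r x \<in> D \<inter> rel_frontier C" if x: "x \<in> D - {q}" for x
  proof -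
    have "\<rho> x \<in> rel_frontier C" using \<rho>(2) x D(2) Ca by blast
    moreover obtain s where "s \<ge> 1" "\<rho> x = q + s *\<^sub>R (x - q)" using \<rho>(4)[of x] x D(2) by blast
    ultimately show ?thesis using ray[of x s] x frC by (auto simp: r_def)
  qed
  have cont: "continuous_on ?T r"
    unfolding T r_def
  proof (rule continuous_on_cases_local)
    show "closedin (top_of_set (D - {q} \<union> Y)) (D - {q})"
      using D(1) qY by (auto simp: closedin_closed intro!: exI[of _ D])
    show "closedin (top_of_set (D - {q} \<union> Y)) Y"
      using Y by (auto simp: closedin_closed intro!: exI[of _ Y])
    show "continuous_on (D - {q}) \<rho>" by (rule continuous_on_subset[OF \<rho>(1)]) (use D Ca in auto)
    show "continuous_on Y (\<lambda>x. x)" by simp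
    show "\<rho> x = x" if "x \<in> D - {q} \<and> x \<notin> D \<or> x \<in> Y \<and> x \<in> D" for x
      using that YD \<rho>(3) by auto
  qed
  show ?thesis
  proof (rule heq_retract)
    show "Y \<subseteq> ?T" using qY by auto
    show "continuous_on ?T r" by (rule cont)
    show "r ` ?T \<subseteq> Y" using rY rD YD by auto
    show "r x = x" if "x \<in> Y" for x using rY that .
    show "homotopic_with_canon (\<lambda>x. True) ?T ?T id r"
    proof (rule homotopic_with_linear)
      show "continuous_on ?T id" by (simp add: continuous_on_id')
      show "continuous_on ?T r" by (rule cont)
      show "closed_segment (id x) (r x) \<subseteq> ?T" if x: "x \<in> ?T" for x
      proof (cases "x \<in> Y")
        case True
        then show ?thesis using rY x by simp
      next
        case False
        then have xD: "x \<in> D - {q}" using x by auto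
        obtain s where s: "s \<ge> 1" "r x = q + s *\<^sub>R (x - q)" using \<rho>(4)[of x] xD D(2) by (auto simp: r_def)
        have "z \<in> D - {q}" if z: "z \<in> closed_segment x (r x)" for z
        proof -
          have "z \<in> C" using z closed_segment_subset[OF _ _ C(1), of x "r x"] xD rD[OF xD] D(2) by blast
          obtain u where u: "0 \<le> u" "u \<le> 1" "z = (1 - u) *\<^sub>R x + u *\<^sub>R r x" using z by (auto simp: in_segment)
          \<comment> \<open>The points of the segment arise from \<open>x\<close> by a factor of at
            least 1, so the ray condition keeps them in \<open>D\<close> and they avoid
            \<open>q\<close>.\<close>
          have ze: "z = q + (1 + u * (s - 1)) *\<^sub>R (x - q)"
            unfolding u(3) s(2) by (simp add: algebra_simps)
          have ge: "1 + u * (s - 1) \<ge> 1" using u s by simp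
          have "z \<in> D" using ray[OF _ ge] xD \<open>z \<in> C\<close> ze by auto
          moreover have "z \<noteq> q" using ze ge xD by auto
          ultimately show ?thesis by simp
        qed
        then show ?thesis by auto
      qed
    qed
  qed
qed

end

section \<open>Removing a maximal cell from a simplicial complex\<close>

lemma simplicial_complex_subfamily:
  assumes K: "simplicial_complex K" and L: "L \<subseteq> K" "\<And>F S. S \<in> L \<Longrightarrow> F face_of S \<Longrightarrow> F \<in> L"
  shows "simplicial_complex L"
proof -
  have "finite K" "\<forall>S\<in>K. \<exists>n. n simplex S" "\<forall>S S'. S \<in> K \<and> S' \<in> K \<longrightarrow> (S \<inter> S') face_of S"
    using K unfolding simplicial_complex_def by blast+
  then show ?thesis
    unfolding simplicial_complex_def using L finite_subset by (metis subsetD)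
qed

lemma simplicial_complexD:
  assumes "simplicial_complex K"
  shows "finite K" "S \<in> K \<Longrightarrow> \<exists>n. n simplex S" "S \<in> K \<Longrightarrow> F face_of S \<Longrightarrow> F \<in> K"
    "S \<in> K \<Longrightarrow> T \<in> K \<Longrightarrow> (S \<inter> T) face_of S"
  using assms unfolding simplicial_complex_def by blast+

lemma simplicial_complex_cell:
  assumes "simplicial_complex K" "S \<in> K"
  shows "convex S" "compact S" "closed S" "polyhedron S"
  using simplicial_complexD(2)[OF assms] convex_simplex compact_simplex closed_simplex simplex_imp_polyhedron by blast+

lemma closed_Union_complex: "simplicial_complex K \<Longrightarrow> closed (\<Union>K)"
  by (intro closed_Union) (auto dest: simplicial_complexD(1) simplicial_complex_cell(3))

lemma simplicial_complex_remove:
  assumes K: "simplicial_complex K" and s: "s \<in> K" "\<And>T. T \<in> K \<Longrightarrow> s \<subseteq> T \<Longrightarrow> T = s"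
  shows "simplicial_complex (K - {s})"
proof (rule simplicial_complex_subfamily[OF K])
  show "F \<in> K - {s}" if "S \<in> K - {s}" "F face_of S" for F S
    using that simplicial_complexD(3)[OF K, of S F] s(2)[of S] face_of_imp_subset[of F S] by auto
qed auto

lemma simplicial_complex_proper_faces:
  assumes K: "simplicial_complex K" and s: "s \<in> K"
  shows "simplicial_complex {F. F face_of s \<and> F \<noteq> s}" "{F. F face_of s \<and> F \<noteq> s} \<subseteq> K"
    "\<Union>{F. F face_of s \<and> F \<noteq> s} = rel_frontier s"
proof -
  show sub: "{F. F face_of s \<and> F \<noteq> s} \<subseteq> K" using simplicial_complexD(3)[OF K s] by blast
  show "simplicial_complex {F. F face_of s \<and> F \<noteq> s}"
  proof (rule simplicial_complex_subfamily[OF K sub])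
    show "G \<in> {F. F face_of s \<and> F \<noteq> s}" if "F \<in> {F. F face_of s \<and> F \<noteq> s}" "G face_of F" for F G
      using that face_of_trans[of G F s] face_of_imp_subset[of G F] face_of_imp_subset[of F s] by auto
  qed
  show "\<Union>{F. F face_of s \<and> F \<noteq> s} = rel_frontier s"
    using rel_frontier_of_polyhedron_alt[OF simplicial_complex_cell(4)[OF K s]] by simp
qed

text \<open>By maximality the cell meets any other cell in a proper face, and the proper faces fill
  the relative frontier.\<close>

lemma maximal_cell_Int:
  assumes K: "simplicial_complex K" and s: "s \<in> K" "\<And>T. T \<in> K \<Longrightarrow> s \<subseteq> T \<Longrightarrow> T = s"
  shows "\<Union>(K - {s}) \<inter> s = rel_frontier s"
proof
  show "\<Union>(K - {s}) \<inter> s \<subseteq> rel_frontier s"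
  proof
    fix x assume "x \<in> \<Union>(K - {s}) \<inter> s"
    then obtain T where T: "T \<in> K" "T \<noteq> s" "x \<in> s \<inter> T" by blast
    have "(s \<inter> T) face_of s" "s \<inter> T \<noteq> s"
      using simplicial_complexD(4)[OF K s(1) T(1)] s(2)[OF T(1)] T(2) by auto
    then show "x \<in> rel_frontier s"
      using simplicial_complex_proper_faces(3)[OF K s(1)] T(3) by blast
  qed
  show "rel_frontier s \<subseteq> \<Union>(K - {s}) \<inter> s"
  proof
    fix x assume "x \<in> rel_frontier s"
    then obtain F where "x \<in> F" "F face_of s" "F \<noteq> s"
      using simplicial_complex_proper_faces(3)[OF K s(1)] by blast
    then show "x \<in> \<Union>(K - {s}) \<inter> s"
      using simplicial_complexD(3)[OF K s(1)] face_of_imp_subset by blast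
  qed
qed

lemma maximal_cell_exists:
  assumes "finite L" "L \<noteq> {}"
  obtains s :: "'a set" where "s \<in> L" "\<And>T. T \<in> L \<Longrightarrow> s \<subseteq> T \<Longrightarrow> T = s"
  using finite_has_maximal[OF assms] by metis

definition lower_cells :: "'a::real_inner set set \<Rightarrow> 'a \<Rightarrow> real \<Rightarrow> 'a set set" where
  "lower_cells K v t = {s \<in> K. s \<subseteq> {y. y \<bullet> v \<le> t}}"

lemma simplicial_complex_lower_cells:
  "simplicial_complex K \<Longrightarrow> simplicial_complex (lower_cells K v t)"
  by (rule simplicial_complex_subfamily)
    (auto simp: lower_cells_def dest: simplicial_complexD(3) face_of_imp_subset)

context coeff_field
begin

lemma heq_lower_cells:
  fixes K :: "'a::euclidean_space set set"
  assumes "simplicial_complex K"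
  shows "heq p (\<Union>(lower_cells K v t)) {y \<in> \<Union>K. y \<bullet> v \<le> t}"
  using assms
proof (induction "card (K - lower_cells K v t)" arbitrary: K rule: less_induct)
  case less
  note K = less.prems
  let ?H = "{y. y \<bullet> v \<le> t}"
  have fin: "finite (K - lower_cells K v t)" using simplicial_complexD(1)[OF K] by simp
  show ?case
  proof (cases "K - lower_cells K v t = {}")
    case True
    then have "\<Union>(lower_cells K v t) = {y \<in> \<Union>K. y \<bullet> v \<le> t}" by (auto simp: lower_cells_def)
    then show ?thesis by (simp add: heq_refl)
  next
    case False
    obtain s where s: "s \<in> K - lower_cells K v t"
      and smax: "\<And>T. T \<in> K - lower_cells K v t \<Longrightarrow> s \<subseteq> T \<Longrightarrow> T = s"
      using maximal_cell_exists[OF fin False] by blast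
    have sK: "s \<in> K" and sH: "\<not> s \<subseteq> ?H" using s by (auto simp: lower_cells_def)
    \<comment> \<open>A cell containing one that leaves the half-space leaves it too, so maximality
      among the cells that leave is maximality in \<open>K\<close>.\<close>
    have max: "T = s" if "T \<in> K" "s \<subseteq> T" for T
      using smax[of T] that sH by (auto simp: lower_cells_def)
    note cell = simplicial_complex_cell[OF K sK]
    have K': "simplicial_complex (K - {s})" by (rule simplicial_complex_remove[OF K sK max])
    have low: "lower_cells (K - {s}) v t = lower_cells K v t" using s by (auto simp: lower_cells_def)
    have clH: "closed ?H" using closed_halfspace_le[of v t] by (simp add: inner_commute)
    have "\<not> rel_interior s \<subseteq> ?H"
    proof
      assume "rel_interior s \<subseteq> ?H"
      then have "closure (rel_interior s) \<subseteq> ?H" by (rule closure_minimal[OF _ clH])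
      then show False using convex_closure_rel_interior[OF cell(1)] cell(3) sH by simp
    qed
    then obtain q where q: "q \<in> rel_interior s" "q \<bullet> v > t" using not_le by blast
    have cap: "{y \<in> \<Union>K. y \<bullet> v \<le> t} = {y \<in> \<Union>(K - {s}). y \<bullet> v \<le> t} \<union> (s \<inter> ?H) - {q}"
      using sK q(2) by auto
    have 1: "heq p {y \<in> \<Union>(K - {s}). y \<bullet> v \<le> t} {y \<in> \<Union>K. y \<bullet> v \<le> t}"
      unfolding cap
    proof (rule heq_radial[OF cell(1,2) q(1)])
      have "{y \<in> \<Union>(K - {s}). y \<bullet> v \<le> t} = \<Union>(K - {s}) \<inter> ?H" by auto
      then show "closed {y \<in> \<Union>(K - {s}). y \<bullet> v \<le> t}"
        using closed_Union_complex[OF K'] clH by (simp add: closed_Int)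
      show "closed (s \<inter> ?H)" using cell(3) clH by (rule closed_Int)
      show "{y \<in> \<Union>(K - {s}). y \<bullet> v \<le> t} \<inter> (s \<inter> ?H) = s \<inter> ?H \<inter> rel_frontier s"
        using maximal_cell_Int[OF K sK max] by blast
      show "q \<notin> {y \<in> \<Union>(K - {s}). y \<bullet> v \<le> t}" using q(2) by simp
      \<comment> \<open>Going from \<open>q\<close>, above level \<open>t\<close>, to a point at or
        below \<open>t\<close> decreases the height, and continuing beyond that point decreases it
        further.\<close>
      show "q + u *\<^sub>R (y - q) \<in> s \<inter> ?H" if "y \<in> s \<inter> ?H" "u \<ge> 1" "q + u *\<^sub>R (y - q) \<in> s" for y u
      proof -
        have "(y - q) \<bullet> v \<le> 0" using that(1) q(2) by (simp add: inner_diff_left)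
        then have "(u - 1) * ((y - q) \<bullet> v) \<le> 0" using that(2) by (simp add: mult_nonneg_nonpos)
        then have "(q + u *\<^sub>R (y - q)) \<bullet> v \<le> y \<bullet> v" by (simp add: algebra_simps inner_diff_left inner_add_left)
        then show ?thesis using that by auto
      qed
    qed auto
    have "card (K - {s} - lower_cells (K - {s}) v t) < card (K - lower_cells K v t)"
      unfolding low by (rule psubset_card_mono[OF fin]) (use s in blast)
    then have 2: "heq p (\<Union>(lower_cells (K - {s}) v t)) {y \<in> \<Union>(K - {s}). y \<bullet> v \<le> t}"
      by (rule less.hyps[OF _ K'])
    from heq_trans[OF 2 1] show ?thesis unfolding low .
  qed
qed

lemma kdim_le:
  fixes U V :: "'a::euclidean_space set"
  assumes "hfin p (U \<inter> V)"
  shows "kdim p U V \<le> bt p (U \<inter> V)"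
  unfolding kdim_def betti_eq
proof (rule qdim_mono)
  show "csubspace (cyc p (U \<inter> V) \<inter> bnd p V \<inter> bnd p U)"
    by (intro csubspace_Int csubspace_cycles csubspace_boundaries)
  show "qfin (cyc p (U \<inter> V)) (bnd p (U \<inter> V))" using assms by (simp add: hfin_def)
qed (use csubspace_cycles csubspace_boundaries in blast)+

lemma heq_bt:
  assumes "heq p S T" "hfin p S"
  shows "hfin p T" "bt p T = bt p S"
  using heq_qdim[OF assms(1)] assms(2) unfolding hfin_def betti_eq by simp_all

text \<open>The radial projection from a point of a full-dimensional cell shows that the punctured cell is
  a homological retract of the punctured space.\<close>

lemma punctured_boundary:
  fixes C :: "'a::euclidean_space set"
  assumes C: "convex C" "compact C" and q: "q \<in> rel_interior C" and full: "affine hull C = UNIV"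
  shows "cyc p (C - {q}) \<inter> bnd p (UNIV - {q}) \<subseteq> bnd p (C - {q})"
proof
  fix z assume z: "z \<in> cyc p (C - {q}) \<inter> bnd p (UNIV - {q})"
  then have zc: "z \<in> cyc p (C - {q})" and zb: "z \<in> bnd p (UNIV - {q})" by blast+
  obtain \<rho> where \<rho>: "continuous_on (affine hull C - {q}) \<rho>" "\<rho> ` (affine hull C - {q}) \<subseteq> rel_frontier C"
    "\<And>y. y \<in> rel_frontier C \<Longrightarrow> \<rho> y = y" "\<And>y. y \<in> C - {q} \<Longrightarrow> \<exists>s\<ge>1. \<rho> y = q + s *\<^sub>R (y - q)"
    using radial_projection_exists[OF C q] by blast
  have fr: "rel_frontier C \<subseteq> C - {q}"
    using q compact_imp_closed[OF C(2)] by (auto simp: rel_frontier_def)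
  have "continuous_map (top_of_set (UNIV - {q})) (top_of_set (C - {q})) \<rho>"
    using \<rho>(1,2) fr unfolding full by (auto simp: continuous_map_in_subtopology)
  then have 1: "push p \<rho> z \<in> bnd p (C - {q})" by (rule push_bnd[OF zb])
  have "homotopic_with_canon (\<lambda>x. True) (C - {q}) (C - {q}) id \<rho>"
  proof (rule homotopic_with_linear)
    show "continuous_on (C - {q}) id" by (simp add: continuous_on_id')
    show "continuous_on (C - {q}) \<rho>" by (rule continuous_on_subset[OF \<rho>(1)]) (auto simp: full)
    show "closed_segment (id x) (\<rho> x) \<subseteq> C - {q}" if x: "x \<in> C - {q}" for x
    proof -
      obtain s where s: "s \<ge> 1" "\<rho> x = q + s *\<^sub>R (x - q)" using \<rho>(4)[OF x] by blast
      have "\<rho> x \<in> C" using \<rho>(2) x fr unfolding full by blast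
      then have "closed_segment x (\<rho> x) \<subseteq> C" using x closed_segment_subset[OF _ _ C(1)] by blast
      moreover have "q \<notin> closed_segment x (\<rho> x)"
      proof
        assume "q \<in> closed_segment x (\<rho> x)"
        then obtain u where u: "0 \<le> u" "u \<le> 1" "q = (1 - u) *\<^sub>R x + u *\<^sub>R \<rho> x" by (auto simp: in_segment)
        have "(1 + u * (s - 1)) *\<^sub>R (x - q) = ((1 - u) *\<^sub>R x + u *\<^sub>R \<rho> x) - q"
          unfolding s(2) by (simp add: algebra_simps)
        also have "\<dots> = 0" using u(3) by simp
        finally have "(1 + u * (s - 1)) *\<^sub>R (x - q) = 0" .
        moreover have "1 + u * (s - 1) \<ge> 1" using u(1) s(1) by simp
        ultimately show False using x by simp
      qed
      ultimately show ?thesis by auto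
    qed
  qed
  then have 2: "csub z (push p \<rho> z) \<in> bnd p (C - {q})" by (rule homotopic_id_push[OF _ zc])
  have zf: "z \<in> cfun" by (rule cycD(1)[OF zc])
  have "z = cadd (csub z (push p \<rho> z)) (push p \<rho> z)" using zf by simp
  then show "z \<in> bnd p (C - {q})" using bndD(3)[OF 2 1] by simp
qed

end

lemma sum_Pow_alternating:
  assumes "finite C" "C \<noteq> {}"
  shows "(\<Sum>c\<in>Pow C. (-1::int) ^ card c) = 0"
proof -
  obtain x D where C: "C = insert x D" "x \<notin> D" using assms(2) by (meson mk_disjoint_insert ex_in_conv)
  have fin: "finite D" using assms(1) C by simp
  have inj: "inj_on (insert x) (Pow D)" proof (rule inj_onI)
    fix c d assume "c \<in> Pow D" "d \<in> Pow D" "insert x c = insert x d"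
    moreover from this have "x \<notin> c" "x \<notin> d" using C(2) by blast+
    ultimately show "c = d" using insert_ident by metis
  qed
  have "(\<Sum>c\<in>Pow C. (-1::int) ^ card c) = (\<Sum>c\<in>Pow D. (-1) ^ card c) + (\<Sum>c\<in>insert x ` Pow D. (-1) ^ card c)"
    unfolding C(1) Pow_insert by (rule sum.union_disjoint) (use fin C(2) in auto)
  also have "(\<Sum>c\<in>insert x ` Pow D. (-1::int) ^ card c) = (\<Sum>c\<in>Pow D. (-1) ^ card (insert x c))"
    using sum.reindex[OF inj, of "\<lambda>c. (-1::int) ^ card c"] by simp
  also have "\<dots> = (\<Sum>c\<in>Pow D. - ((-1) ^ card c))"
  proof (rule sum.cong)
    show "(-1::int) ^ card (insert x c) = - ((-1) ^ card c)" if "c \<in> Pow D" for c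
    proof -
      have "finite c" "x \<notin> c" using that fin C(2) finite_subset by auto
      then show ?thesis by simp
    qed
  qed simp
  finally show ?thesis by (simp add: sum_negf)
qed

text \<open>The nonempty faces are the hulls of the nonempty sets of vertices. The alternating sum
  over all sets of vertices vanishes, so the missing empty set accounts for the value 1.\<close>

lemma simplex_face_sum:
  fixes s :: "'a::euclidean_space set"
  assumes "n simplex s" "s \<noteq> {}"
  shows "(\<Sum>F\<in>{F. F face_of s \<and> F \<noteq> {}}. (-1::int) ^ nat (aff_dim F)) = 1"
proof -
  obtain C where C: "\<not> affine_dependent C" "s = convex hull C" using assms(1) by (auto simp: simplex_def)
  have fin: "finite C" using C(1) by (rule aff_independent_finite)
  have ne: "C \<noteq> {}" using assms(2) C(2) by auto
  have sub: "\<not> affine_dependent c" if "c \<subseteq> C" for c using C(1) that by (rule affine_independent_subset)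
  have inj: "inj_on (\<lambda>c. convex hull c) (Pow C)"
  proof (rule inj_onI)
    fix c d assume "c \<in> Pow C" "d \<in> Pow C" "convex hull c = convex hull d"
    then show "c = d"
      using extreme_point_of_convex_hull_affine_independent[OF sub[of c]]
        extreme_point_of_convex_hull_affine_independent[OF sub[of d]] by auto
  qed
  have faces: "{F. F face_of s \<and> F \<noteq> {}} = (\<lambda>c. convex hull c) ` (Pow C - {{}})"
    unfolding C(2) face_of_convex_hull_affine_independent[OF C(1)] by auto
  have "(\<Sum>F\<in>{F. F face_of s \<and> F \<noteq> {}}. (-1::int) ^ nat (aff_dim F)) =
      (\<Sum>c\<in>Pow C - {{}}. (-1) ^ nat (aff_dim (convex hull c)))"
    unfolding faces using sum.reindex[OF inj_on_subset[OF inj], of "Pow C - {{}}"] by auto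
  also have "\<dots> = (\<Sum>c\<in>Pow C - {{}}. - ((-1) ^ card c))"
  proof (rule sum.cong)
    show "(-1::int) ^ nat (aff_dim (convex hull c)) = - ((-1) ^ card c)" if c: "c \<in> Pow C - {{}}" for c
    proof -
      have "finite c" "c \<noteq> {}" using c fin finite_subset by auto
      then have "card c > 0" by (simp add: card_gt_0_iff)
      then obtain m where m: "card c = Suc m" using gr0_implies_Suc by blast
      have "aff_dim (convex hull c) = int m"
        using sub[of c] c m by (auto simp: aff_dim_convex_hull affine_independent_iff_card)
      then show ?thesis using m by simp
    qed
  qed simp
  also have "\<dots> = 1"
    using sum_Pow_alternating[OF fin ne] sum.remove[of "Pow C" "{}" "\<lambda>c. (-1::int) ^ card c"] fin
    by (simp add: sum_negf)
  finally show ?thesis .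
qed

context coeff_field
begin

lemma bt_empty: "hfin p {}" "bt p {} = 0"
proof -
  have "cyc p {} \<subseteq> bnd p {}"
  proof
    fix c assume "c \<in> cyc p {}"
    from cyc_fchains[OF this] have "c = czero" unfolding Ch_empty by simp
    then show "c \<in> bnd p {}" using bndD(2) by simp
  qed
  then show "hfin p {}" "bt p {} = 0"
    unfolding hfin_def betti_eq using qdim_trivial[OF csubspace_cycles csubspace_boundaries] by blast+
qed

text \<open>The Euler--Poincare formula, proved together with finiteness and two vanishing
  statements. Removing a maximal cell \<open>s\<close> leads to the complex without \<open>s\<close>
  and to the complex of proper faces of \<open>s\<close>, both smaller. Vanishing above the
  dimension of the complex controls the kernel terms; vanishing from the ambient dimension on shows
  that the degrees recorded by the persistent homology transform are enough.\<close>

theorem complex_homology: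
  fixes K :: "'a::euclidean_space set set"
  assumes "simplicial_complex K"
  shows "(\<forall>p. hfin p (\<Union>K)) \<and>
    (\<forall>p. (\<forall>s\<in>K. aff_dim s < int p) \<longrightarrow> bt p (\<Union>K) = 0) \<and>
    (\<forall>p\<ge>DIM('a). bt p (\<Union>K) = 0) \<and>
    (\<Sum>p\<le>DIM('a). (-1) ^ p * int (bt p (\<Union>K))) = (\<Sum>s\<in>K - {{}}. (-1) ^ nat (aff_dim s))"
  using assms
proof (induction "card K" arbitrary: K rule: less_induct)
  case less
  note K = less.prems
  have finK: "finite K" by (rule simplicial_complexD(1)[OF K])
  show ?case
  proof (cases "K - {{}} = {}")
    case True
    then have E: "\<Union>K = {}" by auto
    show ?thesis unfolding True E bt_empty(2) by (simp add: bt_empty(1))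
  next
    case False
    have "finite (K - {{}})" using finK by simp
    then obtain s where s0: "s \<in> K - {{}}" and smax: "\<And>T. T \<in> K - {{}} \<Longrightarrow> s \<subseteq> T \<Longrightarrow> T = s"
      using maximal_cell_exists[OF _ False] by blast
    have s: "s \<in> K" "s \<noteq> {}" using s0 by blast+
    have max: "T = s" if "T \<in> K" "s \<subseteq> T" for T using smax[of T] that s by auto
    note cell = simplicial_complex_cell[OF K s(1)]
    let ?K' = "K - {s}" and ?L = "{F. F face_of s \<and> F \<noteq> s}"
    have K': "simplicial_complex ?K'" by (rule simplicial_complex_remove[OF K s(1) max])
    note L = simplicial_complex_proper_faces[OF K s(1)]
    have "card ?K' < card K" using s finK by (intro psubset_card_mono) auto
    note IHK = less.hyps[OF this K']
    have "card ?L < card K" using s finK L(2) by (intro psubset_card_mono) auto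
    note IHL = less.hyps[OF this L(1)]
    obtain q where q: "q \<in> rel_interior s" using rel_interior_eq_empty[OF cell(1)] s(2) by blast
    have qs: "q \<in> s" using q rel_interior_subset by blast
    have qfr: "q \<notin> rel_frontier s" using q by (simp add: rel_frontier_def)
    have fr: "\<Union>?K' \<inter> s = rel_frontier s" by (rule maximal_cell_Int[OF K s(1) max])
    have qK: "q \<notin> \<Union>?K'" using qs qfr fr by blast
    have SU: "\<Union>K = \<Union>?K' \<union> s" using s(1) by blast
    \<comment> \<open>The puncture makes the two pieces overlap in the punctured cell, which
      retracts to the frontier, while the punctured space retracts to the complex without
      \<open>s\<close>.\<close>
    let ?S = "\<Union>K" and ?U = "\<Union>K - {q}" and ?A = "s - {q}"
    have UA: "?U \<inter> s = ?A" using s(1) by blast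
    have hU: "heq p (\<Union>?K') ?U" for p
      unfolding SU
      by (rule heq_radial[OF cell(1,2) q closed_Union_complex[OF K'] cell(3)]) (use fr qK in auto)
    have hA: "heq p (\<Union>?L) ?A" for p
    proof -
      have "heq p (rel_frontier s) (rel_frontier s \<union> s - {q})"
      proof (rule heq_radial[OF cell(1,2) q closed_rel_frontier cell(3)])
        show "rel_frontier s \<inter> s = s \<inter> rel_frontier s" by (rule Int_commute)
      qed (use qfr in simp_all)
      moreover have "rel_frontier s \<union> s = s" using fr by blast
      ultimately show ?thesis unfolding L(3) by simp
    qed
    note IHK1 = IHK[THEN conjunct1, rule_format] and IHK2 = IHK[THEN conjunct2, THEN conjunct1, rule_format]
      and IHK3 = IHK[THEN conjunct2, THEN conjunct2, THEN conjunct1, rule_format]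
      and IHK4 = IHK[THEN conjunct2, THEN conjunct2, THEN conjunct2]
    note IHL1 = IHL[THEN conjunct1, rule_format] and IHL2 = IHL[THEN conjunct2, THEN conjunct1, rule_format]
      and IHL3 = IHL[THEN conjunct2, THEN conjunct2, THEN conjunct1, rule_format]
      and IHL4 = IHL[THEN conjunct2, THEN conjunct2, THEN conjunct2]
    have U: "hfin p ?U" "bt p ?U = bt p (\<Union>?K')" for p by (rule heq_bt[OF hU IHK1])+
    have A: "hfin p ?A" "bt p ?A = bt p (\<Union>?L)" for p by (rule heq_bt[OF hA IHL1])+
    have mv: "mv_cover ?S ?U s"
      unfolding mv_cover_def
    proof (intro conjI exI)
      show "openin (top_of_set ?S) ?U" by (simp add: openin_delete)
      show "openin (top_of_set ?S) (?S - \<Union>?K')"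
        using closed_Union_complex[OF K'] unfolding openin_open
        by (intro exI[of _ "- \<Union>?K'"]) (auto simp: open_Compl)
      show "?S - \<Union>?K' \<subseteq> s" by auto
      show "?S \<subseteq> ?U \<union> (?S - \<Union>?K')" using qK by auto
      show "s \<subseteq> ?S" using s(1) by blast
    qed auto
    have S: "?S = ?U \<union> s" using qs s(1) by auto
    have fA: "hfin p (?U \<inter> s)" for p unfolding UA by (rule A(1))
    note mvd = mv_dim[OF mv S cell(1) s(2) U(1) fA, unfolded UA]
    define k where "k p = kdim p ?U s" for p
    have kA: "k p \<le> bt p ?A" for p using kdim_le[OF fA, of p] unfolding UA k_def .
    have dims: "aff_dim F < aff_dim s" if "F \<in> ?L" for F
      using face_of_aff_dim_lt[OF cell(1)] that by blast
    have kz: "k p = 0" if "aff_dim s \<le> int p" for p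
    proof -
      have "aff_dim F < int p" if "F \<in> ?L" for F using dims[OF that] \<open>aff_dim s \<le> int p\<close> by linarith
      then have "bt p (\<Union>?L) = 0" by (rule IHL2)
      then show ?thesis using kA[of p] A(2)[of p] by simp
    qed
    \<comment> \<open>A cycle of the punctured cell that bounds in the punctured complex bounds in
      the punctured ambient space, and by radial projection already in the punctured cell.\<close>
    have kfull: "k p = 0" if full: "aff_dim s = int DIM('a)" for p
    proof -
      have "affine hull s = UNIV" using full aff_dim_eq_full by blast
      from punctured_boundary[OF cell(1,2) q this, of p]
      have "cyc p (?U \<inter> s) \<inter> bnd p s \<inter> bnd p ?U \<subseteq> bnd p (?U \<inter> s)"
        unfolding UA using bnd_mono[of ?U "UNIV - {q}" p] by blast
      then show ?thesis
        unfolding k_def kdim_def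
        by (intro qdim_trivial(2) csubspace_Int csubspace_cycles csubspace_boundaries)
    qed
    have step: "bt (Suc p) ?S = 0" if "bt (Suc p) (\<Union>?K') = 0" "aff_dim s \<le> int p \<or> aff_dim s = int DIM('a) \<and> aff_dim s \<le> int (Suc p)" for p
    proof -
      have "k p = 0" "k (Suc p) = 0" using that(2) kz[of p] kz[of "Suc p"] kfull by auto
      then show ?thesis using mvd(3)[of p] that(1) U(2)[of "Suc p"] by (simp add: k_def)
    qed
    have dimle: "aff_dim s \<le> int DIM('a)" by (rule aff_dim_le_DIM)
    have "bt p ?S = 0" if p: "\<forall>T\<in>K. aff_dim T < int p" for p
    proof (cases p)
      case 0
      then have "aff_dim s < 0" using p s(1) by simp
      moreover have "aff_dim s \<noteq> -1" using s(2) aff_dim_empty[of s] by blast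
      ultimately have False using aff_dim_geq[of s] by linarith
      then show ?thesis ..
    next
      case (Suc r)
      have "bt p (\<Union>?K') = 0" by (rule IHK2) (use p in auto)
      moreover have "aff_dim s \<le> int r" using p s(1) Suc by force
      ultimately show ?thesis using step[of r] Suc by simp
    qed
    moreover have "bt p ?S = 0" if p: "p \<ge> DIM('a)" for p
    proof (cases p)
      case 0
      then show ?thesis using p by simp
    next
      case (Suc r)
      have "bt p (\<Union>?K') = 0" by (rule IHK3[OF p])
      moreover have "aff_dim s \<le> int r \<or> aff_dim s = int DIM('a) \<and> aff_dim s \<le> int (Suc r)"
        using dimle p Suc by linarith
      ultimately show ?thesis using step[of r] Suc by simp
    qed
    moreover have "(\<Sum>p\<le>DIM('a). (-1) ^ p * int (bt p ?S)) = (\<Sum>T\<in>K - {{}}. (-1) ^ nat (aff_dim T))"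
    proof -
      \<comment> \<open>In the alternating sum of the degree formulas the kernel terms cancel
        pairwise and only the one of degree \<open>N\<close> is left over.\<close>
      have pre: "(\<Sum>p\<le>N. (-1) ^ p * int (bt p ?S)) = (\<Sum>p\<le>N. (-1) ^ p * int (bt p ?U)) -
          (\<Sum>p\<le>N. (-1) ^ p * int (bt p ?A)) + 1 + (-1) ^ N * int (k N)" for N
      proof (induction N)
        case 0
        then show ?case using mvd(2) by (simp add: k_def)
      next
        case (Suc N)
        have eq: "int (bt (Suc N) ?S) = int (bt (Suc N) ?U) - int (bt (Suc N) ?A) + int (k (Suc N)) + int (k N)"
          using mvd(3)[of N] by (simp add: k_def)
        show ?case unfolding sum.atMost_Suc eq Suc by (simp add: algebra_simps)
      qed
      have "k DIM('a) = 0" using kA[of "DIM('a)"] A(2) IHL3[of "DIM('a)"] by simp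
      then have "(\<Sum>p\<le>DIM('a). (-1) ^ p * int (bt p ?S)) =
          (\<Sum>T\<in>?K' - {{}}. (-1) ^ nat (aff_dim T)) - (\<Sum>T\<in>?L - {{}}. (-1) ^ nat (aff_dim T)) + 1"
        using pre[of "DIM('a)"] U(2) A(2) IHK4 IHL4 by simp
      \<comment> \<open>All nonempty faces of \<open>s\<close> count 1 in total, so the proper ones
        count 1 minus the sign of \<open>s\<close>; subtracting them restores the contribution of
        \<open>s\<close>.\<close>
      moreover have "(\<Sum>T\<in>?L - {{}}. (-1::int) ^ nat (aff_dim T)) = 1 - (-1) ^ nat (aff_dim s)"
      proof -
        obtain n where "n simplex s" using simplicial_complexD(2)[OF K s(1)] by blast
        from simplex_face_sum[OF this s(2)]
        have 1: "(\<Sum>F\<in>{F. F face_of s \<and> F \<noteq> {}}. (-1::int) ^ nat (aff_dim F)) = 1" .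
        have "{F. F face_of s \<and> F \<noteq> {}} = insert s (?L - {{}})"
          using s(2) face_of_refl[OF cell(1)] by auto
        moreover have "finite (?L - {{}})" using finK L(2) finite_subset by blast
        ultimately show ?thesis using 1 by simp
      qed
      moreover have "(\<Sum>T\<in>K - {{}}. (-1::int) ^ nat (aff_dim T)) = (-1) ^ nat (aff_dim s) + (\<Sum>T\<in>?K' - {{}}. (-1) ^ nat (aff_dim T))"
      proof -
        have "K - {{}} - {s} = ?K' - {{}}" by auto
        then show ?thesis using sum.remove[of "K - {{}}" s "\<lambda>T. (-1::int) ^ nat (aff_dim T)"] finK s by simp
      qed
      ultimately show ?thesis by simp
    qed
    ultimately show ?thesis using mvd(1) by blast
  qed
qed

end

section \<open>Sublevel sets in terms of cells and vertices\<close>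

lemma complex_cell_hull:
  fixes K :: "(real ^ 'n) set set"
  assumes K: "simplicial_complex K" and s: "s \<in> K"
  shows "s = convex hull {x \<in> vertices K. x \<in> s}"
proof -
  obtain n where "n simplex s" using simplicial_complexD(2)[OF K s] by blast
  then obtain C where C: "\<not> affine_dependent C" "s = convex hull C" by (auto simp: simplex_def)
  have "C \<subseteq> vertices K"
  proof
    fix c assume "c \<in> C"
    then have "{c} face_of s"
      unfolding face_of_singleton C(2) extreme_point_of_convex_hull_affine_independent[OF C(1)] .
    from simplicial_complexD(3)[OF K s this] show "c \<in> vertices K" by (simp add: vertices_def)
  qed
  then have "C \<subseteq> {x \<in> vertices K. x \<in> s}" using hull_subset[of C convex] unfolding C(2) by auto
  then have "s \<subseteq> convex hull {x \<in> vertices K. x \<in> s}" unfolding C(2) by (rule hull_mono)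
  moreover have "convex hull {x \<in> vertices K. x \<in> s} \<subseteq> s"
    using simplicial_complex_cell(1)[OF K s] by (intro hull_minimal) auto
  ultimately show ?thesis by blast
qed

lemma lower_cells_eq_vertices:
  fixes K :: "(real ^ 'n) set set"
  assumes K: "simplicial_complex K"
  shows "lower_cells K v t = {s \<in> K. \<forall>x\<in>vertices K. x \<in> s \<longrightarrow> v \<bullet> x \<le> t}"
proof -
  have "s \<subseteq> {y. y \<bullet> v \<le> t} \<longleftrightarrow> (\<forall>x\<in>vertices K. x \<in> s \<longrightarrow> v \<bullet> x \<le> t)" if s: "s \<in> K" for s
  proof
    assume "\<forall>x\<in>vertices K. x \<in> s \<longrightarrow> v \<bullet> x \<le> t"
    then have "{x \<in> vertices K. x \<in> s} \<subseteq> {y. y \<bullet> v \<le> t}" by (auto simp: inner_commute)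
    then have "convex hull {x \<in> vertices K. x \<in> s} \<subseteq> {y. y \<bullet> v \<le> t}"
    proof (rule hull_minimal)
      show "convex {y. y \<bullet> v \<le> t}" using convex_halfspace_le[of v t] by (simp add: inner_commute)
    qed
    then show "s \<subseteq> {y. y \<bullet> v \<le> t}" using complex_cell_hull[OF K s] by metis
  qed (auto simp: inner_commute)
  then show ?thesis unfolding lower_cells_def by blast
qed

lemma lower_cells_cong:
  fixes K :: "(real ^ 'n) set set"
  assumes K: "simplicial_complex K" and ab: "a \<le> b" and gap: "\<And>x. x \<in> vertices K \<Longrightarrow> \<not> (a < v \<bullet> x \<and> v \<bullet> x \<le> b)"
  shows "lower_cells K v a = lower_cells K v b"
proof -
  have "v \<bullet> x \<le> a \<longleftrightarrow> v \<bullet> x \<le> b" if "x \<in> vertices K" for x using gap[OF that] ab by linarith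
  then show ?thesis unfolding lower_cells_eq_vertices[OF K] by auto
qed

lemma finite_vertices: "simplicial_complex K \<Longrightarrow> finite (vertices K)"
proof -
  assume "simplicial_complex K"
  then have "finite K" by (rule simplicial_complexD(1))
  then have "finite ((\<lambda>x. {x}) -` K)" by (rule finite_vimageI) simp
  then show ?thesis by (simp add: vertices_def vimage_def)
qed

abbreviation lev :: "(real ^ 'n) set \<Rightarrow> real ^ 'n \<Rightarrow> real \<Rightarrow> (real ^ 'n) set" where
  "lev S v t \<equiv> {y \<in> S. y \<bullet> v \<le> t}"

text \<open>The empty face is removed explicitly: its affine dimension -1 becomes 0 under
  \<open>nat\<close>, so it would count as 1.\<close>

definition cell_count :: "(real ^ 'n) set set \<Rightarrow> real ^ 'n \<Rightarrow> real \<Rightarrow> int" where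
  "cell_count K v t = (\<Sum>s\<in>lower_cells K v t - {{}}. (-1) ^ nat (aff_dim s))"

context coeff_field
begin

context
  fixes K :: "(real ^ 'n) set set"
  assumes K: "simplicial_complex K"
begin

lemma lev_homology:
  "hfin p (lev (\<Union>K) v t)" "p \<ge> CARD('n) \<Longrightarrow> bt p (lev (\<Union>K) v t) = 0"
  "(\<Sum>p<CARD('n). (-1) ^ p * int (bt p (lev (\<Union>K) v t))) = cell_count K v t"
proof -
  note ch = complex_homology[OF simplicial_complex_lower_cells[OF K, of v t]]
  have 1: "hfin p (\<Union>(lower_cells K v t))" for p using ch by blast
  note h = heq_bt[OF heq_lower_cells[OF K] 1]
  show "hfin p (lev (\<Union>K) v t)" by (rule h)
  show 2: "bt p (lev (\<Union>K) v t) = 0" if "p \<ge> CARD('n)" for p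
    using ch h(2)[of p] that by simp
  have "(\<Sum>p\<le>DIM(real ^ 'n). (-1) ^ p * int (bt p (lev (\<Union>K) v t))) = cell_count K v t"
    unfolding h(2) cell_count_def using ch by blast
  then have "(\<Sum>p\<le>CARD('n). (-1) ^ p * int (bt p (lev (\<Union>K) v t))) = cell_count K v t" by simp
  then show "(\<Sum>p<CARD('n). (-1) ^ p * int (bt p (lev (\<Union>K) v t))) = cell_count K v t"
    using 2[of "CARD('n)"] by (simp add: lessThan_Suc_atMost[symmetric])
qed

lemma ECT_eq: "ECT F (\<Union>K) v t = cell_count K v t"
proof -
  let ?b = "\<lambda>p. bt p (lev (\<Union>K) v t)"
  have "p < CARD('n)" if "?b p \<noteq> 0" for p
  proof (rule ccontr)
    assume "\<not> p < CARD('n)"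
    then have "CARD('n) \<le> p" by simp
    from lev_homology(2)[OF this, of v t] that show False by blast
  qed
  then have "{p. ?b p \<noteq> 0} \<subseteq> {..<CARD('n)}" by (simp add: subset_iff)
  then have "(\<Sum>p\<in>{p. ?b p \<noteq> 0}. (-1) ^ p * int (?b p)) = (\<Sum>p<CARD('n). (-1) ^ p * int (?b p))"
    by (intro sum.mono_neutral_left) auto
  then show ?thesis unfolding ECT_def euler_char_def sublevel_def lev_homology(3)[symmetric] by simp
qed

text \<open>The interval is open at \<open>a\<close> and closed at \<open>b\<close> because a
  sublevel set includes its own level. Both sublevel sets then have the homology of the same
  subcomplex.\<close>

lemma heq_lev:
  assumes "a \<le> b" "\<And>x. x \<in> vertices K \<Longrightarrow> \<not> (a < v \<bullet> x \<and> v \<bullet> x \<le> b)"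
  shows "heq p (lev (\<Union>K) v a) (lev (\<Union>K) v b)"
proof (rule heq_cancel_left)
  show "heq p (\<Union>(lower_cells K v a)) (lev (\<Union>K) v a)" by (rule heq_lower_cells[OF K])
  have "lower_cells K v a = lower_cells K v b" by (rule lower_cells_cong[OF K assms])
  then show "heq p (\<Union>(lower_cells K v a)) (lev (\<Union>K) v b)" using heq_lower_cells[OF K, of p v b] by simp
next
  show "lev (\<Union>K) v a \<subseteq> lev (\<Union>K) v b" using assms(1) by auto
qed

lemma vertex_gap:
  assumes "\<And>x. x \<in> vertices K \<Longrightarrow> v \<bullet> x \<noteq> t"
  shows "\<exists>l u. l < t \<and> t < u \<and> (\<forall>x\<in>vertices K. \<not> (l < v \<bullet> x \<and> v \<bullet> x < u))"
proof -
  have "finite ((\<lambda>x. v \<bullet> x) ` vertices K)" using finite_vertices[OF K] by simp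
  then obtain d where d: "d > 0" "\<And>z. z \<in> (\<lambda>x. v \<bullet> x) ` vertices K \<Longrightarrow> z \<noteq> t \<Longrightarrow> d \<le> dist t z"
    using finite_set_avoid[of "(\<lambda>x. v \<bullet> x) ` vertices K" t] by blast
  show ?thesis
  proof (rule exI[of _ "t - d"], rule exI[of _ "t + d"], intro conjI ballI)
    fix x assume x: "x \<in> vertices K"
    have "d \<le> dist t (v \<bullet> x)" by (rule d(2)) (use x assms[OF x] in auto)
    then show "\<not> (t - d < v \<bullet> x \<and> v \<bullet> x < t + d)" by (auto simp: dist_real_def)
  qed (use d in auto)
qed

lemma euler_critical_vertex:
  assumes "euler_critical F (\<Union>K) v t"
  shows "\<exists>x\<in>vertices K. v \<bullet> x = t"
proof (rule ccontr)
  assume "\<not> ?thesis"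
  then have "\<And>x. x \<in> vertices K \<Longrightarrow> v \<bullet> x \<noteq> t" by blast
  then obtain l u where lu: "l < t" "t < u" "\<And>x. x \<in> vertices K \<Longrightarrow> \<not> (l < v \<bullet> x \<and> v \<bullet> x < u)"
    using vertex_gap[of v t] by metis
  have "ECT F (\<Union>K) v a = ECT F (\<Union>K) v t" if "a \<in> {l<..<u}" for a
  proof -
    have "lower_cells K v (min a t) = lower_cells K v (max a t)"
      by (rule lower_cells_cong[OF K]) (use lu that in \<open>force+\<close>)
    then show ?thesis unfolding ECT_eq cell_count_def by (cases "a \<le> t") (auto simp: min_def max_def)
  qed
  then have "ECT F (\<Union>K) v constant_on {l<..<u}" unfolding constant_on_def by blast
  then show False using assms lu(1,2) unfolding euler_critical_def by blast
qed

lemma homology_critical_vertex: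
  assumes "homology_critical F (\<Union>K) v t"
  shows "\<exists>x\<in>vertices K. v \<bullet> x = t"
proof (rule ccontr)
  assume "\<not> ?thesis"
  then have "\<And>x. x \<in> vertices K \<Longrightarrow> v \<bullet> x \<noteq> t" by blast
  then obtain l u where lu: "l < t" "t < u" "\<And>x. x \<in> vertices K \<Longrightarrow> \<not> (l < v \<bullet> x \<and> v \<bullet> x < u)"
    using vertex_gap[of v t] by metis
  have "inclusion_iso F p (sublevel (\<Union>K) v a) (sublevel (\<Union>K) v b)" if ab: "l < a" "a < b" "b < u" for a b p
  proof -
    have "heq p (lev (\<Union>K) v a) (lev (\<Union>K) v b)"
      by (rule heq_lev) (use ab lu(3) in force)+
    moreover have "lev (\<Union>K) v a \<subseteq> lev (\<Union>K) v b" using ab by auto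
    ultimately show ?thesis unfolding sublevel_def by (simp add: inclusion_iso_iff_heq)
  qed
  then show False using assms lu(1,2) unfolding homology_critical_def homology_regular_def by blast
qed

end
end

section \<open>Persistence diagrams\<close>

lemma filter_mset_eq_self: "(\<And>x. x \<in># M \<Longrightarrow> P x) \<Longrightarrow> filter_mset P M = M"
  by (simp add: filter_mset_eq_conv)

lemma filter_replicate_mset: "filter_mset P (replicate_mset n x) = (if P x then replicate_mset n x else {#})"
  by (induction n) auto

text \<open>The drop of \<open>f\<close> at a point \<open>u\<close> of \<open>T\<close> is the
  multiplicity of the value \<open>u\<close>; what remains after the last point of \<open>T\<close>
  is the multiplicity of \<infinity>.\<close>

lemma step_function_multiset:
  fixes f :: "real \<Rightarrow> nat"
  assumes "finite T" and "\<And>t t'. a \<le> t \<Longrightarrow> t \<le> t' \<Longrightarrow> f t' \<le> f t"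
    and "\<And>t t'. a \<le> t \<Longrightarrow> t \<le> t' \<Longrightarrow> T \<inter> {t<..t'} = {} \<Longrightarrow> f t' = f t"
  shows "\<exists>E. (\<forall>e\<in>#E. ereal a < e) \<and> (\<forall>t\<ge>a. size {#e \<in># E. ereal t < e#} = f t)"
  using assms(2,3)
proof (induction "card (T \<inter> {a<..})" arbitrary: a rule: less_induct)
  case less
  have fin: "finite (T \<inter> {a<..})" using assms(1) by simp
  show ?case
  proof (cases "T \<inter> {a<..} = {}")
    case True
    have fa: "f t = f a" if "a \<le> t" for t
      by (rule less.prems(2)) (use True that in auto)
    let ?E = "replicate_mset (f a) (\<infinity>::ereal)"
    have "size {#e \<in># ?E. ereal t < e#} = f t" if "a \<le> t" for t
      unfolding fa[OF that] by (simp add: filter_replicate_mset)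
    moreover have "\<forall>e\<in>#?E. ereal a < e" by (auto simp: in_replicate_mset)
    ultimately show ?thesis by blast
  next
    case False
    define u where "u = Min (T \<inter> {a<..})"
    have u: "u \<in> T" "a < u" using Min_in[OF fin False] by (auto simp: u_def)
    have min: "u \<le> x" if "x \<in> T" "a < x" for x using Min_le[OF fin] that by (simp add: u_def)
    have "card (T \<inter> {u<..}) < card (T \<inter> {a<..})" by (rule psubset_card_mono[OF fin]) (use u in auto)
    then have "\<exists>E. (\<forall>e\<in>#E. ereal u < e) \<and> (\<forall>t\<ge>u. size {#e \<in># E. ereal t < e#} = f t)"
    proof (rule less.hyps)
      show "f t' \<le> f t" if "u \<le> t" "t \<le> t'" for t t' by (rule less.prems(1)) (use that u in auto)
      show "f t' = f t" if "u \<le> t" "t \<le> t'" "T \<inter> {t<..t'} = {}" for t t'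
        by (rule less.prems(2)) (use that u in auto)
    qed
    then obtain E where E: "\<forall>e\<in>#E. ereal u < e" "\<forall>t\<ge>u. size {#e \<in># E. ereal t < e#} = f t" by blast
    have le: "f u \<le> f a" using less.prems(1)[of a u] u by simp
    have "size {#e \<in># E + replicate_mset (f a - f u) (ereal u). ereal t < e#} = f t" if t: "a \<le> t" for t
    proof (cases "u \<le> t")
      case True
      then show ?thesis using E(2)[rule_format, of t] by (simp add: filter_replicate_mset)
    next
      case False
      have "ereal t < e" if "e \<in># E" for e
        by (rule less_trans[of _ "ereal u"]) (use E(1) that False in auto)
      then have "{#e \<in># E. ereal t < e#} = E" "{#e \<in># E. ereal u < e#} = E"
        using E(1) by (auto intro!: filter_mset_eq_self)
      moreover have "size {#e \<in># E. ereal u < e#} = f u" using E(2)[rule_format, of u] by simp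
      moreover have "f t = f a" by (rule less.prems(2)) (use t False min in force)+
      ultimately show ?thesis using False le by (simp add: filter_replicate_mset)
    qed
    moreover have "\<forall>e\<in>#E + replicate_mset (f a - f u) (ereal u). ereal a < e"
      using E(1) u(2) by (auto simp: in_replicate_mset intro: less_trans[of "ereal a" "ereal u"])
    ultimately show ?thesis by blast
  qed
qed

text \<open>Points are produced one birth value at a time. For the largest birth value
  \<open>\<beta>\<close> and \<open>m\<close> slightly below it, \<open>r \<beta> t - r m t\<close>
  counts what is born at \<open>\<beta>\<close> and still alive at \<open>t\<close>. By
  \<open>exch\<close> this number does not increase with \<open>t\<close>, so its drops are the
  deaths.\<close>

lemma persistence_multiset_exists:
  fixes r :: "real \<Rightarrow> real \<Rightarrow> nat"
  assumes T: "finite T" and B: "finite B"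
    and birth: "\<And>s s' t. s \<le> s' \<Longrightarrow> s' \<le> t \<Longrightarrow> B \<inter> {s<..s'} = {} \<Longrightarrow> r s t = r s' t"
    and birth_mono: "\<And>s s' t. s \<le> s' \<Longrightarrow> s' \<le> t \<Longrightarrow> r s t \<le> r s' t"
    and death: "\<And>s t t'. s \<le> t \<Longrightarrow> t \<le> t' \<Longrightarrow> T \<inter> {t<..t'} = {} \<Longrightarrow> r s t' = r s t"
    and exch: "\<And>s s' t t'. s \<le> s' \<Longrightarrow> s' \<le> t \<Longrightarrow> t \<le> t' \<Longrightarrow> r s t + r s' t' \<le> r s' t + r s t'"
    and zero: "\<And>s t. s \<le> t \<Longrightarrow> B \<inter> {..s} = {} \<Longrightarrow> r s t = 0"
  shows "\<exists>D. (\<forall>(b, e)\<in>set_mset D. b < e) \<and>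
    (\<forall>s t. s \<le> t \<longrightarrow> r s t = size {#(b, e) \<in># D. b \<le> ereal s \<and> ereal t < e#})"
  using B birth birth_mono death exch zero
proof (induction B arbitrary: r rule: finite_linorder_max_induct)
  case empty
  have "r s t = 0" if "s \<le> t" for s t by (rule empty.prems(5)) (use that in auto)
  then show ?case by (intro exI[of _ "{#}"]) simp
next
  case (insert \<beta> B)
  obtain m where m: "m < \<beta>" "\<forall>x\<in>B. x < m"
  proof (cases "B = {}")
    case True
    then show ?thesis using that[of "\<beta> - 1"] by simp
  next
    case False
    then have "Max B < \<beta>" using insert.hyps by simp
    then obtain m where "Max B < m" "m < \<beta>" using dense by blast
    then show ?thesis using that[of m] insert.hyps(1) False by simp
  qed
  note birth = insert.prems(1) and mono = insert.prems(2) and death = insert.prems(3)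
    and exch = insert.prems(4) and zero = insert.prems(5)
  \<comment> \<open>Capping the first argument at \<open>m\<close> discards the births at
    \<open>\<beta>\<close> and leaves a rank function for the smaller set of birth values.\<close>
  have "\<exists>D. (\<forall>(b, e)\<in>set_mset D. b < e) \<and>
    (\<forall>s t. s \<le> t \<longrightarrow> r (min s m) t = size {#(b, e) \<in># D. b \<le> ereal s \<and> ereal t < e#})"
  proof (rule insert.IH)
    fix s s' t assume s: "s \<le> s'" "s' \<le> (t::real)"
    show "r (min s m) t \<le> r (min s' m) t" by (rule mono) (use s in auto)
    assume B: "B \<inter> {s<..s'} = {}"
    show "r (min s m) t = r (min s' m) t"
    proof (rule birth)
      show "insert \<beta> B \<inter> {min s m<..min s' m} = {}" using B m s by force
    qed (use s in auto)
  next
    fix s t t' :: real assume "s \<le> t" "t \<le> t'" "T \<inter> {t<..t'} = {}"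
    then show "r (min s m) t' = r (min s m) t" by (intro death) auto
  next
    fix s s' t t' :: real assume "s \<le> s'" "s' \<le> t" "t \<le> t'"
    then show "r (min s m) t + r (min s' m) t' \<le> r (min s' m) t + r (min s m) t'" by (intro exch) auto
  next
    fix s t :: real assume "s \<le> t" "B \<inter> {..s} = {}"
    then show "r (min s m) t = 0" using m by (intro zero) auto
  qed
  then obtain D where D: "\<forall>(b, e)\<in>set_mset D. b < e"
    "\<And>s t. s \<le> t \<Longrightarrow> r (min s m) t = size {#(b, e) \<in># D. b \<le> ereal s \<and> ereal t < e#}" by blast
  have "\<exists>E. (\<forall>e\<in>#E. ereal \<beta> < e) \<and> (\<forall>t\<ge>\<beta>. size {#e \<in># E. ereal t < e#} = r \<beta> t - r m t)"
  proof (rule step_function_multiset[OF T])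
    fix t t' :: real assume t: "\<beta> \<le> t" "t \<le> t'"
    show "r \<beta> t' - r m t' \<le> r \<beta> t - r m t"
      using exch[of m \<beta> t t'] mono[of m \<beta> t] mono[of m \<beta> t'] m t by simp
    assume "T \<inter> {t<..t'} = {}"
    then show "r \<beta> t' - r m t' = r \<beta> t - r m t" using death[of \<beta> t t'] death[of m t t'] m t by simp
  qed
  then obtain E where E: "\<forall>e\<in>#E. ereal \<beta> < e" "\<And>t. \<beta> \<le> t \<Longrightarrow> size {#e \<in># E. ereal t < e#} = r \<beta> t - r m t"
    by blast
  let ?D = "D + image_mset (\<lambda>e. (ereal \<beta>, e)) E"
  have "r s t = size {#(b, e) \<in># ?D. b \<le> ereal s \<and> ereal t < e#}" if st: "s \<le> t" for s t
  proof (cases "\<beta> \<le> s")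
    case True
    have "insert \<beta> B \<inter> {\<beta><..s} = {}" using m by force
    then have "r \<beta> t = r s t" using birth[of \<beta> s t] True st by simp
    moreover have "r (min s m) t = r m t" using True m by (simp add: min_def)
    moreover have "r m t \<le> r \<beta> t" by (rule mono) (use m True st in auto)
    moreover have "size {#(b, e) \<in># image_mset (\<lambda>e. (ereal \<beta>, e)) E. b \<le> ereal s \<and> ereal t < e#} = r \<beta> t - r m t"
      using E(2)[of t] True st by (simp add: filter_mset_image_mset)
    ultimately show ?thesis using D(2)[OF st] by simp
  next
    case False
    have "insert \<beta> B \<inter> {min s m<..s} = {}" using m False by force
    then have "r (min s m) t = r s t" using birth[of "min s m" s t] st by simp
    then show ?thesis using D(2)[OF st] False by (simp add: filter_mset_image_mset)
  qed
  moreover have "\<forall>(b, e)\<in>set_mset ?D. b < e" using D(1) E(1) by auto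
  ultimately show ?case by blast
qed

lemma size_filter_mset_less:
  assumes "\<And>y. P y \<Longrightarrow> Q y" "x \<in># M" "Q x" "\<not> P x"
  shows "size (filter_mset P M) < size (filter_mset Q M)"
proof (rule mset_subset_size)
  have "filter_mset P M \<subseteq># filter_mset Q M" 
  proof -
    have "filter_mset P M = filter_mset P (filter_mset Q M)"
      unfolding filter_filter_mset by (rule filter_mset_cong0) (use assms(1) in blast)
    then show ?thesis by (metis multiset_filter_subset)
  qed
  moreover have "x \<in># filter_mset Q M" "x \<notin># filter_mset P M" using assms(2-4) by auto
  ultimately show "filter_mset P M \<subset># filter_mset Q M" by (metis subset_mset.le_less)
qed

lemma size_filter_mset_count:
  assumes "finite S" "set_mset D \<subseteq> S"
  shows "size {#x \<in># D. P x#} = (\<Sum>x\<in>{x \<in> S. P x}. count D x)"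
proof -
  have "size {#x \<in># D. P x#} = sum (count {#x \<in># D. P x#}) (set_mset {#x \<in># D. P x#})"
    by (rule size_multiset_overloaded_eq)
  also have "\<dots> = sum (count D) (set_mset {#x \<in># D. P x#})" by (rule sum.cong) auto
  also have "\<dots> = sum (count D) {x \<in> S. P x}"
  proof (rule sum.mono_neutral_left)
    show "\<forall>x\<in>{x \<in> S. P x} - set_mset {#x \<in># D. P x#}. count D x = 0" by (auto simp: count_eq_zero_iff)
  qed (use assms in auto)
  finally show ?thesis .
qed

text \<open>Among the points with different multiplicities take the least birth \<open>b\<close>
  and, for it, the greatest death \<open>e\<close>. A quadrant whose corner has \<open>s\<close>
  slightly above \<open>b\<close> and \<open>t\<close> slightly below \<open>e\<close> contains no
  other such point, so the counts over it differ.\<close>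

lemma persistence_multiset_unique:
  fixes D D' :: "(ereal \<times> ereal) multiset"
  assumes D: "\<forall>(b, e)\<in>set_mset D. b < e" "\<forall>(b, e)\<in>set_mset D'. b < e"
    and eq: "\<And>s t. s \<le> t \<Longrightarrow> size {#(b, e) \<in># D. b \<le> ereal s \<and> ereal t < e#} =
      size {#(b, e) \<in># D'. b \<le> ereal s \<and> ereal t < e#}"
  shows "D = D'"
proof (rule ccontr)
  assume ne: "D \<noteq> D'"
  define S where "S = set_mset D \<union> set_mset D'"
  have finS: "finite S" by (simp add: S_def)
  define X where "X = {x \<in> S. count D x \<noteq> count D' x}"
  have X: "finite X" "X \<noteq> {}"
  proof -
    show "finite X" using finS by (simp add: X_def)
    obtain x where x: "count D x \<noteq> count D' x" using ne by (auto simp: multiset_eq_iff)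
    then have "x \<in> S" by (auto simp: S_def not_in_iff intro: ccontr)
    then have "x \<in> X" using x by (simp add: X_def)
    then show "X \<noteq> {}" by blast
  qed
  define b where "b = Min (fst ` X)"
  have b: "b \<in> fst ` X" "\<And>x. x \<in> X \<Longrightarrow> b \<le> fst x" using X by (auto simp: b_def)
  define Y where "Y = snd ` {x \<in> X. fst x = b}"
  define e where "e = Max Y"
  have Y: "finite Y" "Y \<noteq> {}" using X b(1) by (auto simp: Y_def)
  have "e \<in> Y" unfolding e_def by (rule Max_in[OF Y])
  then have be: "(b, e) \<in> X" by (auto simp: Y_def)
  have emax: "e' \<le> e" if "(b, e') \<in> X" for e'
  proof -
    have "e' \<in> Y" using that by (force simp: Y_def)
    then show ?thesis unfolding e_def by (rule Max_ge[OF Y(1)])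
  qed
  have lt: "b < e" using be D by (auto simp: X_def S_def)
  \<comment> \<open>Bounding \<open>s\<close> by the next births and by \<open>e\<close> excludes
    further birth values and leaves room for \<open>t\<close>. The corner must be real, although
    \<open>b\<close> may be -\<infinity> and \<open>e\<close> may be \<infinity>.\<close>
  let ?G = "insert e {b' \<in> fst ` S. b < b'}"
  have "b < Min ?G" using lt finS by simp
  then obtain s where s: "b < ereal s" "ereal s < Min ?G" using ereal_dense2 by blast
  have s': "ereal s < e" "\<And>b'. b' \<in> fst ` S \<Longrightarrow> b < b' \<Longrightarrow> ereal s < b'"
    using s(2) finS by auto
  let ?H = "insert (ereal s) {e' \<in> snd ` S. e' < e}"
  have "Max ?H < e" using s' finS by simp
  then obtain t where t: "Max ?H < ereal t" "ereal t < e" using ereal_dense2 by blast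
  have t': "s < t" "\<And>e'. e' \<in> snd ` S \<Longrightarrow> e' < e \<Longrightarrow> e' < ereal t"
    using t(1) finS by auto
  let ?P = "\<lambda>x. fst x \<le> ereal s \<and> ereal t < snd x"
  let ?W = "{x \<in> S. ?P x}"
  have sz: "size {#x \<in># D. ?P x#} = sum (count D) ?W" "size {#x \<in># D'. ?P x#} = sum (count D') ?W"
    by (rule size_filter_mset_count[OF finS]; simp add: S_def)+
  have beW: "(b, e) \<in> ?W" using be s(1) t(2) by (auto simp: X_def)
  have finW: "finite ?W" using finS by simp
  have "count D x = count D' x" if x: "x \<in> ?W - {(b, e)}" for x
  proof (rule ccontr)
    assume "count D x \<noteq> count D' x"
    then have xX: "x \<in> X" using x by (auto simp: X_def)
    have "\<not> b < fst x" using s'(2)[of "fst x"] x by (auto simp: not_less[symmetric])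
    then have 1: "fst x = b" using b(2)[OF xX] by simp
    have "snd x \<le> e" using emax[of "snd x"] xX 1 by (metis prod.collapse)
    moreover have "\<not> snd x < e" using t'(2)[of "snd x"] x by auto
    ultimately have "x = (b, e)" using 1 by (metis prod.collapse order.not_eq_order_implies_strict)
    then show False using x by blast
  qed
  then have "sum (count D) (?W - {(b, e)}) = sum (count D') (?W - {(b, e)})" by (rule sum.cong[OF refl])
  moreover have "sum (count D) ?W = sum (count D') ?W"
    using eq[of s t] t'(1) sz by (simp add: case_prod_unfold)
  ultimately have "count D (b, e) = count D' (b, e)"
    using sum.remove[OF finW beW, of "count D"] sum.remove[OF finW beW, of "count D'"] by simp
  then show False using be by (simp add: X_def)
qed

section \<open>Persistence diagrams of height functions on complexes\<close>

context coeff_field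
begin

context
  fixes K :: "(real ^ 'n) set set"
  assumes K: "simplicial_complex K"
begin

lemma rank_lev:
  "s \<le> t \<Longrightarrow> inclusion_rank F p (sublevel S v s) (sublevel S v t) = qdim (cyc p (lev S v s)) (bnd p (lev S v t))"
  unfolding sublevel_def by (rule inclusion_rank_eq) auto

lemma lev_below_vertices:
  assumes "\<And>x. x \<in> vertices K \<Longrightarrow> \<not> v \<bullet> x \<le> s"
  shows "\<Union>(lower_cells K v s) = {}"
proof -
  have "\<sigma> = {}" if "\<sigma> \<in> lower_cells K v s" for \<sigma>
  proof -
    have \<sigma>: "\<sigma> \<in> K" "\<sigma> \<subseteq> {y. y \<bullet> v \<le> s}" using that by (auto simp: lower_cells_def)
    have "{x \<in> vertices K. x \<in> \<sigma>} = {}" using assms \<sigma>(2) by (force simp: inner_commute)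
    then show ?thesis using complex_cell_hull[OF K \<sigma>(1)] by (metis convex_hull_eq_empty)
  qed
  then show ?thesis by blast
qed

lemma qfin_lev:
  assumes "s \<le> t"
  shows "qfin (cyc p (lev (\<Union>K) v s)) (bnd p (lev (\<Union>K) v t))"
proof -
  have "qfin (cyc p (lev (\<Union>K) v s)) (bnd p (lev (\<Union>K) v s))" using lev_homology(1)[OF K, of p v s] unfolding hfin_def .
  then show ?thesis
    by (rule quot_exact(1)[OF csubspace_cycles csubspace_boundaries csubspace_boundaries bnd_mono,
          THEN iffD1, THEN conjunct1, rotated]) (use assms in auto)
qed

text \<open>Ranks change only at vertex heights, in either argument. The exchange inequality holds
  because the classes coming from level \<open>s\<close> that die between \<open>t\<close> and
  \<open>t'\<close> form a space growing with \<open>s\<close>. Existence and uniqueness then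
  justify the description operator in \<open>PH\<close>.\<close>

lemma PH_diagram: "is_persistence_diagram F p (\<Union>K) v (PH F p (\<Union>K) v)"
proof -
  let ?c = "\<lambda>s. cyc p (lev (\<Union>K) v s)" and ?b = "\<lambda>s. bnd p (lev (\<Union>K) v s)"
  let ?V = "(\<lambda>x. v \<bullet> x) ` vertices K"
  have fin: "finite ?V" using finite_vertices[OF K] by simp
  have lm: "lev (\<Union>K) v s \<subseteq> lev (\<Union>K) v t" if "s \<le> t" for s t using that by auto
  have heq: "heq p (lev (\<Union>K) v s) (lev (\<Union>K) v t)" if "s \<le> t" "?V \<inter> {s<..t} = {}" for s t
    by (rule heq_lev[OF K that(1)]) (use that(2) in force)
  \<comment> \<open>The last summand is the dimension of the space of classes that come from level
    \<open>s\<close>, taken at level \<open>t\<close>, and vanish at \<open>t'\<close>.\<close>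
  have split: "qdim (?c s) (?b t) = qdim (?c s) (?b t') + qdim (?c s \<inter> ?b t') (?b t)"
    "qfin (?c s \<inter> ?b t') (?b t)" if "s \<le> t" "t \<le> t'" for s t t'
  proof -
    have f: "qfin (?c s) (?b t)" by (rule qfin_lev[OF that(1)])
    have sub: "?b t \<subseteq> ?b t'" by (rule bnd_mono[OF lm[OF that(2)]])
    show "qdim (?c s) (?b t) = qdim (?c s) (?b t') + qdim (?c s \<inter> ?b t') (?b t)"
      by (rule quot_exact(2)[OF csubspace_cycles csubspace_boundaries csubspace_boundaries sub f])
    show "qfin (?c s \<inter> ?b t') (?b t)"
      by (rule quot_exact(1)[OF csubspace_cycles csubspace_boundaries csubspace_boundaries sub, THEN iffD1, OF f,
            THEN conjunct2])
  qed
  have "\<exists>D. (\<forall>(b, e)\<in>set_mset D. b < e) \<and>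
    (\<forall>s t. s \<le> t \<longrightarrow> qdim (?c s) (?b t) = size {#(b, e) \<in># D. b \<le> ereal s \<and> ereal t < e#})"
  proof (rule persistence_multiset_exists[OF fin fin])
    show "qdim (?c s) (?b t) = qdim (?c s') (?b t)" if "s \<le> s'" "s' \<le> t" "?V \<inter> {s<..s'} = {}" for s s' t
      by (rule heq_qdim_left(1)[OF heq[OF that(1,3)] lm[OF that(2)], symmetric])
    show "qdim (?c s) (?b t) \<le> qdim (?c s') (?b t)" if "s \<le> s'" "s' \<le> t" for s s' t
      by (rule qdim_mono(2)[OF csubspace_cycles csubspace_cycles csubspace_boundaries cyc_mono[OF lm[OF that(1)]]
            qfin_lev[OF that(2)]])
    show "qdim (?c s) (?b t') = qdim (?c s) (?b t)" if "s \<le> t" "t \<le> t'" "?V \<inter> {t<..t'} = {}" for s t t'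
      by (rule heq_qdim_right(2)[OF heq[OF that(2,3)] lm[OF that(1)] qfin_lev[OF that(1)], symmetric])
    show "qdim (?c s) (?b t) + qdim (?c s') (?b t') \<le> qdim (?c s') (?b t) + qdim (?c s) (?b t')"
      if "s \<le> s'" "s' \<le> t" "t \<le> t'" for s s' t t'
    proof -
      have "?c s \<inter> ?b t' \<subseteq> ?c s' \<inter> ?b t'" using cyc_mono[OF lm[OF that(1)], of p] by blast
      from qdim_mono(2)[OF csubspace_Int[OF csubspace_cycles csubspace_boundaries]
          csubspace_Int[OF csubspace_cycles csubspace_boundaries] csubspace_boundaries this split(2)[OF that(2,3)]]
      have "qdim (?c s \<inter> ?b t') (?b t) \<le> qdim (?c s' \<inter> ?b t') (?b t)" .
      then show ?thesis using split(1)[of s t t'] split(1)[of s' t t'] that by simp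
    qed
    show "qdim (?c s) (?b t) = 0" if "s \<le> t" "?V \<inter> {..s} = {}" for s t
    proof -
      have e: "\<Union>(lower_cells K v s) = {}" by (rule lev_below_vertices) (use that(2) in auto)
      have "heq p {} (lev (\<Union>K) v s)" using heq_lower_cells[OF K, of p v s] unfolding e .
      from heq_qdim_left(1)[OF this lm[OF that(1)]]
      have "qdim (?c s) (?b t) = qdim (cyc p {}) (?b t)" .
      moreover have "qdim (cyc p {}) (?b t) = 0"
      proof (rule qdim_trivial(2)[OF csubspace_cycles csubspace_boundaries])
        show "cyc p {} \<subseteq> ?b t"
        proof
          fix c :: "('f, real ^ 'n) field_chain" assume "c \<in> cyc p {}"
          from cyc_fchains[OF this] have "c = czero" unfolding Ch_empty by simp
          then show "c \<in> ?b t" using bndD(2) by simp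
        qed
      qed
      ultimately show ?thesis by simp
    qed
  qed
  then obtain D where D: "\<forall>(b, e)\<in>set_mset D. b < e"
    "\<And>s t. s \<le> t \<Longrightarrow> qdim (?c s) (?b t) = size {#(b, e) \<in># D. b \<le> ereal s \<and> ereal t < e#}" by blast
  have iff: "is_persistence_diagram F p (\<Union>K) v D' \<longleftrightarrow> (\<forall>(b, e)\<in>set_mset D'. b < e) \<and>
    (\<forall>s t. s \<le> t \<longrightarrow> qdim (?c s) (?b t) = size {#(b, e) \<in># D'. b \<le> ereal s \<and> ereal t < e#})" for D'
    unfolding is_persistence_diagram_def by (simp add: rank_lev cong: imp_cong)
  show ?thesis
    unfolding PH_def
  proof (rule theI)
    show "is_persistence_diagram F p (\<Union>K) v D" unfolding iff using D by blast
    fix D' assume "is_persistence_diagram F p (\<Union>K) v D'"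
    then have D': "\<forall>(b, e)\<in>set_mset D'. b < e"
      "\<And>s t. s \<le> t \<Longrightarrow> qdim (?c s) (?b t) = size {#(b, e) \<in># D'. b \<le> ereal s \<and> ereal t < e#}"
      unfolding iff by blast+
    show "D' = D"
      by (rule persistence_multiset_unique[OF D'(1) D(1)]) (simp only: D'(2)[symmetric] D(2)[symmetric])
  qed
qed

lemma PH_rank:
  assumes "s \<le> t"
  shows "qdim (cyc p (lev (\<Union>K) v s)) (bnd p (lev (\<Union>K) v t)) =
    size {#(b, e) \<in># PH F p (\<Union>K) v. b \<le> ereal s \<and> ereal t < e#}"
  using PH_diagram[of p v] assms unfolding is_persistence_diagram_def rank_lev[OF assms, symmetric] by blast

lemma PH_less: "(b, e) \<in># PH F p (\<Union>K) v \<Longrightarrow> b < e"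
  using PH_diagram[of p v] unfolding is_persistence_diagram_def by blast

text \<open>A point with coordinate \<open>c\<close> makes two ranks differ, one taken at level
  \<open>c\<close> and one at a level \<open>a\<close> slightly below, whereas regularity makes the
  inclusion of these levels an isomorphism. Levels below \<open>c\<close> are the right ones to
  compare with, since a closed sublevel set changes on reaching \<open>c\<close>.\<close>

lemma PH_value_critical:
  assumes be: "(b, e) \<in># PH F p (\<Union>K) v" and c: "b = ereal c \<or> e = ereal c"
  shows "homology_critical F (\<Union>K) v c"
  unfolding homology_critical_def
proof
  assume "homology_regular F (\<Union>K) v c"
  then obtain l u where lu: "l < c" "c < u"
    "\<And>a b. l < a \<Longrightarrow> a < b \<Longrightarrow> b < u \<Longrightarrow> inclusion_iso F p (sublevel (\<Union>K) v a) (sublevel (\<Union>K) v b)"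
    unfolding homology_regular_def by blast
  have heq: "heq p (lev (\<Union>K) v a) (lev (\<Union>K) v c)" if a: "l < a" "a < c" for a
  proof -
    have "lev (\<Union>K) v a \<subseteq> lev (\<Union>K) v c" using a by auto
    from inclusion_iso_iff_heq[OF this] show ?thesis using lu(3)[OF a lu(2)] unfolding sublevel_def by blast
  qed
  have less: "b < e" by (rule PH_less[OF be])
  let ?D = "PH F p (\<Union>K) v"
  show False
  proof (cases "b = ereal c")
    case True
    obtain a where a: "l < a" "a < c" using dense[OF lu(1)] by blast
    have "qdim (cyc p (lev (\<Union>K) v c)) (bnd p (lev (\<Union>K) v c)) = qdim (cyc p (lev (\<Union>K) v a)) (bnd p (lev (\<Union>K) v c))"
      by (rule heq_qdim_left(1)[OF heq[OF a]]) simp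
    then have "size {#(b, e) \<in># ?D. b \<le> ereal c \<and> ereal c < e#} = size {#(b, e) \<in># ?D. b \<le> ereal a \<and> ereal c < e#}"
      using PH_rank[of c c p v] PH_rank[of a c p v] a by simp
    moreover have "size {#(b, e) \<in># ?D. b \<le> ereal a \<and> ereal c < e#} < size {#(b, e) \<in># ?D. b \<le> ereal c \<and> ereal c < e#}"
      by (rule size_filter_mset_less[OF _ be])
        (use a True less in \<open>auto intro: order_trans[of _ "ereal a" "ereal c"]\<close>)
    ultimately show False by simp
  next
    case False
    then have e: "e = ereal c" using c by blast
    \<comment> \<open>Besides lying in the regular interval, \<open>a\<close> must not precede the
      birth, so that the point is alive at \<open>a\<close> and dead at \<open>c\<close>.\<close>
    have "max b (ereal l) < ereal c" using less e lu(1) by simp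
    then obtain a where a: "max b (ereal l) < ereal a" "ereal a < ereal c" using ereal_dense2 by blast
    then have a': "l < a" "a < c" "b \<le> ereal a" by auto
    have "qdim (cyc p (lev (\<Union>K) v a)) (bnd p (lev (\<Union>K) v a)) = qdim (cyc p (lev (\<Union>K) v a)) (bnd p (lev (\<Union>K) v c))"
      by (rule heq_qdim_right(2)[OF heq[OF a'(1,2)] subset_refl qfin_lev]) simp
    then have "size {#(b, e) \<in># ?D. b \<le> ereal a \<and> ereal a < e#} = size {#(b, e) \<in># ?D. b \<le> ereal a \<and> ereal c < e#}"
      using PH_rank[of a a p v] PH_rank[of a c p v] a' by simp
    moreover have "size {#(b, e) \<in># ?D. b \<le> ereal a \<and> ereal c < e#} < size {#(b, e) \<in># ?D. b \<le> ereal a \<and> ereal a < e#}"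
      by (rule size_filter_mset_less[OF _ be])
        (use a' e in \<open>auto intro: less_trans[of "ereal a" "ereal c"]\<close>)
    ultimately show False by simp
  qed
qed

lemma bt_lev_PH: "bt p (lev (\<Union>K) v t) = size {#(b, e) \<in># PH F p (\<Union>K) v. b \<le> ereal t \<and> ereal t < e#}"
  using PH_rank[of t t p v] by (simp add: betti_eq)

end

text \<open>The rank from a level to itself is a Betti number, and the degrees recorded by the
  transform are those whose alternating sum is \<open>cell_count\<close>.\<close>

lemma PHT_determines_cell_count:
  fixes K K' :: "(real ^ 'n) set set"
  assumes K: "simplicial_complex K" "simplicial_complex K'" and eq: "PHT F (\<Union>K) v = PHT F (\<Union>K') v"
  shows "cell_count K v t = cell_count K' v t"
proof -
  have "PH F p (\<Union>K) v = PH F p (\<Union>K') v" if "p < CARD('n)" for p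
    using eq that unfolding PHT_def by (simp add: list_eq_iff_nth_eq)
  then show ?thesis
    unfolding lev_homology(3)[OF K(1), symmetric] lev_homology(3)[OF K(2), symmetric]
      bt_lev_PH[OF K(1)] bt_lev_PH[OF K(2)] by simp
qed

end

section \<open>Recovering the shape from cell counts\<close>

text \<open>On sums of indicators of bounded open convex sets there is a well-defined functional counting every
  nonempty set once.  On the line it is \<open>f \<mapsto> \<Sum>\<^sub>t (f (t+) - f t)\<close>; in general one eliminates the coordinates
  one by one.\<close>

lemma open_intervals_sum_zero:
  fixes A :: "'i \<Rightarrow> real set" and c :: "'i \<Rightarrow> int"
  assumes I: "finite I" and A: "\<And>i. i \<in> I \<Longrightarrow> open (A i) \<and> convex (A i) \<and> bounded (A i)"
    and zero: "\<And>t. (\<Sum>i | i \<in> I \<and> t \<in> A i. c i) = 0"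
  shows "(\<Sum>i | i \<in> I \<and> A i \<noteq> {}. c i) = 0"
proof -
  define J where "J = {i \<in> I. A i \<noteq> {}}"
  have finJ: "finite J" using I by (simp add: J_def)
  define a where "a i = Inf (A i)" for i
  define b where "b i = Sup (A i)" for i
  have ab: "A i = {a i<..<b i}" "a i < b i" if "i \<in> J" for i
  proof -
    have i: "open (A i)" "convex (A i)" "bounded (A i)" "A i \<noteq> {}" using that A by (auto simp: J_def)
    have bd: "bdd_below (A i)" "bdd_above (A i)" by (rule bounded_imp_bdd_below[OF i(3)], rule bounded_imp_bdd_above[OF i(3)])
    show eq: "A i = {a i<..<b i}"
      unfolding a_def b_def
    proof (intro equalityI subsetI)
      fix x assume x: "x \<in> A i"
      obtain e where e: "e > 0" "ball x e \<subseteq> A i" using i(1)[unfolded open_contains_ball] x by blast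
      have "x - e / 2 \<in> A i" "x + e / 2 \<in> A i" using e by (auto simp: subset_iff dist_real_def)
      then show "x \<in> {Inf (A i)<..<Sup (A i)}"
        using cInf_lower[OF _ bd(1), of "x - e / 2"] cSup_upper[OF _ bd(2), of "x + e / 2"] e(1) by auto
    next
      fix x assume "x \<in> {Inf (A i)<..<Sup (A i)}"
      then obtain y z where yz: "y \<in> A i" "y < x" "z \<in> A i" "x < z"
        using cInf_less_iff[OF i(4) bd(1)] less_cSup_iff[OF i(4) bd(2)] by auto
      have "is_interval (A i)" using i(2) by (simp add: is_interval_convex_1)
      from this[unfolded is_interval_1, rule_format, OF yz(1,3), of x] show "x \<in> A i" using yz by simp
    qed
    show "a i < b i" using i(4) unfolding eq by auto
  qed
  have zero': "(\<Sum>i\<in>J. if a i < t \<and> t < b i then c i else 0) = 0" for t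
  proof -
    have "t \<in> A i \<longleftrightarrow> a i < t \<and> t < b i" if "i \<in> J" for i unfolding ab(1)[OF that] by simp
    moreover have "{i \<in> I. t \<in> A i} = {i \<in> J. t \<in> A i}" by (auto simp: J_def)
    ultimately have "{i \<in> I. t \<in> A i} = {i \<in> J. a i < t \<and> t < b i}" by (metis (mono_tags, lifting) Collect_cong)
    then show ?thesis using zero[of t] finJ by (simp add: sum.inter_filter)
  qed
  \<comment> \<open>Compare the sum at \<open>t\<close> with the one at a point \<open>s\<close>
    just to the right. The intervals being open, those ending at \<open>t\<close> are absent from
    both and those starting at \<open>t\<close> are the only new ones.\<close>
  have "(\<Sum>i\<in>J. if a i = t then c i else 0) = 0" for t
  proof -
    define d where "d = Min (insert (t + 1) {x \<in> a ` J \<union> b ` J. t < x})"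
    have fin: "finite (insert (t + 1) {x \<in> a ` J \<union> b ` J. t < x})" using finJ by simp
    have "t < d" unfolding d_def using fin by (subst Min_gr_iff) auto
    then obtain s where s: "t < s" "s < d" using dense by blast
    have gap: "s < x" if "x \<in> a ` J \<union> b ` J" "t < x" for x
      using Min_le[OF fin, of x] that s by (auto simp: d_def)
    have "(if a i < s \<and> s < b i then c i else 0) - (if a i < t \<and> t < b i then c i else 0) =
        (if a i = t then c i else 0)" if "i \<in> J" for i
      using gap[of "a i"] gap[of "b i"] ab(2)[OF that] s(1) that by (auto simp: not_less)
    then have "(\<Sum>i\<in>J. if a i = t then c i else 0) = (\<Sum>i\<in>J. (if a i < s \<and> s < b i then c i else 0) - (if a i < t \<and> t < b i then c i else 0))"
      by (intro sum.cong) simp_all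
    then show ?thesis by (simp add: sum_subtractf zero')
  qed
  then have "(\<Sum>t\<in>a ` J. sum c {i \<in> J. a i = t}) = 0" using finJ by (simp add: sum.inter_filter)
  moreover have "(\<Sum>t\<in>a ` J. sum c {i \<in> J. a i = t}) = sum c J" by (rule sum.group) (use finJ in auto)
  ultimately show ?thesis by (simp add: J_def)
qed

lemma open_convex_sum_zero:
  fixes C :: "'i \<Rightarrow> 'a::euclidean_space set" and c :: "'i \<Rightarrow> int"
  assumes I: "finite I" and C: "\<And>i. i \<in> I \<Longrightarrow> open (C i) \<and> convex (C i)"
    and bd: "\<And>i y b. i \<in> I \<Longrightarrow> y \<in> C i \<Longrightarrow> b \<in> Basis \<Longrightarrow> \<bar>y \<bullet> b\<bar> < 1"
    and zero: "\<And>y. (\<Sum>i | i \<in> I \<and> y \<in> C i. c i) = 0"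
  shows "(\<Sum>i | i \<in> I \<and> C i \<noteq> {}. c i) = 0"
proof -
  \<comment> \<open>The set \<open>C i\<close> swept out along the coordinates in \<open>E\<close>.
    Adding a coordinate replaces membership by nonemptiness of a line slice; for
    \<open>E = Basis\<close> the result is everything or empty.\<close>
  define S where "S E i = {y. \<exists>z\<in>C i. \<forall>b\<in>Basis - E. y \<bullet> b = z \<bullet> b}" for E i
  have S: "open (S E i) \<and> convex (S E i)" if "i \<in> I" for E i
  proof -
    let ?W = "{w::'a. \<forall>b\<in>Basis - E. w \<bullet> b = 0}"
    have eq: "S E i = (\<Union>x\<in>C i. \<Union>y\<in>?W. {x + y})"
    proof (intro equalityI subsetI)
      fix y assume "y \<in> S E i"
      then obtain z where z: "z \<in> C i" "\<forall>b\<in>Basis - E. y \<bullet> b = z \<bullet> b" by (auto simp: S_def)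
      then have "y - z \<in> ?W" "y = z + (y - z)" by (auto simp: inner_diff_left)
      then show "y \<in> (\<Union>x\<in>C i. \<Union>y\<in>?W. {x + y})" using z(1) by blast
    qed (auto simp: S_def inner_add_left)
    have "convex ?W" unfolding convex_def by (auto simp: inner_add_left)
    then show ?thesis unfolding eq using C[OF that] by (blast intro: open_sums convex_sums)
  qed
  have "(\<Sum>i | i \<in> I \<and> y \<in> S E i. c i) = 0" if "finite E" "E \<subseteq> Basis" for E y
    using that
  proof (induction E arbitrary: y rule: finite_induct)
    case empty
    have "S {} i = C i" for i unfolding S_def using euclidean_eqI by auto
    then show ?case using zero by simp
  next
    case (insert b E)
    let ?A = "\<lambda>i. {t::real. y + t *\<^sub>R b \<in> S E i}"
    have b: "b \<in> Basis" using insert.prems by blast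
    have yb: "(y + t *\<^sub>R b) \<bullet> b' = (if b' = b then y \<bullet> b + t else y \<bullet> b')" if "b' \<in> Basis" for t b'
      using that b by (simp add: inner_add_left inner_Basis)
    have "?A i \<noteq> {} \<longleftrightarrow> y \<in> S (insert b E) i" for i
    proof
      assume "?A i \<noteq> {}"
      then obtain t z where z: "z \<in> C i" "\<forall>b'\<in>Basis - E. (y + t *\<^sub>R b) \<bullet> b' = z \<bullet> b'" by (auto simp: S_def)
      have "y \<bullet> b' = z \<bullet> b'" if "b' \<in> Basis - insert b E" for b'
        using z(2)[rule_format, of b'] yb[of b' t] that by simp
      then show "y \<in> S (insert b E) i" using z(1) by (auto simp: S_def)
    next
      assume "y \<in> S (insert b E) i"
      then obtain z where z: "z \<in> C i" "\<forall>b'\<in>Basis - insert b E. y \<bullet> b' = z \<bullet> b'" by (auto simp: S_def)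
      have "(y + (z \<bullet> b - y \<bullet> b) *\<^sub>R b) \<bullet> b' = z \<bullet> b'" if "b' \<in> Basis - E" for b'
        using z(2)[rule_format, of b'] yb[of b' "z \<bullet> b - y \<bullet> b"] that by (cases "b' = b") auto
      then have "z \<bullet> b - y \<bullet> b \<in> ?A i" using z(1) by (auto simp: S_def)
      then show "?A i \<noteq> {}" by blast
    qed
    moreover have "(\<Sum>i | i \<in> I \<and> ?A i \<noteq> {}. c i) = 0"
    proof (rule open_intervals_sum_zero[OF I])
      fix i assume i: "i \<in> I"
      have "open ((\<lambda>t. y + t *\<^sub>R b) -` S E i)"
        using S[OF i, of E] by (intro open_vimage continuous_intros) auto
      moreover have "convex (?A i)"
      proof (rule convexI)
        fix s t u w :: real assume *: "s \<in> ?A i" "t \<in> ?A i" "0 \<le> u" "0 \<le> w" "u + w = 1"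
        have "u *\<^sub>R (y + s *\<^sub>R b) + w *\<^sub>R (y + t *\<^sub>R b) \<in> S E i"
          using S[OF i, of E] * by (auto intro: convexD)
        moreover have "u *\<^sub>R (y + s *\<^sub>R b) + w *\<^sub>R (y + t *\<^sub>R b) = (u + w) *\<^sub>R y + (u * s + w * t) *\<^sub>R b"
          by (simp add: algebra_simps)
        ultimately show "u *\<^sub>R s + w *\<^sub>R t \<in> ?A i" using *(5) by simp
      qed
      moreover have "bounded (?A i)"
      proof (rule boundedI)
        fix t assume "t \<in> ?A i"
        then obtain z where z: "z \<in> C i" "\<forall>b'\<in>Basis - E. (y + t *\<^sub>R b) \<bullet> b' = z \<bullet> b'" by (auto simp: S_def)
        \<comment> \<open>The coordinate \<open>b\<close> has not been swept out yet, so the bound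
          on \<open>C i\<close> bounds the slice.\<close>
        have "y \<bullet> b + t = z \<bullet> b" using z(2)[rule_format, of b] yb[OF b, of t] b insert.hyps by simp
        then show "norm t \<le> 1 + \<bar>y \<bullet> b\<bar>" using bd[OF i z(1) b] by simp
      qed
      ultimately show "open (?A i) \<and> convex (?A i) \<and> bounded (?A i)" by (simp add: vimage_def)
    next
      fix t
      show "(\<Sum>i | i \<in> I \<and> t \<in> ?A i. c i) = 0" using insert.IH[of "y + t *\<^sub>R b"] insert.prems by simp
    qed
    ultimately show ?case by simp
  qed
  from this[of Basis 0] have "(\<Sum>i | i \<in> I \<and> 0 \<in> S Basis i. c i) = 0" by simp
  moreover have "0 \<in> S Basis i \<longleftrightarrow> C i \<noteq> {}" for i by (auto simp: S_def)
  ultimately show ?thesis by simp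
qed

section \<open>From generic directions to all directions, and from cell counts to the shape\<close>

lemma lower_cells_order:
  fixes K :: "(real ^ 'n) set set"
  assumes K: "simplicial_complex K" and "\<And>x. x \<in> vertices K \<Longrightarrow> v \<bullet> x \<le> t \<longleftrightarrow> w \<bullet> x \<le> s"
  shows "lower_cells K v t = lower_cells K w s" "cell_count K v t = cell_count K w s"
proof -
  show "lower_cells K v t = lower_cells K w s"
    unfolding lower_cells_eq_vertices[OF K] using assms(2) by auto
  then show "cell_count K v t = cell_count K w s" unfolding cell_count_def by simp
qed

text \<open>The level \<open>s\<close> is put strictly between \<open>t\<close> and the next vertex
  height. All comparisons of vertex heights with \<open>s\<close> are then strict, so they persist
  for nearby directions and hence for some direction of \<open>G\<close>.\<close>

lemma cell_count_dense:
  fixes K K' :: "(real ^ 'n) set set"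
  assumes K: "simplicial_complex K" "simplicial_complex K'"
    and dense: "closure G = UNIV" and eq: "\<And>v t. v \<in> G \<Longrightarrow> cell_count K v t = cell_count K' v t"
  shows "cell_count K v t = cell_count K' v t"
proof -
  let ?X = "vertices K \<union> vertices K'"
  have fin: "finite ?X" using K by (simp add: finite_vertices)
  let ?A = "(\<lambda>x. v \<bullet> x) ` ?X"
  define d where "d = Min (insert (t + 1) {a \<in> ?A. t < a})"
  have finA: "finite (insert (t + 1) {a \<in> ?A. t < a})" using fin by simp
  have "t < d" unfolding d_def using finA by (subst Min_gr_iff) auto
  then obtain s where s: "t < s" "s < d" using dense_order_class.dense by blast
  have gap: "s < v \<bullet> x" if "x \<in> ?X" "t < v \<bullet> x" for x
    using Min_le[OF finA, of "v \<bullet> x"] that s by (auto simp: d_def)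
  define U where "U = (\<Inter>x\<in>?X. if v \<bullet> x \<le> t then {w. w \<bullet> x < s} else {w. w \<bullet> x > s})"
  have "open U" unfolding U_def
    by (intro open_INT fin) (simp add: open_Collect_less continuous_intros)
  moreover have "v \<in> U"
    unfolding U_def
  proof
    fix x assume x: "x \<in> ?X"
    show "v \<in> (if v \<bullet> x \<le> t then {w. w \<bullet> x < s} else {w. w \<bullet> x > s})"
      using gap[OF x] s(1) by (cases "v \<bullet> x \<le> t") simp_all
  qed
  ultimately have "U \<inter> G \<noteq> {}" using dense open_Int_closure_eq_empty[of U G] by blast
  then obtain w where w: "w \<in> U" "w \<in> G" by blast
  have "v \<bullet> x \<le> t \<longleftrightarrow> w \<bullet> x \<le> s" if "x \<in> ?X" for x
  proof -
    have "w \<in> (if v \<bullet> x \<le> t then {w. w \<bullet> x < s} else {w. w \<bullet> x > s})" using w(1) that unfolding U_def by blast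
    then show ?thesis by (cases "v \<bullet> x \<le> t") simp_all
  qed
  then show ?thesis
    using lower_cells_order(2)[OF K(1), of v t w s] lower_cells_order(2)[OF K(2), of v t w s] eq[OF w(2), of s] by simp
qed

lemma dense_generic:
  fixes Y :: "(real ^ 'n) set"
  assumes "finite Y" "0 \<notin> Y"
  shows "closure {v. \<forall>y\<in>Y. v \<bullet> y \<noteq> 0} = UNIV"
proof -
  have "interior (\<Union>y\<in>Y. {v. v \<bullet> y = 0}) = {}"
  proof -
    have "negligible (\<Union>y\<in>Y. {v. v \<bullet> y = 0})"
    proof (rule negligible_Union)
      show "finite ((\<lambda>y. {v. v \<bullet> y = 0}) ` Y)" using assms(1) by simp
      fix t assume "t \<in> (\<lambda>y. {v. v \<bullet> y = 0}) ` Y"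
      then obtain y where "y \<in> Y" "t = {v. y \<bullet> v = 0}" by (auto simp: inner_commute)
      then show "negligible t" using assms(2) negligible_hyperplane[of y 0] by auto
    qed
    then have "negligible (interior (\<Union>y\<in>Y. {v. v \<bullet> y = 0}))" using interior_subset negligible_subset by blast
    then show ?thesis using open_not_negligible[OF open_interior] by blast
  qed
  then have "closure (- (\<Union>y\<in>Y. {v. v \<bullet> y = 0})) = UNIV" unfolding closure_complement by simp
  moreover have "- (\<Union>y\<in>Y. {v. v \<bullet> y = 0}) = {v. \<forall>y\<in>Y. v \<bullet> y \<noteq> 0}" by auto
  ultimately show ?thesis by simp
qed

definition cell_weight :: "(real ^ 'n) set set \<Rightarrow> real ^ 'n \<Rightarrow> int" where
  "cell_weight K x = (\<Sum>s | s \<in> K \<and> x \<in> s. (-1) ^ nat (aff_dim s))"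

text \<open>On the relative interior of a maximal cell no other cell contributes, so the weight
  there is a sign. Elsewhere terms may cancel, and the closure repairs this.\<close>

lemma closure_cell_weight:
  fixes K :: "(real ^ 'n) set set"
  assumes K: "simplicial_complex K"
  shows "\<Union>K = closure {x. cell_weight K x \<noteq> 0}"
proof (intro equalityI subsetI)
  fix x assume "x \<in> \<Union>K"
  then obtain s where s: "s \<in> K" "x \<in> s" by blast
  have finK: "finite K" by (rule simplicial_complexD(1)[OF K])
  obtain T where T: "T \<in> K" "s \<subseteq> T" and max: "\<And>R. R \<in> K \<Longrightarrow> T \<subseteq> R \<Longrightarrow> T = R"
    using finite_has_maximal2[OF finK s(1)] by blast
  note cell = simplicial_complex_cell[OF K T(1)]
  have "cell_weight K p \<noteq> 0" if p: "p \<in> rel_interior T" for p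
  proof -
    have pT: "p \<in> T" using p rel_interior_subset by blast
    have "R = T" if R: "R \<in> K" "p \<in> R" for R
    proof -
      have "T \<inter> R face_of T" by (rule simplicial_complexD(4)[OF K T(1) R(1)])
      moreover have "\<not> (T \<inter> R) \<inter> rel_interior T = {}" using p pT R(2) by blast
      ultimately have "T \<inter> R = T" using face_of_disjoint_rel_interior by blast
      then show ?thesis using max[OF R(1)] by blast
    qed
    then have "{s. s \<in> K \<and> p \<in> s} = {T}" using T(1) pT by blast
    then show ?thesis unfolding cell_weight_def by simp
  qed
  then have "closure (rel_interior T) \<subseteq> closure {x. cell_weight K x \<noteq> 0}" by (intro closure_mono) blast
  moreover have "closure (rel_interior T) = closure T" by (rule convex_closure_rel_interior[OF cell(1)])
  ultimately show "x \<in> closure {x. cell_weight K x \<noteq> 0}" using s(2) T(2) closure_subset by blast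
next
  have "{x. cell_weight K x \<noteq> 0} \<subseteq> \<Union>K"
  proof
    fix x assume "x \<in> {x. cell_weight K x \<noteq> 0}"
    then have "{s. s \<in> K \<and> x \<in> s} \<noteq> {}" unfolding cell_weight_def by force
    then show "x \<in> \<Union>K" by blast
  qed
  then have "closure {x. cell_weight K x \<noteq> 0} \<subseteq> \<Union>K" using closure_minimal closed_Union_complex[OF K] by blast
  then show "x \<in> closure {x. cell_weight K x \<noteq> 0} \<Longrightarrow> x \<in> \<Union>K" for x by blast
qed

text \<open>By convexity it is enough to test the finitely many points of \<open>V\<close>, so
  \<open>U\<close> is a finite intersection of open conditions linear in \<open>v\<close>. An
  element of \<open>U\<close> is a strict separation of \<open>x\<close> from
  \<open>s\<close>.\<close>

lemma strictly_below_open_convex: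
  fixes s :: "'a::euclidean_space set" and x :: 'a
  assumes s: "s = convex hull V" "finite V" "V \<noteq> {}"
  defines "U \<equiv> {v. \<forall>y\<in>s. v \<bullet> y < v \<bullet> x}"
  shows "U = {v. \<forall>y\<in>V. v \<bullet> y < v \<bullet> x}" "open U" "convex U" "U \<noteq> {} \<longleftrightarrow> x \<notin> s"
proof -
  show eq: "U = {v. \<forall>y\<in>V. v \<bullet> y < v \<bullet> x}"
  proof (intro equalityI subsetI)
    fix v assume v: "v \<in> {v. \<forall>y\<in>V. v \<bullet> y < v \<bullet> x}"
    have "s \<subseteq> {y. v \<bullet> y < v \<bullet> x}" unfolding s(1)
      by (rule hull_minimal) (use v in \<open>auto simp: convex_halfspace_lt\<close>)
    then show "v \<in> U" unfolding U_def by blast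
  qed (auto simp: U_def s(1) hull_inc)
  have eq2: "U = (\<Inter>y\<in>V. {v. v \<bullet> y < v \<bullet> x})" unfolding eq by auto
  show "open U" unfolding eq2 using s(2) by (intro open_INT) (auto intro!: open_Collect_less continuous_intros)
  show "convex U" unfolding eq2
  proof (rule convex_INT)
    fix y
    have "{v. v \<bullet> y < v \<bullet> x} = {v. (y - x) \<bullet> v < 0}" by (auto simp: inner_diff_left inner_commute[of y] inner_commute[of x])
    then show "convex {v. v \<bullet> y < v \<bullet> x}" by (simp add: convex_halfspace_lt)
  qed
  show "U \<noteq> {} \<longleftrightarrow> x \<notin> s"
  proof (rule iffI)
    assume "x \<notin> s"
    moreover have "convex s" "closed s" using s by (auto intro: compact_imp_closed finite_imp_compact_convex_hull)
    ultimately obtain a b where ab: "a \<bullet> x < b" "\<forall>y\<in>s. a \<bullet> y > b"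
      using separating_hyperplane_closed_point[of s x] by blast
    then have "- a \<in> U" unfolding U_def by force
    then show "U \<noteq> {}" by blast
  qed (auto simp: U_def)
qed

theorem cell_count_determines_shape:
  fixes K K' :: "(real ^ 'n) set set"
  assumes K: "simplicial_complex K" "simplicial_complex K'"
    and eq: "\<And>v t. cell_count K v t = cell_count K' v t"
  shows "\<Union>K = \<Union>K'"
proof -
  let ?I = "K \<union> K' - {{}}"
  have finK: "finite K" "finite K'" using K by (auto dest: simplicial_complexD(1))
  have fin: "finite ?I" using finK by simp
  \<comment> \<open>One family of coefficients for both complexes: common cells cancel, and equal
    cell counts become vanishing signed sums.\<close>
  define c :: "(real ^ 'n) set \<Rightarrow> int" where
    "c s = (-1) ^ nat (aff_dim s) * (of_bool (s \<in> K) - of_bool (s \<in> K'))" for s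
  have split: "(\<Sum>s | s \<in> ?I \<and> P s. c s) = (\<Sum>s | s \<in> K - {{}} \<and> P s. (-1) ^ nat (aff_dim s)) -
      (\<Sum>s | s \<in> K' - {{}} \<and> P s. (-1) ^ nat (aff_dim s))" for P
  proof -
    have "(\<Sum>s | s \<in> ?I \<and> P s. c s) = (\<Sum>s | s \<in> ?I \<and> P s. (if s \<in> K then (-1) ^ nat (aff_dim s) else 0) -
        (if s \<in> K' then (-1) ^ nat (aff_dim s) else 0))" by (rule sum.cong) (auto simp: c_def)
    also have "\<dots> = (\<Sum>s | s \<in> ?I \<and> P s. if s \<in> K then (-1) ^ nat (aff_dim s) else 0) -
        (\<Sum>s | s \<in> ?I \<and> P s. if s \<in> K' then (-1) ^ nat (aff_dim s) else 0)" by (rule sum_subtractf)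
    also have "(\<Sum>s | s \<in> ?I \<and> P s. if s \<in> K then (-1) ^ nat (aff_dim s) else 0) = (\<Sum>s | s \<in> K - {{}} \<and> P s. (-1::int) ^ nat (aff_dim s))"
      by (rule sum.mono_neutral_cong_right) (use fin in auto)
    also have "(\<Sum>s | s \<in> ?I \<and> P s. if s \<in> K' then (-1) ^ nat (aff_dim s) else 0) = (\<Sum>s | s \<in> K' - {{}} \<and> P s. (-1::int) ^ nat (aff_dim s))"
      by (rule sum.mono_neutral_cong_right) (use fin in auto)
    finally show ?thesis .
  qed
  have le: "(\<Sum>s | s \<in> ?I \<and> s \<subseteq> {y. y \<bullet> v \<le> t}. c s) = 0" for v t
  proof -
    have "{s. s \<in> L - {{}} \<and> s \<subseteq> {y. y \<bullet> v \<le> t}} = lower_cells L v t - {{}}" for L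
      by (auto simp: lower_cells_def)
    then show ?thesis unfolding split using eq[of v t] by (simp only: cell_count_def)
  qed
  define V where "V s = (if s \<in> K then {x \<in> vertices K. x \<in> s} else {x \<in> vertices K'. x \<in> s})" for s
  have Vsub: "V s \<subseteq> vertices K \<union> vertices K'" "V s \<subseteq> s" for s by (auto simp: V_def)
  have hull: "s = convex hull V s" if "s \<in> ?I" for s
  proof (cases "s \<in> K")
    case True
    then have "V s = {x \<in> vertices K. x \<in> s}" by (simp add: V_def)
    then show ?thesis using complex_cell_hull[OF K(1) True] by metis
  next
    case False
    then have "V s = {x \<in> vertices K'. x \<in> s}" "s \<in> K'" using that by (simp_all add: V_def)
    then show ?thesis using complex_cell_hull[OF K(2), of s] by metis
  qed
  have finV: "finite (V s)" for s using K by (simp add: V_def finite_vertices)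
  have neV: "V s \<noteq> {}" if "s \<in> ?I" for s using hull[OF that] that by (metis DiffD2 convex_hull_empty singletonI)
  have weight: "(\<Sum>s | s \<in> ?I \<and> x \<notin> s. c s) = 0" for x
  proof -
    define U where "U s = {v. \<forall>y\<in>s. v \<bullet> y < v \<bullet> x}" for s
    \<comment> \<open>Counting nonempty sets is available for bounded sets only. Cutting the cones
      by a cube about the origin makes no nonempty one empty, by scaling.\<close>
    define C where "C s = U s \<inter> {v. \<forall>b\<in>Basis. \<bar>v \<bullet> b\<bar> < 1}" for s
    note UU = strictly_below_open_convex[OF hull finV neV, of _ x, folded U_def]
    have strict: "(\<Sum>s | s \<in> ?I \<and> v \<in> U s. c s) = 0" for v
    proof -
      let ?A = "(\<lambda>y. v \<bullet> y) ` (vertices K \<union> vertices K')"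
      \<comment> \<open>With \<open>d\<close> the largest vertex height below
        \<open>v \<bullet> x\<close>, or \<open>v \<bullet> x - 1\<close> if larger, lying strictly
        below \<open>x\<close> is the same as lying in the closed half-space at level
        \<open>d\<close>.\<close>
      define d where "d = Max (insert (v \<bullet> x - 1) {a \<in> ?A. a < v \<bullet> x})"
      have finA: "finite (insert (v \<bullet> x - 1) {a \<in> ?A. a < v \<bullet> x})" using K by (simp add: finite_vertices)
      have d: "d < v \<bullet> x" unfolding d_def using finA by (subst Max_less_iff) auto
      have "v \<in> U s \<longleftrightarrow> s \<subseteq> {y. y \<bullet> v \<le> d}" if s: "s \<in> ?I" for s
      proof
        assume "v \<in> U s"
        then have lt: "v \<bullet> y < v \<bullet> x" if "y \<in> s" for y using that by (auto simp: U_def)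
        have "V s \<subseteq> {y. v \<bullet> y \<le> d}"
        proof
          fix y assume y: "y \<in> V s"
          then have "v \<bullet> y < v \<bullet> x" using lt Vsub(2)[of s] y by blast
          moreover have "v \<bullet> y \<in> ?A" using y Vsub(1)[of s] by blast
          ultimately show "y \<in> {y. v \<bullet> y \<le> d}" unfolding d_def using Max_ge[OF finA, of "v \<bullet> y"] by simp
        qed
        then have "convex hull V s \<subseteq> {y. v \<bullet> y \<le> d}" by (rule hull_minimal) (rule convex_halfspace_le)
        then show "s \<subseteq> {y. y \<bullet> v \<le> d}" unfolding hull[OF s, symmetric] by (simp add: inner_commute)
      next
        assume "s \<subseteq> {y. y \<bullet> v \<le> d}"
        then show "v \<in> U s" using d by (force simp: U_def inner_commute)
      qed
      then have "{s. s \<in> ?I \<and> v \<in> U s} = {s. s \<in> ?I \<and> s \<subseteq> {y. y \<bullet> v \<le> d}}" by blast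
      then show ?thesis using le[of v d] by simp
    qed
    have "(\<Sum>s | s \<in> ?I \<and> C s \<noteq> {}. c s) = 0"
    proof (rule open_convex_sum_zero[OF fin])
      have "open {v::real ^ 'n. \<forall>b\<in>Basis. \<bar>v \<bullet> b\<bar> < 1}" "convex {v::real ^ 'n. \<forall>b\<in>Basis. \<bar>v \<bullet> b\<bar> < 1}"
      proof -
        have eq: "{v::real ^ 'n. \<forall>b\<in>Basis. \<bar>v \<bullet> b\<bar> < 1} = box (- One) One"
          by (auto simp: box_def abs_less_iff)
        show "open {v::real ^ 'n. \<forall>b\<in>Basis. \<bar>v \<bullet> b\<bar> < 1}" "convex {v::real ^ 'n. \<forall>b\<in>Basis. \<bar>v \<bullet> b\<bar> < 1}"
          unfolding eq by (rule open_box, rule convex_box)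
      qed
      then show "open (C s) \<and> convex (C s)" if "s \<in> ?I" for s
        unfolding C_def using UU(2,3)[OF that that] by (blast intro: open_Int convex_Int)
      show "(\<Sum>s | s \<in> ?I \<and> v \<in> C s. c s) = 0" for v
      proof (cases "\<forall>b\<in>Basis. \<bar>v \<bullet> b\<bar> < 1")
        case True
        then show ?thesis using strict[of v] by (simp add: C_def)
      next
        case False
        then have "{s. s \<in> ?I \<and> v \<in> C s} = {}" unfolding C_def by blast
        then show ?thesis by (metis sum.empty)
      qed
    qed (auto simp: C_def)
    moreover have "C s \<noteq> {} \<longleftrightarrow> x \<notin> s" if s: "s \<in> ?I" for s
    proof -
      have "C s \<noteq> {}" if v: "v \<in> U s" for v
      proof -
        have "(1 / (norm v + 1)) *\<^sub>R v \<in> U s" 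
          using v unfolding U_def by (simp add: divide_strict_right_mono add_nonneg_pos)
        moreover have "\<bar>((1 / (norm v + 1)) *\<^sub>R v) \<bullet> b\<bar> < 1" if "b \<in> Basis" for b
        proof -
          have "\<bar>v \<bullet> b\<bar> < norm v + 1" using Basis_le_norm[OF that, of v] by linarith
          then show ?thesis by (simp add: abs_mult divide_simps)
        qed
        ultimately show ?thesis unfolding C_def by blast
      qed
      then have "C s \<noteq> {} \<longleftrightarrow> U s \<noteq> {}" unfolding C_def by blast
      then show ?thesis using UU(4)[OF s s] by simp
    qed
    then have "{s. s \<in> ?I \<and> C s \<noteq> {}} = {s. s \<in> ?I \<and> x \<notin> s}" by blast
    ultimately show ?thesis by simp
  qed
  \<comment> \<open>For the zero direction every cell lies at level 0, which gives the total;
    subtracting the cells that miss \<open>x\<close> leaves those that contain it.\<close>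
  have total: "(\<Sum>s\<in>?I. c s) = 0"
  proof -
    have "{s. s \<in> ?I \<and> s \<subseteq> {y. y \<bullet> 0 \<le> (0::real)}} = ?I" by auto
    then show ?thesis using le[of 0 0] by metis
  qed
  have "(\<Sum>s | s \<in> ?I \<and> x \<in> s. c s) = 0" for x
  proof -
    have "(\<Sum>s\<in>?I. c s) = (\<Sum>s | s \<in> ?I \<and> x \<in> s. c s) + (\<Sum>s | s \<in> ?I \<and> x \<notin> s. c s)"
      by (subst sum.union_disjoint[symmetric]) (use fin in \<open>auto intro!: sum.cong\<close>)
    then show ?thesis using total weight[of x] by simp
  qed
  moreover have "{s. s \<in> L - {{}} \<and> x \<in> s} = {s. s \<in> L \<and> x \<in> s}" for L and x :: "real ^ 'n" by auto
  ultimately have "cell_weight K x = cell_weight K' x" for x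
    unfolding split by (simp add: cell_weight_def)
  then show ?thesis using closure_cell_weight[OF K(1)] closure_cell_weight[OF K(2)] by simp
qed

section \<open>Choosing directions\<close>

text \<open>A chord of angle \<theta> has squared length 2 - 2 cos \<theta>, so the claim reduces to
  \<delta>/8 < sin (\<delta>/2). Up to \<delta>/2 = \<pi>/3 this is the mean value theorem with
  cosine above 1/2; beyond, the sine is at least half the square root of 3.\<close>

lemma geodesic_ball_dist:
  fixes u v :: "real ^ 'n"
  assumes u: "norm u = 1" "norm v = 1" and d: "0 < \<delta>" "\<delta> < pi" "dist v u \<le> \<delta> / 4"
  shows "u \<in> geodesic_ball v \<delta>"
proof -
  have "(dist v u)\<^sup>2 = 2 - 2 * (v \<bullet> u)"
    using u by (simp add: dist_norm power2_norm_eq_inner inner_diff_left inner_diff_right inner_commute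
        norm_eq_1)
  moreover have "(dist v u)\<^sup>2 \<le> (\<delta> / 4)\<^sup>2" using d(3) by (intro power_mono) auto
  moreover have "(\<delta> / 4)\<^sup>2 < 2 - 2 * cos \<delta>"
  proof -
    have "\<delta> / 8 < sin (\<delta> / 2)"
    proof -
      define x where "x = \<delta> / 2"
      have x: "0 < x" "x \<le> pi / 2" using d by (auto simp: x_def)
      have "x / 4 < sin x"
      proof (cases "x \<le> pi / 3")
        case True
        obtain z where z: "0 < z" "z < x" "sin x - sin 0 = (x - 0) * cos z"
          using MVT2[of 0 x sin cos] x(1) by (auto intro: DERIV_sin)
        have "cos (pi / 3) < cos z" using z(1,2) True pi_gt_zero by (intro cos_monotone_0_pi) auto
        then have "1 / 2 < cos z" by (simp add: cos_60)
        then have "x * (1 / 2) < x * cos z" using x(1) by (intro mult_strict_left_mono)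
        then show ?thesis using z(3) x(1) by simp
      next
        case False
        have "sin (pi / 3) \<le> sin x" using False x(2) by (intro sin_monotone_2pi_le) auto
        moreover have "1 < sqrt (3::real)" by simp
        moreover have "x / 4 < 1 / 2" using x(2) pi_less_4 by simp
        ultimately show ?thesis unfolding sin_60 by linarith
      qed
      then show ?thesis by (simp add: x_def)
    qed
    then have "(\<delta> / 8)\<^sup>2 < (sin (\<delta> / 2))\<^sup>2" using d(1) by (intro power_strict_mono) auto
    moreover have "cos \<delta> = 1 - 2 * (sin (\<delta> / 2))\<^sup>2" using cos_double_sin[of "\<delta> / 2"] by simp
    ultimately show ?thesis by (simp add: power2_eq_square)
  qed
  ultimately have "cos \<delta> < v \<bullet> u" by simp
  moreover have "\<bar>v \<bullet> u\<bar> \<le> 1" using Cauchy_Schwarz_ineq2[of v u] u by simp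
  ultimately have "arccos (v \<bullet> u) < arccos (cos \<delta>)" by (intro arccos_less_arccos) auto
  then show ?thesis using d u by (simp add: geodesic_ball_def arccos_cos)
qed

text \<open>In a grid of mesh \<open>r / CARD('n)\<close>, two points of one cube are within
  \<open>r\<close> even in the sum norm. One point of the sphere is picked from each cube that meets
  it, so the net lies on the sphere.\<close>

lemma sphere_net_grid:
  fixes r :: real
  assumes "0 < r"
  shows "\<exists>W :: (real ^ 'n) set. finite W \<and> W \<subseteq> sphere 0 1 \<and>
    real (card W) \<le> (2 * real CARD('n) / r + 3) ^ CARD('n) \<and> (\<forall>v\<in>sphere 0 1. \<exists>w\<in>W. dist v w \<le> r)"
proof -
  define h where "h = r / real CARD('n)"
  have h: "h > 0" using assms by (simp add: h_def)
  define cell :: "real ^ 'n \<Rightarrow> 'n \<Rightarrow> int" where "cell v i = \<lfloor>v $ i / h\<rfloor>" for v i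
  define M where "M = \<lceil>1 / h\<rceil>"
  have M: "real_of_int M \<le> 1 / h + 1" "0 \<le> M"
  proof -
    show "real_of_int M \<le> 1 / h + 1" unfolding M_def by linarith
    have "0 < 1 / h" using h by simp
    then show "0 \<le> M" unfolding M_def by linarith
  qed
  let ?S = "sphere 0 1 :: (real ^ 'n) set"
  have cells: "cell ` ?S \<subseteq> (UNIV \<rightarrow>\<^sub>E {- M..M})"
  proof (intro image_subsetI PiE_I)
    fix v :: "real ^ 'n" and i assume "v \<in> ?S"
    then have "\<bar>v $ i\<bar> \<le> 1" using component_le_norm_cart[of v i] by simp
    then have "\<bar>v $ i / h\<bar> \<le> 1 / h" using h by (simp add: divide_right_mono)
    then have "v $ i / h \<le> of_int M" "- of_int M \<le> v $ i / h" unfolding M_def by linarith+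
    then have "\<lfloor>v $ i / h\<rfloor> \<le> M" "- M \<le> \<lfloor>v $ i / h\<rfloor>"
      by (simp add: floor_le_iff, simp add: le_floor_iff)
    then show "cell v i \<in> {- M..M}" by (simp add: cell_def)
  qed simp
  have finP: "finite (UNIV \<rightarrow>\<^sub>E {- M..M} :: ('n \<Rightarrow> int) set)" by (intro finite_PiE) auto
  have fin: "finite (cell ` ?S)" using finite_subset[OF cells finP] .
  define pick where "pick c = (SOME v. v \<in> ?S \<and> cell v = c)" for c
  have pick: "pick (cell v) \<in> ?S" "cell (pick (cell v)) = cell v" if "v \<in> ?S" for v
    using someI[of "\<lambda>w. w \<in> ?S \<and> cell w = cell v" v] that unfolding pick_def by blast+
  let ?W = "pick ` cell ` ?S"
  have "card ?W \<le> card (UNIV \<rightarrow>\<^sub>E {- M..M} :: ('n \<Rightarrow> int) set)"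
    using card_image_le[OF fin, of pick] card_mono[OF finP cells] by linarith
  also have "\<dots> = nat (2 * M + 1) ^ CARD('n)" by (simp add: card_PiE)
  finally have "real (card ?W) \<le> real (nat (2 * M + 1) ^ CARD('n))" by (rule of_nat_mono)
  then have "real (card ?W) \<le> real (nat (2 * M + 1)) ^ CARD('n)" by simp
  also have "\<dots> \<le> (2 * real CARD('n) / r + 3) ^ CARD('n)"
  proof (rule power_mono)
    have "real (nat (2 * M + 1)) = 2 * of_int M + 1" using M(2) by simp
    also have "\<dots> \<le> 2 * (1 / h) + 3" using M(1) by simp
    finally show "real (nat (2 * M + 1)) \<le> 2 * real CARD('n) / r + 3" by (simp add: h_def)
  qed simp
  finally have card: "real (card ?W) \<le> (2 * real CARD('n) / r + 3) ^ CARD('n)" .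
  have "dist v (pick (cell v)) \<le> r" if "v \<in> ?S" for v
  proof -
    let ?w = "pick (cell v)"
    have "\<bar>(v - ?w) $ i\<bar> \<le> h" for i
    proof -
      have "\<lfloor>v $ i / h\<rfloor> = \<lfloor>?w $ i / h\<rfloor>" using fun_cong[OF pick(2)[OF that], of i] by (simp add: cell_def)
      then have "\<bar>v $ i / h - ?w $ i / h\<bar> \<le> 1" by linarith
      then have "\<bar>(v $ i - ?w $ i) / h\<bar> \<le> 1" by (simp add: diff_divide_distrib)
      then show ?thesis using h by (simp add: divide_simps)
    qed
    then have "norm (v - ?w) \<le> (\<Sum>i\<in>(UNIV::'n set). h)"
      using norm_le_l1_cart[of "v - ?w"] sum_mono[of UNIV "\<lambda>i. \<bar>(v - ?w) $ i\<bar>" "\<lambda>_. h"] by fastforce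
    then show ?thesis by (simp add: dist_norm h_def)
  qed
  then have "\<forall>v\<in>?S. \<exists>w\<in>?W. dist v w \<le> r" by blast
  moreover have "finite ?W" "?W \<subseteq> ?S" using fin pick(1) by auto
  ultimately show ?thesis using card by blast
qed

text \<open>Directions are added one at a time outside the spans of fewer than
  \<open>CARD('n)\<close> earlier ones; each span lies in a hyperplane, and the complement of
  finitely many hyperplanes is dense. In dimension 1 only the zero subspace is avoided, which would
  not exclude repetitions; hence the condition on \<open>m\<close>.\<close>

lemma general_position_directions:
  fixes w :: "real ^ 'n"
  assumes w: "norm w = 1" and e: "0 < e" and m: "m \<le> 1 \<or> CARD('n) \<ge> 2"
  shows "\<exists>U. finite U \<and> card U = m \<and> U \<subseteq> sphere 0 1 \<inter> cball w e \<and>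
    (\<forall>S\<subseteq>U. card S \<le> CARD('n) \<longrightarrow> independent S)"
  using m
proof (induction m)
  case 0
  show ?case by (rule exI[of _ "{}"]) (simp add: real_vector.independent_empty)
next
  case (Suc m)
  then have "m \<le> 1 \<or> CARD('n) \<ge> 2" by linarith
  from Suc.IH[OF this] obtain U where U: "finite U" "card U = m" "U \<subseteq> sphere 0 1 \<inter> cball w e"
    "\<forall>S\<subseteq>U. card S \<le> CARD('n) \<longrightarrow> independent S" by blast
  let ?F = "{S. S \<subseteq> U \<and> card S < CARD('n)}"
  have finF: "finite ?F" using U(1) by simp
  have ex: "\<exists>y. y \<noteq> 0 \<and> (\<forall>x\<in>span S. orthogonal x y)" if "S \<in> ?F" for S
  proof -
    have "finite S" using that U(1) finite_subset by blast
    then have "dim S \<le> card S" by (rule dim_le_card')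
    then have "dim S < DIM(real ^ 'n)" using that by simp
    from orthogonal_to_subspace_exists[OF this] show ?thesis by (metis orthogonal_commute)
  qed
  define y :: "(real ^ 'n) set \<Rightarrow> real ^ 'n" where "y S = (SOME y. y \<noteq> 0 \<and> (\<forall>x\<in>span S. orthogonal x y))" for S
  have y: "y S \<noteq> 0" "\<And>x. x \<in> span S \<Longrightarrow> orthogonal x (y S)" if "S \<in> ?F" for S
    using someI_ex[OF ex[OF that]] unfolding y_def by blast+
  have cl: "closure {v. \<forall>z\<in>y ` ?F. v \<bullet> z \<noteq> 0} = UNIV"
    by (rule dense_generic) (use finF y(1) in auto)
  \<comment> \<open>Normalising moves \<open>v\<close> by at most its distance from
    \<open>w\<close>, so \<open>e / 4\<close> leaves room; the bound 1/2 keeps \<open>v\<close> away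
    from 0.\<close>
  obtain v where v: "\<forall>z\<in>y ` ?F. v \<bullet> z \<noteq> 0" "dist v w < min (1 / 2) (e / 4)"
  proof -
    have "w \<in> closure {v. \<forall>z\<in>y ` ?F. v \<bullet> z \<noteq> 0}" unfolding cl by simp
    moreover have "0 < min (1 / 2) (e / 4)" using e by simp
    ultimately have "\<exists>v\<in>{v. \<forall>z\<in>y ` ?F. v \<bullet> z \<noteq> 0}. dist v w < min (1 / 2) (e / 4)"
      unfolding closure_approachable by blast
    then show ?thesis using that by blast
  qed
  let ?u = "v /\<^sub>R norm v"
  have nv: "\<bar>norm v - 1\<bar> \<le> dist v w" using norm_triangle_ineq3[of v w] w by (simp add: dist_norm)
  then have v0: "norm v > 0" using v(2) by linarith
  have u: "norm ?u = 1" using v0 by simp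
  have "dist w ?u \<le> e"
  proof -
    have "dist v ?u = \<bar>norm v - 1\<bar>"
    proof -
      have nu: "norm v *\<^sub>R ?u = v" using v0 by simp
      have eq: "v - ?u = (norm v - 1) *\<^sub>R ?u" unfolding scaleR_diff_left nu by (simp only: scaleR_one)
      have "norm (v - ?u) = \<bar>norm v - 1\<bar> * norm ?u" unfolding eq by (rule norm_scaleR)
      then show ?thesis unfolding dist_norm u by simp
    qed
    then have "dist w ?u \<le> dist v w + dist v w" using dist_triangle[of w ?u v] nv by (simp add: dist_commute)
    then show ?thesis using v(2) zero_le_dist[of v w] by linarith
  qed
  define u where "u = ?u"
  have nsp: "u \<notin> span S" if "S \<in> ?F" for S
  proof
    assume "u \<in> span S"
    from y(2)[OF that this] have "v \<bullet> y S = 0" using v0 by (simp add: u_def orthogonal_def)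
    moreover have "y S \<in> y ` ?F" using that by (rule imageI)
    ultimately show False using v(1) by blast
  qed
  have uU: "u \<notin> U"
  proof
    assume u: "u \<in> U"
    then have "card U \<noteq> 0" using U(1) by auto
    then have "CARD('n) \<ge> 2" using Suc.prems U(2) by simp
    then have "{u} \<in> ?F" using u by simp
    from nsp[OF this] show False by (simp add: span_base)
  qed
  have "independent S" if S: "S \<subseteq> insert u U" "card S \<le> CARD('n)" for S
  proof (cases "u \<in> S")
    case True
    then have eq: "S = insert u (S - {u})" by blast
    have finS: "finite S" using finite_subset[OF S(1)] U(1) by simp
    have sub: "S - {u} \<subseteq> U" using S(1) by blast
    have c: "card (S - {u}) < CARD('n)" using card_Diff1_less[OF finS True] S(2) by linarith
    have "independent (S - {u})" using U(4)[rule_format, OF sub] c by simp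
    moreover have "u \<notin> span (S - {u})" by (rule nsp) (use sub c in simp)
    ultimately show ?thesis by (subst eq) (rule independent_insertI)
  next
    case False
    then have "S \<subseteq> U" using S(1) by blast
    then show ?thesis using U(4) S(2) by simp
  qed
  moreover have "finite (insert u U)" "card (insert u U) = Suc m" using U(1,2) uU by auto
  moreover have "insert u U \<subseteq> sphere 0 1 \<inter> cball w e"
    using U(3) \<open>norm ?u = 1\<close> \<open>dist w ?u \<le> e\<close> unfolding u_def by simp
  ultimately show ?case by (intro exI[of _ "insert u U"]) blast
qed

lemma independent_orthogonal_card:
  fixes z :: "real ^ 'n"
  assumes U: "finite U" "\<forall>S\<subseteq>U. card S \<le> CARD('n) \<longrightarrow> independent S" and z: "z \<noteq> 0"
  shows "card {u \<in> U. u \<bullet> z = 0} < CARD('n)"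
proof (rule ccontr)
  assume "\<not> ?thesis"
  then obtain S where S: "S \<subseteq> {u \<in> U. u \<bullet> z = 0}" "card S = CARD('n)" "finite S"
    by (meson not_less obtain_subset_with_card_n)
  have "S \<subseteq> U" using S(1) by blast
  from U(2)[rule_format, OF this] have ind: "independent S" using S(2) by simp
  have "dim S = DIM(real ^ 'n)" using dim_eq_card_independent[OF ind] S(2) by simp
  then have "span S = UNIV" by (rule dim_eq_full[THEN iffD1])
  then have "z \<in> span S" by simp
  moreover have "orthogonal z x" if "x \<in> S" for x using S(1) that by (auto simp: orthogonal_def inner_commute)
  ultimately have "orthogonal z z" using orthogonal_to_span by blast
  then show False using z by (simp add: orthogonal_self)
qed

text \<open>The sign patterns realised by the chambers that the hyperplanes orthogonal to the vectors in \<open>Z\<close>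
  cut out of \<open>V\<close>.\<close>
definition sign_patterns :: "'a::euclidean_space set \<Rightarrow> 'a set \<Rightarrow> 'a set set" where
  "sign_patterns V Z = {A. \<exists>v\<in>V. (\<forall>z\<in>Z. v \<bullet> z \<noteq> 0) \<and> A = {z \<in> Z. v \<bullet> z > 0}}"

lemma sign_patternsI: "v \<in> V \<Longrightarrow> \<forall>z\<in>Z. v \<bullet> z \<noteq> 0 \<Longrightarrow> A = {z \<in> Z. v \<bullet> z > 0} \<Longrightarrow> A \<in> sign_patterns V Z"
  unfolding sign_patterns_def by blast

lemma sign_patternsE:
  assumes "A \<in> sign_patterns V Z"
  obtains v where "v \<in> V" "\<forall>z\<in>Z. v \<bullet> z \<noteq> 0" "A = {z \<in> Z. v \<bullet> z > 0}"
  using assms unfolding sign_patterns_def by blast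

lemma sign_patterns_subset: "sign_patterns V Z \<subseteq> Pow Z"
  by (auto simp: sign_patterns_def)

lemma finite_sign_patterns: "finite Z \<Longrightarrow> finite (sign_patterns V Z)"
  using finite_subset[OF sign_patterns_subset] by simp

text \<open>Deletion and restriction: a pattern on \<open>Z\<close> that occurs on both sides of the
  hyperplane of \<open>z\<close> accounts for two patterns on \<open>insert z Z\<close>, and it also
  occurs on the hyperplane itself.\<close>

lemma card_sign_patterns_insert:
  fixes V :: "'a::euclidean_space set"
  assumes Z: "finite Z" "z \<notin> Z" and V: "Real_Vector_Spaces.subspace V"
  shows "card (sign_patterns V (insert z Z)) \<le> card (sign_patterns V Z) + card (sign_patterns (V \<inter> {v. v \<bullet> z = 0}) Z)"
proof -
  let ?S = "sign_patterns V (insert z Z)" and ?T = "sign_patterns V Z" and ?S' = "sign_patterns (V \<inter> {v. v \<bullet> z = 0}) Z"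
  have fin: "finite ?S" "finite ?T" "finite ?S'"
    using Z(1) by (simp_all add: finite_sign_patterns)
  define P where "P = {A \<in> ?S. z \<notin> A}"
  define Q where "Q = {A \<in> ?S. z \<in> A}"
  let ?Q' = "(\<lambda>A. A - {z}) ` Q"
  have PQ: "?S = P \<union> Q" "P \<inter> Q = {}" "finite P" "finite Q" using fin by (auto simp: P_def Q_def)
  have inj: "inj_on (\<lambda>A. A - {z}) Q" by (rule inj_onI) (auto simp: Q_def)
  define \<Phi> where "\<Phi> A v \<longleftrightarrow> v \<in> V \<and> (\<forall>y\<in>Z. v \<bullet> y \<noteq> 0) \<and> A = {y \<in> Z. v \<bullet> y > 0}" for A v
  have P: "\<exists>v. \<Phi> A v \<and> v \<bullet> z < 0" if "A \<in> P" for A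
  proof -
    have "A \<in> ?S" "z \<notin> A" using that by (auto simp: P_def)
    from this(1) obtain v where v: "v \<in> V" "\<forall>y\<in>insert z Z. v \<bullet> y \<noteq> 0" "A = {y \<in> insert z Z. v \<bullet> y > 0}"
      by (rule sign_patternsE)
    have "\<not> v \<bullet> z > 0" using \<open>z \<notin> A\<close> v(3) by simp
    moreover have "v \<bullet> z \<noteq> 0" using v(2) by simp
    ultimately have "v \<bullet> z < 0" by linarith
    moreover from this have "A = {y \<in> Z. v \<bullet> y > 0}" using v(3) by auto
    ultimately show ?thesis using v(1,2) unfolding \<Phi>_def by (intro exI[of _ v]) simp
  qed
  have Q: "\<exists>v. \<Phi> A v \<and> v \<bullet> z > 0" if A: "A \<in> ?Q'" for A
  proof -
    obtain B where B: "B \<in> ?S" "z \<in> B" "A = B - {z}" using A by (auto simp: Q_def)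
    from this(1) obtain v where v: "v \<in> V" "\<forall>y\<in>insert z Z. v \<bullet> y \<noteq> 0" "B = {y \<in> insert z Z. v \<bullet> y > 0}"
      by (rule sign_patternsE)
    have "v \<bullet> z > 0" using B(2) v(3) by simp
    moreover have "A = {y \<in> Z. v \<bullet> y > 0}" using B(3) v(3) Z(2) by auto
    ultimately show ?thesis using v(1,2) unfolding \<Phi>_def by (intro exI[of _ v]) simp
  qed
  have un: "P \<union> ?Q' \<subseteq> ?T"
  proof
    fix A assume "A \<in> P \<union> ?Q'"
    then obtain v where "\<Phi> A v" using P[of A] Q[of A] by blast
    then show "A \<in> ?T" unfolding \<Phi>_def by (blast intro: sign_patternsI)
  qed
  have int: "P \<inter> ?Q' \<subseteq> ?S'"
  proof
    fix A assume "A \<in> P \<inter> ?Q'"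
    then have AP: "A \<in> P" and AQ: "A \<in> ?Q'" by simp_all
    obtain v where v: "v \<in> V" "\<forall>y\<in>Z. v \<bullet> y \<noteq> 0" "v \<bullet> z < 0" "A = {y \<in> Z. v \<bullet> y > 0}"
      using P[OF AP] unfolding \<Phi>_def by blast
    obtain w where w: "w \<in> V" "\<forall>y\<in>Z. w \<bullet> y \<noteq> 0" "w \<bullet> z > 0" "A = {y \<in> Z. w \<bullet> y > 0}"
      using Q[OF AQ] unfolding \<Phi>_def by blast
    \<comment> \<open>A positive combination of \<open>v\<close> and \<open>w\<close> that is
      orthogonal to \<open>z\<close>; both vectors have the same signs on \<open>Z\<close>, so the
      combination keeps them.\<close>
    let ?u = "(w \<bullet> z) *\<^sub>R v + (- (v \<bullet> z)) *\<^sub>R w"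
    have u: "?u \<in> V" using v(1) w(1) V by (intro real_vector.subspace_add real_vector.subspace_scale)
    have uz: "?u \<bullet> z = 0" by (simp add: inner_diff_left)
    have sgn: "(?u \<bullet> y > 0 \<longleftrightarrow> y \<in> A) \<and> ?u \<bullet> y \<noteq> 0" if y: "y \<in> Z" for y
    proof (cases "y \<in> A")
      case True
      then have "v \<bullet> y > 0" "w \<bullet> y > 0" using v(4) w(4) by blast+
      then have "(w \<bullet> z) * (v \<bullet> y) > 0" "(- (v \<bullet> z)) * (w \<bullet> y) > 0" using v(3) w(3) by (auto intro: mult_pos_pos simp: mult_neg_pos)
      then show ?thesis using True by (simp add: inner_diff_left)
    next
      case False
      then have "\<not> v \<bullet> y > 0" "\<not> w \<bullet> y > 0" using v(4) w(4) y by blast+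
      moreover have "v \<bullet> y \<noteq> 0" "w \<bullet> y \<noteq> 0" using v(2) w(2) y by blast+
      ultimately have "v \<bullet> y < 0" "w \<bullet> y < 0" by linarith+
      then have "(w \<bullet> z) * (v \<bullet> y) < 0" "(v \<bullet> z) * (w \<bullet> y) > 0"
        using v(3) w(3) by (auto intro: mult_pos_neg mult_neg_neg)
      then show ?thesis using False by (simp add: inner_diff_left)
    qed
    have "A = {y \<in> Z. ?u \<bullet> y > 0}" using sgn v(4) by blast
    moreover have "\<forall>y\<in>Z. ?u \<bullet> y \<noteq> 0" using sgn by blast
    ultimately show "A \<in> ?S'" using u uz by (intro sign_patternsI[of ?u]) simp_all
  qed
  have "card ?S = card P + card Q" using PQ by (simp add: card_Un_disjoint)
  also have "\<dots> = card P + card ?Q'" by (simp add: card_image[OF inj])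
  also have "\<dots> = card (P \<union> ?Q') + card (P \<inter> ?Q')" using PQ(3,4) by (intro card_Un_Int) auto
  also have "\<dots> \<le> card ?T + card ?S'" using card_mono[OF fin(2) un] card_mono[OF fin(3) int] by linarith
  finally show ?thesis .
qed

text \<open>The number of chambers of \<open>m\<close> central hyperplanes in general position in
  dimension \<open>r\<close>. The value 0 for \<open>r = 0\<close> reflects that the zero vector is
  off no hyperplane through the origin.\<close>

fun chamber_bound :: "nat \<Rightarrow> nat \<Rightarrow> nat" where
  "chamber_bound 0 r = 1"
| "chamber_bound (Suc m) 0 = 0"
| "chamber_bound (Suc m) (Suc r) = chamber_bound m (Suc r) + chamber_bound m r"

lemma chamber_bound_le: "chamber_bound m (Suc r) \<le> 2 * (m + 1) ^ r"
proof (induction m arbitrary: r)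
  case (Suc m)
  show ?case
  proof (cases r)
    case 0
    have "chamber_bound m (Suc 0) + chamber_bound m 0 \<le> 2"
      using Suc.IH[of 0] by (cases m) auto
    then show ?thesis using 0 by simp
  next
    case (Suc q)
    have "chamber_bound (Suc m) (Suc r) \<le> 2 * (m + 1) ^ Suc q + 2 * (m + 1) ^ q"
      using Suc.IH[of "Suc q"] Suc.IH[of q] \<open>r = Suc q\<close> by simp
    also have "\<dots> = 2 * ((m + 1) ^ q * (Suc m + 1))" by (simp add: algebra_simps)
    also have "\<dots> \<le> 2 * ((Suc m + 1) ^ q * (Suc m + 1))" by (intro mult_le_mono power_mono) auto
    finally show ?thesis unfolding \<open>r = Suc q\<close> by (simp only: power_Suc mult.commute)
  qed
qed simp

lemma card_sign_patterns_le:
  fixes V :: "'a::euclidean_space set"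
  assumes "finite Z" "Real_Vector_Spaces.subspace V" "dim V \<le> r"
  shows "card (sign_patterns V Z) \<le> chamber_bound (card Z) r"
  using assms
proof (induction Z arbitrary: V r rule: finite_induct)
  case empty
  have "sign_patterns V {} \<subseteq> {{}}" by (auto simp: sign_patterns_def)
  then have "card (sign_patterns V {}) \<le> card {{}::'a set}" by (intro card_mono) auto
  then show ?case by simp
next
  case (insert z Z)
  let ?V' = "V \<inter> {v. v \<bullet> z = 0}"
  have V': "Real_Vector_Spaces.subspace ?V'" using insert.prems(1) subspace_hyperplane[of z] by (simp add: real_vector.subspace_inter inner_commute)
  show ?case
  proof (cases "V \<subseteq> {v. v \<bullet> z = 0}")
    case True
    then have "sign_patterns V (insert z Z) = {}" by (auto simp: sign_patterns_def)
    then show ?thesis by simp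
  next
    case False
    have "dim ?V' < dim V"
    proof (rule dim_psubset)
      show "span ?V' \<subset> span V" using False V' insert.prems(1) by (auto simp: span_eq_iff[THEN iffD2])
    qed
    then obtain q where q: "r = Suc q" "dim ?V' \<le> q" using insert.prems(2) by (cases r) auto
    have "card (sign_patterns V (insert z Z)) \<le> card (sign_patterns V Z) + card (sign_patterns ?V' Z)"
      by (rule card_sign_patterns_insert[OF insert.hyps insert.prems(1)])
    also have "\<dots> \<le> chamber_bound (card Z) (Suc q) + chamber_bound (card Z) q"
      using insert.IH[OF insert.prems(1), of "Suc q"] insert.IH[OF V' q(2)] insert.prems(2) q(1) by simp
    finally show ?thesis using insert.hyps q(1) by simp
  qed
qed

lemma chamber_directions:
  fixes Z :: "(real ^ 'n) set"
  assumes Z: "finite Z"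
  shows "\<exists>R. finite R \<and> R \<subseteq> sphere 0 1 \<and> card R \<le> 2 * (card Z + 1) ^ (CARD('n) - 1) \<and>
    (\<forall>v. (\<forall>z\<in>Z. v \<bullet> z \<noteq> 0) \<longrightarrow> (\<exists>r\<in>R. \<forall>z\<in>Z. r \<bullet> z \<noteq> 0 \<and> (v \<bullet> z > 0 \<longleftrightarrow> r \<bullet> z > 0)))"
proof -
  let ?S = "sign_patterns UNIV Z"
  have finS: "finite ?S" using Z by (rule finite_sign_patterns)
  define good where "good A r \<longleftrightarrow> norm r = 1 \<and> (\<forall>z\<in>Z. r \<bullet> z \<noteq> 0) \<and> A = {z \<in> Z. r \<bullet> z > 0}" for A and r :: "real ^ 'n"
  have ex: "\<exists>r. good A r" if A: "A \<in> ?S" for A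
  proof -
    obtain v where v: "\<forall>z\<in>Z. v \<bullet> z \<noteq> 0" "A = {z \<in> Z. v \<bullet> z > 0}" using sign_patternsE[OF A] by metis
    show ?thesis
    proof (cases "v = 0")
      \<comment> \<open>The zero vector realises a pattern only if \<open>Z\<close> is empty, and
        then any unit vector will do.\<close>
      case True
      then have "Z = {}" using v(1) by auto
      then have "good A (axis undefined 1)" using v(2) by (simp add: good_def)
      then show ?thesis by blast
    next
      case False
      have "(v /\<^sub>R norm v) \<bullet> z = (v \<bullet> z) / norm v" for z by (simp add: divide_inverse mult.commute)
      then have "good A (v /\<^sub>R norm v)" using False v by (auto simp: good_def zero_less_divide_iff)
      then show ?thesis by blast
    qed
  qed
  define rep where "rep A = (SOME r. good A r)" for A
  have rep: "good A (rep A)" if "A \<in> ?S" for A using someI_ex[OF ex[OF that]] unfolding rep_def .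
  have "card (rep ` ?S) \<le> card ?S" by (rule card_image_le[OF finS])
  also have "\<dots> \<le> chamber_bound (card Z) (Suc (CARD('n) - 1))"
    by (rule card_sign_patterns_le[OF Z]) (auto simp: dim_UNIV)
  also have "\<dots> \<le> 2 * (card Z + 1) ^ (CARD('n) - 1)" by (rule chamber_bound_le)
  finally have card: "card (rep ` ?S) \<le> 2 * (card Z + 1) ^ (CARD('n) - 1)" .
  have "\<exists>r\<in>rep ` ?S. \<forall>z\<in>Z. r \<bullet> z \<noteq> 0 \<and> (v \<bullet> z > 0 \<longleftrightarrow> r \<bullet> z > 0)" if v: "\<forall>z\<in>Z. v \<bullet> z \<noteq> 0" for v
  proof -
    have A: "{z \<in> Z. v \<bullet> z > 0} \<in> ?S" unfolding sign_patterns_def using v by blast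
    have "\<forall>z\<in>Z. rep {z \<in> Z. v \<bullet> z > 0} \<bullet> z \<noteq> 0 \<and> (v \<bullet> z > 0 \<longleftrightarrow> rep {z \<in> Z. v \<bullet> z > 0} \<bullet> z > 0)"
      using rep[OF A] unfolding good_def by blast
    then show ?thesis using A by blast
  qed
  moreover have "rep ` ?S \<subseteq> sphere 0 1" using rep by (auto simp: good_def)
  ultimately show ?thesis using card finS by (intro exI[of _ "rep ` ?S"]) blast
qed

section \<open>The query procedure\<close>

fun ask_all :: "'v list \<Rightarrow> ('a list \<Rightarrow> ('v, 'a) query_procedure) \<Rightarrow> ('v, 'a) query_procedure" where
  "ask_all [] c = c []"
| "ask_all (v # vs) c = Query v (\<lambda>a. ask_all vs (\<lambda>as. c (a # as)))"

lemma transcript_ask_all: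
  "transcript (ask_all vs c) f = map (\<lambda>v. (v, f v)) vs @ transcript (c (map f vs)) f"
  by (induction vs arbitrary: c) auto

text \<open>The threshold is the \<open>r\<close>-height of a vertex that is highest for
  \<open>v\<close> among those not above \<open>t\<close>; if there is none, a number below all
  heights serves.\<close>

lemma same_order_threshold:
  fixes K :: "(real ^ 'n) set set"
  assumes K: "simplicial_complex K"
    and order: "\<And>x y. x \<in> vertices K \<Longrightarrow> y \<in> vertices K \<Longrightarrow> v \<bullet> x \<le> v \<bullet> y \<longleftrightarrow> r \<bullet> x \<le> r \<bullet> y"
  obtains s where "\<And>x. x \<in> vertices K \<Longrightarrow> v \<bullet> x \<le> t \<longleftrightarrow> r \<bullet> x \<le> s"
proof (cases "{x \<in> vertices K. v \<bullet> x \<le> t} = {}")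
  case True
  define s where "s = Min (insert 0 ((\<lambda>x. r \<bullet> x) ` vertices K)) - 1"
  have "s < r \<bullet> x" if "x \<in> vertices K" for x
  proof -
    have "Min (insert 0 ((\<lambda>x. r \<bullet> x) ` vertices K)) \<le> r \<bullet> x"
      using finite_vertices[OF K] that by (intro Min_le) auto
    then show ?thesis by (simp add: s_def)
  qed
  then show ?thesis using that[of s] True by (metis (mono_tags, lifting) empty_Collect_eq not_le)
next
  case False
  let ?L = "{x \<in> vertices K. v \<bullet> x \<le> t}"
  have fin: "finite ?L" using finite_vertices[OF K] by simp
  have "finite ((\<lambda>x. v \<bullet> x) ` ?L)" "(\<lambda>x. v \<bullet> x) ` ?L \<noteq> {}" using fin False by auto
  from Max_in[OF this] obtain y where y: "y \<in> ?L" "v \<bullet> y = Max ((\<lambda>x. v \<bullet> x) ` ?L)" by (metis (no_types, lifting) imageE)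
  have max: "v \<bullet> x \<le> v \<bullet> y" if "x \<in> ?L" for x using fin that unfolding y(2) by (intro Max_ge) auto
  have "v \<bullet> x \<le> t \<longleftrightarrow> r \<bullet> x \<le> r \<bullet> y" if x: "x \<in> vertices K" for x
  proof -
    have "v \<bullet> x \<le> t \<longleftrightarrow> v \<bullet> x \<le> v \<bullet> y" using max[of x] x y(1) by auto
    then show ?thesis using order[OF x, of y] y(1) by simp
  qed
  then show ?thesis by (rule that)
qed

text \<open>Common to both transforms: \<open>T a\<close> is the set of values that the answer \<open>a\<close> shows to be critical.\<close>

lemma determinable_from_critical_values:
  fixes A :: "(real ^ 'n) set \<Rightarrow> real ^ 'n \<Rightarrow> 'a" and T :: "'a \<Rightarrow> real set"
    and \<K> :: "(real ^ 'n) set set set" and W :: "(real ^ 'n) set" and crit :: "(real ^ 'n) set set \<Rightarrow> real ^ 'n \<Rightarrow> real \<Rightarrow> bool"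
  assumes \<delta>: "0 < \<delta>" "\<delta> < pi"
    and W: "finite W" "W \<subseteq> sphere 0 1" "\<forall>v\<in>sphere 0 1. \<exists>w\<in>W. dist v w \<le> \<delta> / 8"
    and complex: "\<And>K. K \<in> \<K> \<Longrightarrow> simplicial_complex K"
    and T_crit: "\<And>K v t. K \<in> \<K> \<Longrightarrow> t \<in> T (A (\<Union>K) v) \<Longrightarrow> crit K v t"
    and crit_vertex: "\<And>K v t. K \<in> \<K> \<Longrightarrow> crit K v t \<Longrightarrow> \<exists>x\<in>vertices K. v \<bullet> x = t"
    and observable: "\<And>K x. K \<in> \<K> \<Longrightarrow> x \<in> vertices K \<Longrightarrow>
      \<exists>v\<^sub>x\<in>sphere 0 1. \<forall>v\<in>geodesic_ball v\<^sub>x \<delta>. v \<bullet> x \<in> T (A (\<Union>K) v)"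
    and few: "\<And>K v. K \<in> \<K> \<Longrightarrow> v \<in> sphere 0 1 \<Longrightarrow>
      card {x \<in> vertices K. \<exists>w\<in>geodesic_ball v \<delta>. crit K w (w \<bullet> x)} \<le> k"
    and count: "\<And>K K' v t. K \<in> \<K> \<Longrightarrow> K' \<in> \<K> \<Longrightarrow> A (\<Union>K) v = A (\<Union>K') v \<Longrightarrow> cell_count K v t = cell_count K' v t"
    and \<Delta>: "real (card W * ((CARD('n) - 1) * k + 1) + 2 * ((k * card W)\<^sup>2 + 1) ^ (CARD('n) - 1)) \<le> \<Delta>"
  shows "determinable A \<K> \<Delta>"
proof -
  define m where "m = (CARD('n) - 1) * k + 1"
  have "0 < CARD('n)" by simp
  then have m: "m \<le> 1 \<or> CARD('n) \<ge> 2" unfolding m_def by (cases "CARD('n) = 1") auto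
  define gen where "gen w U \<longleftrightarrow> finite U \<and> card U = m \<and> U \<subseteq> sphere 0 1 \<inter> cball w (\<delta> / 8) \<and>
    (\<forall>S\<subseteq>U. card S \<le> CARD('n) \<longrightarrow> independent S)" for w and U :: "(real ^ 'n) set"
  define U where "U w = (SOME U. gen w U)" for w :: "real ^ 'n"
  have U: "gen w (U w)" if "w \<in> W" for w :: "real ^ 'n"
  proof -
    have "norm w = 1" using W(2) that by auto
    then have "\<exists>U. gen w U" unfolding gen_def using general_position_directions[OF _ _ m] \<delta> by simp
    then show ?thesis unfolding U_def by (rule someI_ex)
  qed
  have Ufin: "finite (U w)" and Ucard: "card (U w) = m" and Usph: "U w \<subseteq> sphere 0 1"
    and Unear: "\<And>u. u \<in> U w \<Longrightarrow> dist w u \<le> \<delta> / 8"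
    and Uind: "\<forall>S\<subseteq>U w. card S \<le> CARD('n) \<longrightarrow> independent S" if "w \<in> W" for w
    using U[OF that] unfolding gen_def by auto
  have Uball: "u \<in> geodesic_ball v \<delta>" if "w \<in> W" "u \<in> U w" "norm v = 1" "dist v w \<le> \<delta> / 8" for u v w
  proof (rule geodesic_ball_dist[OF _ that(3) \<delta>])
    show "norm u = 1" using Usph[OF that(1)] that(2) by auto
    show "dist v u \<le> \<delta> / 4" using Unear[OF that(1,2)] that(4) dist_triangle[of v u w] by simp
  qed
  \<comment> \<open>The vertex set as a function of the answers. Only values at directions in the
    clusters \<open>U w\<close> are consulted, so the first stage of queries determines it.\<close>
  define X where "X g = {x. \<exists>w\<in>W. \<forall>u\<in>U w. u \<bullet> x \<in> T (g u)}" for g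
  have candidate: "x \<in> vertices K \<and> (\<exists>u\<in>geodesic_ball w \<delta>. crit K u (u \<bullet> x))"
    if K: "K \<in> \<K>" and w: "w \<in> W" and x: "\<forall>u\<in>U w. u \<bullet> x \<in> T (A (\<Union>K) u)" for K w x
  proof -
    have w1: "norm w = 1" using W(2) w by auto
    let ?Y = "{x \<in> vertices K. \<exists>u\<in>geodesic_ball w \<delta>. crit K u (u \<bullet> x)}"
    have finY: "finite ?Y" using finite_vertices[OF complex[OF K]] by simp
    have Yk: "card ?Y \<le> k" by (rule few[OF K]) (use w1 in simp)
    have hit: "\<exists>y\<in>?Y. u \<bullet> y = u \<bullet> x" if u: "u \<in> U w" for u
    proof -
      have c: "crit K u (u \<bullet> x)" using T_crit[OF K] x u by blast
      then obtain y where y: "y \<in> vertices K" "u \<bullet> y = u \<bullet> x" using crit_vertex[OF K] by blast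
      have "u \<in> geodesic_ball w \<delta>" by (rule Uball[OF w u w1]) (use \<delta> in simp)
      moreover have "crit K u (u \<bullet> y)" using c y(2) by simp
      ultimately show ?thesis using y by blast
    qed
    have "x \<in> ?Y"
    proof (rule ccontr)
      assume "x \<notin> ?Y"
      \<comment> \<open>By general position, a vertex other than \<open>x\<close> has the height of
        \<open>x\<close> in fewer than \<open>CARD('n)\<close> directions of the cluster, so
        \<open>k\<close> of them cannot cover it.\<close>
      have small: "card {u \<in> U w. u \<bullet> (y - x) = 0} \<le> CARD('n) - 1" if "y \<in> ?Y" for y
      proof -
        have "y - x \<noteq> 0" using that \<open>x \<notin> ?Y\<close> by auto
        from independent_orthogonal_card[OF Ufin[OF w] Uind[OF w] this] show ?thesis by simp
      qed
      have "U w \<subseteq> (\<Union>y\<in>?Y. {u \<in> U w. u \<bullet> (y - x) = 0})"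
      proof
        fix u assume u: "u \<in> U w"
        from hit[OF u] obtain y where "y \<in> ?Y" "u \<bullet> y = u \<bullet> x" by blast
        then show "u \<in> (\<Union>y\<in>?Y. {u \<in> U w. u \<bullet> (y - x) = 0})" using u by (auto simp: inner_diff_right)
      qed
      moreover have "finite (\<Union>y\<in>?Y. {u \<in> U w. u \<bullet> (y - x) = 0})" using finY Ufin[OF w] by simp
      ultimately have "card (U w) \<le> card (\<Union>y\<in>?Y. {u \<in> U w. u \<bullet> (y - x) = 0})" by (rule card_mono[rotated])
      also have "\<dots> \<le> (\<Sum>y\<in>?Y. card {u \<in> U w. u \<bullet> (y - x) = 0})" by (rule card_UN_le[OF finY])
      also have "\<dots> \<le> card ?Y * (CARD('n) - 1)" 
        using sum_bounded_above[of ?Y "\<lambda>y. card {u \<in> U w. u \<bullet> (y - x) = 0}", OF small] by simp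
      also have "\<dots> \<le> k * (CARD('n) - 1)" using Yk by (rule mult_le_mono1)
      finally show False unfolding Ucard[OF w] m_def by (simp add: mult.commute)
    qed
    then show ?thesis by simp
  qed
  have X: "X (A (\<Union>K)) = vertices K" if K: "K \<in> \<K>" for K
  proof (intro equalityI subsetI)
    fix x assume "x \<in> X (A (\<Union>K))"
    then obtain w where "w \<in> W" "\<forall>u\<in>U w. u \<bullet> x \<in> T (A (\<Union>K) u)" unfolding X_def by blast
    from candidate[OF K this] show "x \<in> vertices K" by simp
  next
    fix x assume "x \<in> vertices K"
    from observable[OF K this] obtain v where v: "v \<in> sphere 0 1" "\<forall>u\<in>geodesic_ball v \<delta>. u \<bullet> x \<in> T (A (\<Union>K) u)"
      by blast
    obtain w where w: "w \<in> W" "dist v w \<le> \<delta> / 8" using W(3) v(1) by blast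
    have "u \<bullet> x \<in> T (A (\<Union>K) u)" if u: "u \<in> U w" for u
      using v(2) Uball[OF w(1) u _ w(2)] v(1) by simp
    then show "x \<in> X (A (\<Union>K))" unfolding X_def using w(1) by blast
  qed
  \<comment> \<open>Summing the bound of condition (2) over the net makes the length of the second
    stage bounded independently of \<open>K\<close>.\<close>
  have Xcard: "card (vertices K) \<le> k * card W" if K: "K \<in> \<K>" for K
  proof -
    let ?Y = "\<lambda>w. {x \<in> vertices K. \<exists>u\<in>geodesic_ball w \<delta>. crit K u (u \<bullet> x)}"
    have "vertices K \<subseteq> (\<Union>w\<in>W. ?Y w)"
    proof
      fix x assume "x \<in> vertices K"
      then have "x \<in> X (A (\<Union>K))" using X[OF K] by simp
      then obtain w where w: "w \<in> W" "\<forall>u\<in>U w. u \<bullet> x \<in> T (A (\<Union>K) u)" unfolding X_def by blast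
      from candidate[OF K this] have "x \<in> ?Y w" by simp
      then show "x \<in> (\<Union>w\<in>W. ?Y w)" using w(1) by blast
    qed
    moreover have "finite (\<Union>w\<in>W. ?Y w)" using W(1) finite_vertices[OF complex[OF K]] by simp
    ultimately have "card (vertices K) \<le> card (\<Union>w\<in>W. ?Y w)" by (rule card_mono[rotated])
    also have "\<dots> \<le> (\<Sum>w\<in>W. card (?Y w))" by (rule card_UN_le[OF W(1)])
    also have "\<dots> \<le> card W * k"
    proof -
      have "card (?Y w) \<le> k" if "w \<in> W" for w by (rule few[OF K]) (use W(2) that in blast)
      from sum_bounded_above[of W "\<lambda>w. card (?Y w)", OF this] show ?thesis by simp
    qed
    finally show ?thesis by (simp add: mult.commute)
  qed
  have "finite (\<Union>w\<in>W. U w)" using W(1) Ufin by simp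
  then obtain L1 where L1: "set L1 = (\<Union>w\<in>W. U w)" "distinct L1" using finite_distinct_list by blast
  have L1_len: "length L1 \<le> card W * m"
  proof -
    have "length L1 = card (\<Union>w\<in>W. U w)" using distinct_card[OF L1(2)] L1(1) by simp
    also have "\<dots> \<le> (\<Sum>w\<in>W. card (U w))" by (rule card_UN_le[OF W(1)])
    also have "\<dots> = card W * m" using Ucard by simp
    finally show ?thesis .
  qed
  have L1_sph: "set L1 \<subseteq> sphere 0 1" unfolding L1(1) using Usph by blast
  \<comment> \<open>The signs of a direction on the differences encode the order of the vertex
    heights; nonzero signs mean that no two vertices share a height.\<close>
  define Z where "Z V = (\<lambda>(x, y). x - y) ` {(x, y). x \<in> V \<and> y \<in> V \<and> x \<noteq> y}" for V :: "(real ^ 'n) set"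
  have Z: "finite (Z V)" "card (Z V) \<le> (card V)\<^sup>2" if "finite V" for V
  proof -
    have sub: "{(x, y). x \<in> V \<and> y \<in> V \<and> x \<noteq> y} \<subseteq> V \<times> V" by auto
    have fin: "finite (V \<times> V)" using that by simp
    show "finite (Z V)" unfolding Z_def using finite_subset[OF sub fin] by simp
    have "card (Z V) \<le> card {(x, y). x \<in> V \<and> y \<in> V \<and> x \<noteq> y}"
      unfolding Z_def by (rule card_image_le[OF finite_subset[OF sub fin]])
    also have "\<dots> \<le> card (V \<times> V)" by (rule card_mono[OF fin sub])
    finally show "card (Z V) \<le> (card V)\<^sup>2" by (simp add: card_cartesian_product power2_eq_square)
  qed
  define ok where "ok V l \<longleftrightarrow> set l \<subseteq> sphere 0 1 \<and> length l \<le> 2 * ((card V)\<^sup>2 + 1) ^ (CARD('n) - 1) \<and>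
    (\<forall>v. (\<forall>z\<in>Z V. v \<bullet> z \<noteq> 0) \<longrightarrow> (\<exists>r\<in>set l. \<forall>z\<in>Z V. r \<bullet> z \<noteq> 0 \<and> (v \<bullet> z > 0 \<longleftrightarrow> r \<bullet> z > 0)))" for V l
  \<comment> \<open>One list is fixed for each possible vertex set, so the second stage depends on
    the answers through the vertex set alone.\<close>
  define L2 where "L2 V = (SOME l. ok V l)" for V
  have L2: "ok V (L2 V)" if V: "finite V" for V
  proof -
    obtain R where R: "finite R" "R \<subseteq> sphere 0 1" "card R \<le> 2 * (card (Z V) + 1) ^ (CARD('n) - 1)"
      "\<forall>v. (\<forall>z\<in>Z V. v \<bullet> z \<noteq> 0) \<longrightarrow> (\<exists>r\<in>R. \<forall>z\<in>Z V. r \<bullet> z \<noteq> 0 \<and> (v \<bullet> z > 0 \<longleftrightarrow> r \<bullet> z > 0))"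
      using chamber_directions[OF Z(1)[OF V]] by blast
    obtain l where l: "set l = R" "distinct l" using finite_distinct_list[OF R(1)] by blast
    have "length l = card R" using distinct_card[OF l(2)] l(1) by simp
    also have "\<dots> \<le> 2 * (card (Z V) + 1) ^ (CARD('n) - 1)" by (rule R(3))
    also have "\<dots> \<le> 2 * ((card V)\<^sup>2 + 1) ^ (CARD('n) - 1)" using Z(2)[OF V] by (intro mult_le_mono power_mono) auto
    finally have "ok V l" unfolding ok_def using R(2,4) l(1) by simp
    then show ?thesis unfolding L2_def by (rule someI)
  qed
  \<comment> \<open>The answers arrive as a list; \<open>map_of\<close> turns it back into a
    function that agrees with the transform on the queried directions.\<close>
  define P where "P = ask_all L1 (\<lambda>as. ask_all (L2 (X (\<lambda>u. the (map_of (zip L1 as) u)))) (\<lambda>_. Stop))"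
  have tr: "transcript P (A (\<Union>K)) = map (\<lambda>v. (v, A (\<Union>K) v)) (L1 @ L2 (vertices K))" if K: "K \<in> \<K>" for K
  proof -
    have "the (map_of (zip L1 (map (A (\<Union>K)) L1)) u) = A (\<Union>K) u" if "w \<in> W" "u \<in> U w" for w u
    proof -
      have "u \<in> set L1" unfolding L1(1) using that by blast
      then show ?thesis by (simp add: map_of_zip_map)
    qed
    then have "X (\<lambda>u. the (map_of (zip L1 (map (A (\<Union>K)) L1)) u)) = X (A (\<Union>K))" unfolding X_def by simp
    then show ?thesis unfolding P_def transcript_ask_all X[OF K] by simp
  qed
  have fst_map: "fst ` set (map (\<lambda>v. (v, f v)) l) = set l" for f :: "real ^ 'n \<Rightarrow> 'a" and l by force
  have "fst ` set (transcript P (A (\<Union>K))) \<subseteq> sphere 0 1 \<and> real (length (transcript P (A (\<Union>K)))) \<le> \<Delta>"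
    if K: "K \<in> \<K>" for K
  proof -
    have ok: "ok (vertices K) (L2 (vertices K))" by (rule L2[OF finite_vertices[OF complex[OF K]]])
    have "length (L1 @ L2 (vertices K)) \<le> card W * m + 2 * ((card (vertices K))\<^sup>2 + 1) ^ (CARD('n) - 1)"
      using L1_len ok unfolding ok_def by simp
    also have "\<dots> \<le> card W * m + 2 * ((k * card W)\<^sup>2 + 1) ^ (CARD('n) - 1)"
      using Xcard[OF K] by (intro add_mono mult_le_mono power_mono) auto
    finally have "real (length (L1 @ L2 (vertices K))) \<le> \<Delta>" using \<Delta> unfolding m_def by linarith
    moreover have "set (L1 @ L2 (vertices K)) \<subseteq> sphere 0 1" using L1_sph ok unfolding ok_def by simp
    ultimately show ?thesis unfolding tr[OF K] fst_map by simp
  qed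
  moreover have "\<Union>K = \<Union>K'" if K: "K \<in> \<K>" "K' \<in> \<K>" and eq: "transcript P (A (\<Union>K)) = transcript P (A (\<Union>K'))" for K K'
  proof -
    note sc = complex[OF K(1)] complex[OF K(2)]
    let ?V = "vertices K"
    have eq': "map (\<lambda>v. (v, A (\<Union>K) v)) (L1 @ L2 (vertices K)) = map (\<lambda>v. (v, A (\<Union>K') v)) (L1 @ L2 (vertices K'))"
      using eq unfolding tr[OF K(1)] tr[OF K(2)] .
    then have lists: "L1 @ L2 (vertices K) = L1 @ L2 (vertices K')"
      by (metis (no_types, lifting) fst_conv list.map_comp list.map_ident_strong comp_apply)
    have same: "A (\<Union>K) v = A (\<Union>K') v" if "v \<in> set (L1 @ L2 (vertices K))" for v
      using eq'[folded lists] that by (simp only: map_eq_conv) simp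
    have "X (A (\<Union>K)) = X (A (\<Union>K'))"
    proof -
      have "A (\<Union>K) u = A (\<Union>K') u" if "w \<in> W" "u \<in> U w" for w u
        by (rule same) (use that L1(1) in auto)
      then show ?thesis unfolding X_def by simp
    qed
    then have V': "vertices K' = ?V" using X[OF K(1)] X[OF K(2)] by simp
    have ok: "ok ?V (L2 ?V)" by (rule L2[OF finite_vertices[OF sc(1)]])
    let ?G = "{v. \<forall>z\<in>Z ?V. v \<bullet> z \<noteq> 0}"
    have "closure ?G = UNIV"
    proof (rule dense_generic)
      show "finite (Z ?V)" by (rule Z(1)[OF finite_vertices[OF sc(1)]])
    qed (auto simp: Z_def)
    moreover have "cell_count K v t = cell_count K' v t" if v: "v \<in> ?G" for v t
    proof -
      obtain r where r: "r \<in> set (L2 ?V)" "\<forall>z\<in>Z ?V. r \<bullet> z \<noteq> 0 \<and> (v \<bullet> z > 0 \<longleftrightarrow> r \<bullet> z > 0)"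
        using ok v unfolding ok_def by blast
      have order: "v \<bullet> x \<le> v \<bullet> y \<longleftrightarrow> r \<bullet> x \<le> r \<bullet> y" if xy: "x \<in> ?V" "y \<in> ?V" for x y
      proof (cases "x = y")
        case False
        then have "x - y \<in> Z ?V" using xy unfolding Z_def by force
        then have "v \<bullet> (x - y) > 0 \<longleftrightarrow> r \<bullet> (x - y) > 0" using r(2) by blast
        then show ?thesis by (auto simp: inner_diff_right)
      qed simp
      from same_order_threshold[OF sc(1) order] obtain s where s: "\<And>x. x \<in> ?V \<Longrightarrow> v \<bullet> x \<le> t \<longleftrightarrow> r \<bullet> x \<le> s"
        by metis
      \<comment> \<open>The representative \<open>r\<close> was queried for both complexes. They
        share their vertices, so the same pair \<open>r\<close>, \<open>s\<close> replaces
        \<open>v\<close>, \<open>t\<close> in both counts.\<close>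
      have "cell_count K r s = cell_count K' r s" by (rule count[OF K same]) (use r(1) in simp)
      moreover have "cell_count K v t = cell_count K r s" by (rule lower_cells_order(2)[OF sc(1) s])
      moreover have "cell_count K' v t = cell_count K' r s"
        by (rule lower_cells_order(2)[OF sc(2)]) (use s V' in simp)
      ultimately show ?thesis by simp
    qed
    ultimately have "cell_count K v t = cell_count K' v t" for v t
      by (rule cell_count_dense[OF sc])
    then show ?thesis by (rule cell_count_determines_shape[OF sc])
  qed
  ultimately show ?thesis unfolding determinable_def by (intro exI[of _ P]) blast
qed

text \<open>The size of the net in the form required by the error term. For
  \<open>CARD('n) = 1\<close> no power of \<open>1 / \<delta>\<close> is allowed, so the sphere
  itself, two points, is the net. Otherwise \<delta> < 4 absorbs the additive constant of the grid
  bound.\<close>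

lemma sphere_net:
  "\<exists>C\<ge>0. \<forall>\<delta>::real. 0 < \<delta> \<and> \<delta> < pi \<longrightarrow> (\<exists>W :: (real ^ 'n) set. finite W \<and> W \<subseteq> sphere 0 1 \<and>
     (\<forall>v\<in>sphere 0 1. \<exists>w\<in>W. dist v w \<le> \<delta> / 8) \<and>
     real (card W) \<le> C / \<delta> ^ (if CARD('n) = 1 then 0 else CARD('n)))"
proof (cases "CARD('n) = 1")
  case True
  then obtain i :: 'n where i: "UNIV = {i}" by (meson card_1_singletonE)
  have "sphere 0 1 \<subseteq> {vec 1, vec (-1) :: real ^ 'n}"
  proof
    fix v :: "real ^ 'n" assume "v \<in> sphere 0 1"
    then have "norm v = 1" by simp
    then have "\<bar>v $ i\<bar> = 1" unfolding norm_vec_def L2_set_def i by simp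
    moreover have "v = vec (v $ i)" unfolding vec_eq_iff using i by (metis UNIV_I singletonD vec_component)
    ultimately show "v \<in> {vec 1, vec (-1)}" by (metis abs_eq_iff' abs_one insertCI)
  qed
  then have fin: "finite (sphere 0 1 :: (real ^ 'n) set)" by (rule finite_subset) simp
  show ?thesis
  proof (intro exI[of _ "real (card (sphere 0 1 :: (real ^ 'n) set))"] conjI allI impI)
    fix \<delta> :: real assume "0 < \<delta> \<and> \<delta> < pi"
    then have "\<forall>v\<in>sphere 0 1. \<exists>w\<in>sphere 0 1. dist v w \<le> \<delta> / 8" for v :: "real ^ 'n"
      by (metis dist_self divide_nonneg_pos less_imp_le zero_less_numeral)
    then show "\<exists>W :: (real ^ 'n) set. finite W \<and> W \<subseteq> sphere 0 1 \<and> (\<forall>v\<in>sphere 0 1. \<exists>w\<in>W. dist v w \<le> \<delta> / 8) \<and>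
       real (card W) \<le> real (card (sphere 0 1 :: (real ^ 'n) set)) / \<delta> ^ (if CARD('n) = 1 then 0 else CARD('n))"
      using fin True by (intro exI[of _ "sphere 0 1"]) auto
  qed simp
next
  case False
  let ?d = "real CARD('n)"
  show ?thesis
  proof (intro exI[of _ "(16 * ?d + 12) ^ CARD('n)"] conjI allI impI)
    fix \<delta> :: real assume \<delta>: "0 < \<delta> \<and> \<delta> < pi"
    obtain W :: "(real ^ 'n) set" where W: "finite W" "W \<subseteq> sphere 0 1"
      "real (card W) \<le> (2 * ?d / (\<delta> / 8) + 3) ^ CARD('n)" "\<forall>v\<in>sphere 0 1. \<exists>w\<in>W. dist v w \<le> \<delta> / 8"
      using sphere_net_grid[of "\<delta> / 8", where 'n = 'n] \<delta> by auto
    have "3 * \<delta> \<le> 12" using \<delta> pi_less_4 by linarith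
    then have "2 * ?d / (\<delta> / 8) + 3 \<le> (16 * ?d + 12) / \<delta>" using \<delta> by (simp add: field_simps)
    then have "(2 * ?d / (\<delta> / 8) + 3) ^ CARD('n) \<le> ((16 * ?d + 12) / \<delta>) ^ CARD('n)" using \<delta> by (intro power_mono) auto
    then have "real (card W) \<le> (16 * ?d + 12) ^ CARD('n) / \<delta> ^ CARD('n)" using W(3) by (simp add: power_divide)
    then show "\<exists>W :: (real ^ 'n) set. finite W \<and> W \<subseteq> sphere 0 1 \<and> (\<forall>v\<in>sphere 0 1. \<exists>w\<in>W. dist v w \<le> \<delta> / 8) \<and>
       real (card W) \<le> (16 * ?d + 12) ^ CARD('n) / \<delta> ^ (if CARD('n) = 1 then 0 else CARD('n))"
      using W False by (intro exI[of _ W]) simp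
  qed simp
qed

text \<open>Both query stages are bounded by multiples of the error term. The bound
  \<open>\<delta> < 4\<close> trades missing factors \<open>1 / \<delta>\<close> for powers of 4,
  and \<open>1 \<le> d\<close> and \<open>1 \<le> k\<close> allow powers of \<open>d\<close> and
  \<open>k\<close> to be raised.\<close>

lemma direction_count_bound:
  fixes d k N :: nat and C \<delta> :: real
  assumes d: "1 \<le> d" and k: "1 \<le> k" and \<delta>: "0 < \<delta>" "\<delta> < 4" and C: "0 \<le> C"
    and N: "real N \<le> C / \<delta> ^ e" and e: "e = (if d = 1 then 0 else d)"
  shows "real (N * ((d - 1) * k + 1) + 2 * ((k * N)\<^sup>2 + 1) ^ (d - 1)) \<le>
    (C * 4 ^ (2 * d * (d - 1)) + 2 * (C\<^sup>2 + 16 ^ e) ^ (d - 1)) * (real d ^ (d + 1) * real k ^ (2 * d) / \<delta> ^ (2 * d * (d - 1)))"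
proof -
  let ?p = "2 * d * (d - 1)"
  let ?B = "real d ^ (d + 1) * real k ^ (2 * d)"
  have ep: "e \<le> ?p"
  proof (cases "d = 1")
    case False
    then have "1 \<le> 2 * (d - 1)" using d by simp
    from mult_le_mono2[OF this, of d] show ?thesis using False e by (simp add: ac_simps)
  qed (simp add: e)
  \<comment> \<open>The second stage raises the squared net size to the power \<open>d - 1\<close>;
    this is the source of the exponent of \<delta> in the error term.\<close>
  have pe: "2 * e * (d - 1) = ?p" using e by simp
  have dk: "real d * real k \<le> ?B" 
  proof (rule mult_mono)
    show "real d \<le> real d ^ (d + 1)" using d by (simp add: self_le_power)
    show "real k \<le> real k ^ (2 * d)" using d k by (simp add: self_le_power)
  qed auto
  have B: "real k ^ (2 * (d - 1)) \<le> ?B"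
  proof -
    have "real k ^ (2 * (d - 1)) \<le> real k ^ (2 * d)" using k by (intro power_increasing) auto
    also have "\<dots> = 1 * real k ^ (2 * d)" by simp
    also have "\<dots> \<le> ?B" using d by (intro mult_right_mono one_le_power) auto
    finally show ?thesis .
  qed
  have "1 / \<delta> ^ e \<le> 4 ^ ?p / \<delta> ^ ?p"
  proof -
    have "\<delta> ^ ?p = \<delta> ^ e * \<delta> ^ (?p - e)" using ep by (simp flip: power_add)
    also have "\<dots> \<le> \<delta> ^ e * 4 ^ (?p - e)" using \<delta> by (intro mult_left_mono power_mono) auto
    also have "\<dots> \<le> \<delta> ^ e * 4 ^ ?p" using \<delta> by (intro mult_left_mono power_increasing) auto
    finally show ?thesis using \<delta> by (simp add: field_simps)
  qed
  then have "C * (1 / \<delta> ^ e) \<le> C * (4 ^ ?p / \<delta> ^ ?p)" using C by (rule mult_left_mono)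
  then have N': "real N \<le> C * 4 ^ ?p / \<delta> ^ ?p" using N by simp
  have "real ((d - 1) * k + 1) \<le> real d * real k"
  proof -
    have "(d - 1) * k + 1 \<le> d * k" using d k by (cases d) auto
    then show ?thesis by (metis of_nat_le_iff of_nat_mult)
  qed
  then have "real ((d - 1) * k + 1) \<le> ?B" using dk by linarith
  then have "real N * real ((d - 1) * k + 1) \<le> (C * 4 ^ ?p / \<delta> ^ ?p) * ?B"
    using N' C \<delta> by (intro mult_mono) auto
  then have 1: "real N * real ((d - 1) * k + 1) \<le> C * 4 ^ ?p * (?B / \<delta> ^ ?p)" by simp
  have "(real k * real N)\<^sup>2 + 1 \<le> (real k)\<^sup>2 * (C\<^sup>2 + 16 ^ e) / \<delta> ^ (2 * e)"
  proof -
    have "(real k * real N)\<^sup>2 \<le> (real k * (C / \<delta> ^ e))\<^sup>2" using N by (intro power_mono mult_left_mono) auto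
    also have "\<dots> = (real k)\<^sup>2 * C\<^sup>2 / \<delta> ^ (2 * e)" by (simp add: power_mult_distrib power_divide power_mult[symmetric] mult.commute)
    finally have a: "(real k * real N)\<^sup>2 \<le> (real k)\<^sup>2 * C\<^sup>2 / \<delta> ^ (2 * e)" .
    have "\<delta> ^ (2 * e) \<le> 4 ^ (2 * e)" using \<delta> by (intro power_mono) auto
    also have "\<dots> = (16::real) ^ e" by (simp add: power_mult)
    also have "\<dots> \<le> (real k)\<^sup>2 * 16 ^ e" using k by (simp add: mult_le_cancel_right1)
    finally have "1 \<le> (real k)\<^sup>2 * 16 ^ e / \<delta> ^ (2 * e)" using \<delta> by simp
    with a show ?thesis by (simp add: distrib_left add_divide_distrib)
  qed
  then have "((real k * real N)\<^sup>2 + 1) ^ (d - 1) \<le> ((real k)\<^sup>2 * (C\<^sup>2 + 16 ^ e) / \<delta> ^ (2 * e)) ^ (d - 1)"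
    by (intro power_mono) auto
  also have "\<dots> = (C\<^sup>2 + 16 ^ e) ^ (d - 1) * (real k ^ (2 * (d - 1)) / \<delta> ^ ?p)"
    unfolding pe[symmetric] by (simp add: power_mult_distrib power_divide power_mult[symmetric])
  also have "\<dots> \<le> (C\<^sup>2 + 16 ^ e) ^ (d - 1) * (?B / \<delta> ^ ?p)"
    using B \<delta> by (intro mult_left_mono divide_right_mono) auto
  finally have 2: "((real k * real N)\<^sup>2 + 1) ^ (d - 1) \<le> (C\<^sup>2 + 16 ^ e) ^ (d - 1) * (?B / \<delta> ^ ?p)" .
  have "real (N * ((d - 1) * k + 1) + 2 * ((k * N)\<^sup>2 + 1) ^ (d - 1)) =
      real N * real ((d - 1) * k + 1) + 2 * ((real k * real N)\<^sup>2 + 1) ^ (d - 1)"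
    by (simp only: of_nat_add of_nat_mult of_nat_power of_nat_numeral of_nat_1)
  also have "\<dots> \<le> C * 4 ^ ?p * (?B / \<delta> ^ ?p) + 2 * ((C\<^sup>2 + 16 ^ e) ^ (d - 1) * (?B / \<delta> ^ ?p))"
    using 1 2 by linarith
  also have "\<dots> = (C * 4 ^ ?p + 2 * (C\<^sup>2 + 16 ^ e) ^ (d - 1)) * (?B / \<delta> ^ ?p)"
    by (simp only: distrib_right mult.assoc)
  finally show ?thesis .
qed

theorem theorem7p14:
  shows "\<exists>C :: real. \<forall>(F :: 'f ring) (\<delta> :: real) (k :: nat).
    field F \<and> 0 < \<delta> \<and> \<delta> < pi \<and> 0 < k \<longrightarrow>
    (let d = CARD('n::finite);
         \<Delta> = ((real d - 1) * real k + 1) * (1 + 3 / \<delta>) ^ d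
             + C * (real d ^ (d + 1) * real k ^ (2 * d) / \<delta> ^ (2 * d * (d - 1)))
     in determinable (ECT F) (euler_complexes F \<delta> k :: (real ^ 'n) set set set) \<Delta> \<and>
        determinable (PHT F) (homology_complexes F \<delta> k :: (real ^ 'n) set set set) \<Delta>)"
proof -
  let ?d = "CARD('n)"
  define e where "e = (if ?d = 1 then 0 else ?d)"
  obtain C :: real where C0: "0 \<le> C" and C: "\<forall>\<delta>. 0 < \<delta> \<and> \<delta> < pi \<longrightarrow> (\<exists>W :: (real ^ 'n) set. finite W \<and> W \<subseteq> sphere 0 1 \<and>
     (\<forall>v\<in>sphere 0 1. \<exists>w\<in>W. dist v w \<le> \<delta> / 8) \<and> real (card W) \<le> C / \<delta> ^ e)"
    using sphere_net[where 'n = 'n, folded e_def] by (elim exE conjE) (rule that; assumption)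
  \<comment> \<open>Built from \<open>C\<close> and \<open>e\<close>, hence from the dimension
    alone, so that it is fixed before \<open>F\<close>, \<open>\<delta>\<close> and
    \<open>k\<close>.\<close>
  define C' where "C' = C * 4 ^ (2 * ?d * (?d - 1)) + 2 * (C\<^sup>2 + 16 ^ e) ^ (?d - 1)"
  show ?thesis
  proof (intro exI[of _ C'] allI impI)
    fix F :: "'f ring" and \<delta> :: real and k :: nat
    assume a: "field F \<and> 0 < \<delta> \<and> \<delta> < pi \<and> 0 < k"
    then have \<delta>: "0 < \<delta>" "\<delta> < pi" by simp_all
    interpret coeff_field F using a by (simp add: coeff_field_def)
    define \<Delta> where "\<Delta> = ((real ?d - 1) * real k + 1) * (1 + 3 / \<delta>) ^ ?d
      + C' * (real ?d ^ (?d + 1) * real k ^ (2 * ?d) / \<delta> ^ (2 * ?d * (?d - 1)))"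
    obtain W :: "(real ^ 'n) set" where W: "finite W" "W \<subseteq> sphere 0 1" "\<forall>v\<in>sphere 0 1. \<exists>w\<in>W. dist v w \<le> \<delta> / 8"
      and cW: "real (card W) \<le> C / \<delta> ^ e" 
      using C[rule_format, OF conjI[OF \<delta>]] by (elim exE conjE) (rule that; assumption)
    have bound: "real (card W * ((?d - 1) * k + 1) + 2 * ((k * card W)\<^sup>2 + 1) ^ (?d - 1)) \<le> \<Delta>"
    proof -
      have "real (card W * ((?d - 1) * k + 1) + 2 * ((k * card W)\<^sup>2 + 1) ^ (?d - 1)) \<le>
          C' * (real ?d ^ (?d + 1) * real k ^ (2 * ?d) / \<delta> ^ (2 * ?d * (?d - 1)))"
        unfolding C'_def
        by (rule direction_count_bound[OF _ _ \<delta>(1) _ C0 cW e_def]) (use a pi_less_4 in \<open>auto simp: Suc_le_eq\<close>)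
      moreover have "0 \<le> ((real ?d - 1) * real k + 1) * (1 + 3 / \<delta>) ^ ?d"
        using \<delta> by (intro mult_nonneg_nonneg add_nonneg_nonneg zero_le_power) (auto simp: Suc_le_eq)
      ultimately show ?thesis unfolding \<Delta>_def by linarith
    qed
    have "determinable (ECT F) (euler_complexes F \<delta> k :: (real ^ 'n) set set set) \<Delta>"
    \<comment> \<open>For Euler curves the values shown by an answer are exactly the critical ones,
      so \<open>T\<close> and \<open>crit\<close> agree.\<close>
    proof (rule determinable_from_critical_values[OF \<delta> W, where
          T = "\<lambda>g. {t. \<not> (\<exists>a b. a < t \<and> t < b \<and> g constant_on {a<..<b})}" and k = k and
          crit = "\<lambda>K v t. euler_critical F (\<Union>K) v t"])
      fix K K' :: "(real ^ 'n) set set" and v :: "real ^ 'n" and t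
      assume K: "K \<in> euler_complexes F \<delta> k"
      show sc: "simplicial_complex K" using K by (simp add: euler_complexes_def)
      show "t \<in> {t. \<not> (\<exists>a b. a < t \<and> t < b \<and> ECT F (\<Union>K) v constant_on {a<..<b})} \<Longrightarrow> euler_critical F (\<Union>K) v t"
        by (simp add: euler_critical_def)
      show "euler_critical F (\<Union>K) v t \<Longrightarrow> \<exists>x\<in>vertices K. v \<bullet> x = t" by (rule euler_critical_vertex[OF sc])
      show "v \<in> sphere 0 1 \<Longrightarrow> card {x \<in> vertices K. \<exists>w\<in>geodesic_ball v \<delta>. euler_critical F (\<Union>K) w (w \<bullet> x)} \<le> k"
        using K by (simp add: euler_complexes_def)
      show "v \<in> vertices K \<Longrightarrow> \<exists>v\<^sub>x\<in>sphere 0 1. \<forall>w\<in>geodesic_ball v\<^sub>x \<delta>.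
          w \<bullet> v \<in> {t. \<not> (\<exists>a b. a < t \<and> t < b \<and> ECT F (\<Union>K) w constant_on {a<..<b})}"
        using K unfolding euler_complexes_def euler_observable_def euler_critical_def by simp
      assume K': "K' \<in> euler_complexes F \<delta> k" and eq: "ECT F (\<Union>K) v = ECT F (\<Union>K') v"
      have "simplicial_complex K'" using K' by (simp add: euler_complexes_def)
      then show "cell_count K v t = cell_count K' v t" using fun_cong[OF eq, of t] by (simp add: ECT_eq sc)
    qed (rule bound)
    moreover have "determinable (PHT F) (homology_complexes F \<delta> k :: (real ^ 'n) set set set) \<Delta>"
    \<comment> \<open>Observability refers to coordinates of diagram points, condition (2) to
      homological critical values. \<open>T\<close> takes the former, \<open>crit\<close> the
      latter, and \<open>PH_value_critical\<close> links them.\<close>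
    proof (rule determinable_from_critical_values[OF \<delta> W, where
          T = "\<lambda>L. {t. \<exists>D\<in>set L. \<exists>(b, e)\<in>set_mset D. b = ereal t \<or> e = ereal t}" and k = k and
          crit = "\<lambda>K v t. homology_critical F (\<Union>K) v t"])
      fix K K' :: "(real ^ 'n) set set" and v :: "real ^ 'n" and t
      assume K: "K \<in> homology_complexes F \<delta> k"
      show sc: "simplicial_complex K" using K by (simp add: homology_complexes_def)
      show "homology_critical F (\<Union>K) v t"
        if t: "t \<in> {t. \<exists>D\<in>set (PHT F (\<Union>K) v). \<exists>(b, e)\<in>set_mset D. b = ereal t \<or> e = ereal t}"
      proof -
        obtain D b e where D: "D \<in> set (PHT F (\<Union>K) v)" "(b, e) \<in># D" "b = ereal t \<or> e = ereal t" using t by blast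
        obtain p where "D = PH F p (\<Union>K) v" using D(1) unfolding PHT_def by auto
        then show ?thesis using PH_value_critical[OF sc] D(2,3) by blast
      qed
      show "homology_critical F (\<Union>K) v t \<Longrightarrow> \<exists>x\<in>vertices K. v \<bullet> x = t" by (rule homology_critical_vertex[OF sc])
      show "v \<in> sphere 0 1 \<Longrightarrow> card {x \<in> vertices K. \<exists>w\<in>geodesic_ball v \<delta>. homology_critical F (\<Union>K) w (w \<bullet> x)} \<le> k"
        using K by (simp add: homology_complexes_def)
      show "v \<in> vertices K \<Longrightarrow> \<exists>v\<^sub>x\<in>sphere 0 1. \<forall>w\<in>geodesic_ball v\<^sub>x \<delta>.
          w \<bullet> v \<in> {t. \<exists>D\<in>set (PHT F (\<Union>K) w). \<exists>(b, e)\<in>set_mset D. b = ereal t \<or> e = ereal t}"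
        using K unfolding homology_complexes_def homology_observable_def homology_observable_in_def by simp
      assume K': "K' \<in> homology_complexes F \<delta> k" and eq: "PHT F (\<Union>K) v = PHT F (\<Union>K') v"
      have "simplicial_complex K'" using K' by (simp add: homology_complexes_def)
      from PHT_determines_cell_count[OF sc this eq] show "cell_count K v t = cell_count K' v t" .
    qed (rule bound)
    ultimately show "let d = ?d;
         \<Delta> = ((real d - 1) * real k + 1) * (1 + 3 / \<delta>) ^ d
             + C' * (real d ^ (d + 1) * real k ^ (2 * d) / \<delta> ^ (2 * d * (d - 1)))
     in determinable (ECT F) (euler_complexes F \<delta> k :: (real ^ 'n) set set set) \<Delta> \<and>
        determinable (PHT F) (homology_complexes F \<delta> k :: (real ^ 'n) set set set) \<Delta>"
      unfolding Let_def \<Delta>_def by blast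
  qed
qed

end
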